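(* Let $\Sigma$ be a standard SLDS with modes $\ker R_1(\frac{d}{dt})$, $\ker R_2(\frac{d}{dt})$, where $R_1,R_2\in\mathbb{R}^{\tt w\times\tt w}[\xi]$ are Hurwitz and $R_2R_1^{-1}$ is strictly proper and strictly positive-real. Define $\Phi(\zeta,\eta):=R_1(\zeta)^\top R_2(\eta)+R_2(\zeta)^\top R_1(\eta)$. Then there exists $Q\in\mathbb{R}^{\bullet\times\tt w}[\xi]$ such that $\Phi(-\xi,\xi)=Q(-\xi)^\top Q(\xi)$, $\operatorname{rank}\begin{bmatrix}R_1(\lambda)\\Q(\lambda)\end{bmatrix}=\tt w$ for all $\lambda\in\mathbb{C}$, and $QR_1^{-1}$ is strictly proper. Define $$\Psi_1(\zeta,\eta):=\frac{\Phi(\zeta,\eta)-Q(\zeta)^\top Q(\eta)}{\zeta+\eta}.$$ Then $\Psi_1$ is $R_1$-canonical. Moreover, with $\Psi_2:=\Psi_1\bmod R_2$, the pair $\{\Psi_1,\Psi_2\}$ induces a multiple Lyapunov function for $\Sigma$.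
   Context: Standard SLDS: let $R_1,R_2\in\mathbb{R}^{\tt w\times\tt w}[\xi]$ be nonsingular with $R_2R_1^{-1}$ strictly proper, $n_j=\deg\det R_j$. Let $X_2\in\mathbb{R}^{n_2\times\tt w}[\xi]$, $X_1'\in\mathbb{R}^{(n_1-n_2)\times\tt w}[\xi]$, $\Pi\in\mathbb{R}^{(n_1-n_2)\times n_2}$ be such that the rows of $X_2$ form a basis of $\{f\in\mathbb{R}^{1\times\tt w}[\xi]: fR_2^{-1}\text{ strictly proper}\}$ (a minimal state map for $\mathfrak{B}_2=\ker R_2(\frac{d}{dt})$), the rows of $X_1:=\mathrm{col}(X_2,X_1')$ form a basis of $\{f: fR_1^{-1}\text{ strictly proper}\}$ (a minimal state map for $\mathfrak{B}_1=\ker R_1(\frac{d}{dt})$), and $X_1'\bmod R_2=\Pi X_2$. Here, for nonsingular $R$ and polynomial row $f$, $fR^{-1}=s+p$ with $s$ strictly proper, $p$ polynomial, and $f\bmod R:=sR$ (rowwise); for $\Psi(\zeta,\eta)=M(\zeta)^\top L(\eta)$, $\Psi\bmod R:=(M\bmod R)(\zeta)^\top(L\bmod R)(\eta)$, and $\Psi$ is $R$-canonical if $\Psi=\Psi\bmod R$. The standard SLDS is the switched system with modes $\mathfrak{B}_1,\mathfrak{B}_2$, switching signals piecewise constant right-continuous $s:\mathbb{R}\to\{1,2\}$ with finitely many switches in bounded intervals, and gluing conditions $(G^-_{2\to1},G^+_{2\to1})=(\mathrm{col}(X_2,\Pi X_2),\mathrm{col}(X_2,X_1'))$, $(G^-_{1\to2},G^+_{1\to2})=(X_2,X_2)$;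 its trajectories $w$ are those which on each interval between consecutive switching instants $t_i$ coincide with a trajectory of the active mode and satisfy $G^+_{k\to\ell}(\frac{d}{dt})w(t_i^+)=G^-_{k\to\ell}(\frac{d}{dt})w(t_i^-)$ at each switch from mode $k$ to mode $\ell$. Hurwitz: determinant has all roots in the open left half-plane. $G$ rational is strictly positive-real if analytic in $\mathbb{C}_+$ and $G(-j\omega)^\top+G(j\omega)>0$ for all real $\omega$. QDF: $\Psi(\zeta,\eta)=\sum\Psi_{h,k}\zeta^h\eta^k$ induces $Q_\Psi(w)=\sum(\frac{d^hw}{dt^h})^\top\Psi_{h,k}\frac{d^kw}{dt^k}$. $\{\Psi_1,\Psi_2\}$ induces a multiple Lyapunov function if $Q_{\Psi_i}\ge0$ along $\mathfrak{B}_i$, $\frac{d}{dt}Q_{\Psi_i}$ (induced by $(\zeta+\eta)\Psi_i$) is negative along $\mathfrak{B}_i$ (nonpositive, zero only for $w=0$), and at every switching instant $t_j$ of every admissible trajectory $w$, $Q_{\Psi_{s(t_{j-1})}}(w)(t_j^-)\ge Q_{\Psi_{s(t_j)}}(w)(t_j^+)$. *)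

theory Defs
  imports "HOL-Analysis.Analysis" "HOL-Computational_Algebra.Polynomial"
    "Jordan_Normal_Form.Determinant" "Jordan_Normal_Form.DL_Rank"
begin

text \<open>Polynomial matrices are JNF matrices over real poly; the number of columns
  plays the role of w.  Complex evaluation of real polynomials.\<close>

definition cpoly :: "real poly \<Rightarrow> complex \<Rightarrow> complex" where
  "cpoly p z = poly (map_poly complex_of_real p) z"

definition evalc :: "real poly mat \<Rightarrow> complex \<Rightarrow> complex mat" where
  "evalc M z = map_mat (\<lambda>p. cpoly p z) M"

definition const_mat :: "real mat \<Rightarrow> real poly mat" where
  "const_mat C = map_mat (\<lambda>c. [:c:]) C"

definition hurwitz :: "real poly mat \<Rightarrow> bool" where
  "hurwitz R \<longleftrightarrow> det R \<noteq> 0 \<and> (\<forall>z. cpoly (det R) z = 0 \<longrightarrow> Re z < 0)"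

text \<open>A rational function p/q (q nonzero) is strictly proper iff deg p < deg q (or p = 0);
  this does not depend on the chosen (possibly unreduced) representation.\<close>
definition sp_frac :: "real poly \<Rightarrow> real poly \<Rightarrow> bool" where
  "sp_frac p q \<longleftrightarrow> p = 0 \<or> degree p < degree q"

text \<open>right_sp M R: the rational matrix M R^{-1} = (M adj R)/det R is strictly proper
  (for R square nonsingular).\<close>
definition right_sp :: "real poly mat \<Rightarrow> real poly mat \<Rightarrow> bool" where
  "right_sp M R \<longleftrightarrow>
     (\<forall>i<dim_row M. \<forall>j<dim_col R. sp_frac ((M * adj_mat R) $$ (i,j)) (det R))"

text \<open>Strictly positive-real rational matrix G = N/d (entrywise N_ij/d), d nonzero:
  analytic in the open right half-plane and G(-j w)^T + G(j w) positive definite.\<close>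
definition rat_eval :: "real poly mat \<Rightarrow> real poly \<Rightarrow> complex \<Rightarrow> complex mat" where
  "rat_eval N d s = mat (dim_row N) (dim_col N) (\<lambda>(i,j). cpoly (N $$ (i,j)) s / cpoly d s)"

definition strictly_positive_real :: "real poly mat \<Rightarrow> real poly \<Rightarrow> bool" where
  "strictly_positive_real N d \<longleftrightarrow>
     (\<forall>i<dim_row N. \<forall>j<dim_col N. \<exists>g. g analytic_on {s. 0 < Re s} \<and>
         (\<forall>s. 0 < Re s \<and> cpoly d s \<noteq> 0 \<longrightarrow> g s = cpoly (N $$ (i,j)) s / cpoly d s)) \<and>
     (\<forall>\<omega>::real. \<forall>x. x \<in> carrier_vec (dim_row N) \<and> x \<noteq> 0\<^sub>v (dim_row N) \<longrightarrow>
        (let M = transpose_mat (rat_eval N d (- \<i> * of_real \<omega>)) + rat_eval N d (\<i> * of_real \<omega>);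
             q = (M *\<^sub>v x) \<bullet>c x
         in Im q = 0 \<and> 0 < Re q))"

definition rmod :: "real poly mat \<Rightarrow> real poly mat \<Rightarrow> real poly mat" where
  "rmod M R = (THE S. S \<in> carrier_mat (dim_row M) (dim_col M) \<and> right_sp S R \<and>
        (\<exists>P. P \<in> carrier_mat (dim_row M) (dim_row R) \<and> S = M - P * R))"

text \<open>Two-variable polynomials as real poly poly: outer variable eta, inner variable zeta;
  coeff (coeff p k) h is the coefficient of zeta^h eta^k.\<close>
definition zeta_emb :: "real poly \<Rightarrow> real poly poly" where
  "zeta_emb p = [:p:]"

definition eta_emb :: "real poly \<Rightarrow> real poly poly" where
  "eta_emb p = map_poly (\<lambda>c. [:c:]) p"

definition bivar :: "real poly mat \<Rightarrow> real poly mat \<Rightarrow> real poly poly mat" where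
  "bivar M L = transpose_mat (map_mat zeta_emb M) * map_mat eta_emb L"

definition zeta_plus_eta :: "real poly poly" where
  "zeta_plus_eta = [:[:0, 1:], 1:]"

definition para_eval :: "real poly poly \<Rightarrow> real poly" where
  "para_eval P = poly (map_poly (\<lambda>c. pcompose c [:0, -1:]) P) [:0, 1:]"

definition neg_var :: "real poly mat \<Rightarrow> real poly mat" where
  "neg_var M = map_mat (\<lambda>p. pcompose p [:0, -1:]) M"

definition bimod :: "real poly poly mat \<Rightarrow> real poly mat \<Rightarrow> real poly poly mat" where
  "bimod Psi R = (THE Psi'. \<exists>M L. dim_row M = dim_row L \<and> dim_col M = dim_row R \<and>
       dim_col L = dim_row R \<and> Psi = bivar M L \<and> Psi' = bivar (rmod M R) (rmod L R))"

definition canonical :: "real poly poly mat \<Rightarrow> real poly mat \<Rightarrow> bool" where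
  "canonical Psi R \<longleftrightarrow> Psi = bimod Psi R"

definition row_basis :: "real poly mat \<Rightarrow> real poly mat \<Rightarrow> bool" where
  "row_basis X R \<longleftrightarrow> dim_col X = dim_row R \<and> right_sp X R \<and>
     (\<forall>c. c \<in> carrier_mat 1 (dim_row X) \<and> const_mat c * X = 0\<^sub>m 1 (dim_col X)
          \<longrightarrow> c = 0\<^sub>m 1 (dim_row X)) \<and>
     (\<forall>f. f \<in> carrier_mat 1 (dim_row R) \<and> right_sp f R \<longrightarrow>
          (\<exists>c. c \<in> carrier_mat 1 (dim_row X) \<and> f = const_mat c * X))"

text \<open>Trajectories are maps real => (nat => real); components j >= w are required to be 0.\<close>
definition smooth_fn :: "(real \<Rightarrow> real) \<Rightarrow> bool" where
  "smooth_fn f \<longleftrightarrow> (\<forall>k t. ((deriv ^^ k) f) differentiable (at t))"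

definition pdiff :: "real poly \<Rightarrow> (real \<Rightarrow> real) \<Rightarrow> real \<Rightarrow> real" where
  "pdiff p f t = (\<Sum>k\<le>degree p. coeff p k * (deriv ^^ k) f t)"

definition mat_diff :: "real poly mat \<Rightarrow> (real \<Rightarrow> nat \<Rightarrow> real) \<Rightarrow> real \<Rightarrow> nat \<Rightarrow> real" where
  "mat_diff M v t i = (\<Sum>j<dim_col M. pdiff (M $$ (i,j)) (\<lambda>\<tau>. v \<tau> j) t)"

definition behavior :: "nat \<Rightarrow> real poly mat \<Rightarrow> (real \<Rightarrow> nat \<Rightarrow> real) set" where
  "behavior w R = {v. (\<forall>j<w. smooth_fn (\<lambda>t. v t j)) \<and> (\<forall>t j. w \<le> j \<longrightarrow> v t j = 0) \<and>
                      (\<forall>t i. i < dim_row R \<longrightarrow> mat_diff R v t i = 0)}"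

definition qdf :: "real poly poly mat \<Rightarrow> (real \<Rightarrow> nat \<Rightarrow> real) \<Rightarrow> real \<Rightarrow> real" where
  "qdf Psi v t = (\<Sum>i<dim_row Psi. \<Sum>j<dim_col Psi. \<Sum>k\<le>degree (Psi $$ (i,j)).
       \<Sum>h\<le>degree (coeff (Psi $$ (i,j)) k).
         (deriv ^^ h) (\<lambda>\<tau>. v \<tau> i) t * coeff (coeff (Psi $$ (i,j)) k) h * (deriv ^^ k) (\<lambda>\<tau>. v \<tau> j) t)"

text \<open>The two-variable matrix (zeta + eta) Psi inducing d/dt Q_Psi.\<close>
definition ddt_poly :: "real poly poly mat \<Rightarrow> real poly poly mat" where
  "ddt_poly Psi = map_mat (\<lambda>e. zeta_plus_eta * e) Psi"

definition switch_times :: "(real \<Rightarrow> nat) \<Rightarrow> real set" where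
  "switch_times s = {t. \<not> eventually (\<lambda>\<tau>. s \<tau> = s t) (at_left t)}"

definition switching_signal :: "(real \<Rightarrow> nat) \<Rightarrow> bool" where
  "switching_signal s \<longleftrightarrow> (\<forall>t. s t \<in> {1, 2}) \<and>
     (\<forall>t. eventually (\<lambda>\<tau>. s \<tau> = s t) (at_right t)) \<and>
     (\<forall>t. \<exists>m. eventually (\<lambda>\<tau>. s \<tau> = m) (at_left t)) \<and>
     (\<forall>a b. finite (switch_times s \<inter> {a..b}))"

text \<open>Trajectories of the SLDS with modes ker R k (d/dt) and gluing conditions
  G k l = (G^-_{k->l}, G^+_{k->l}).\<close>
definition slds_traj :: "nat \<Rightarrow> (nat \<Rightarrow> real poly mat) \<Rightarrow>
    (nat \<Rightarrow> nat \<Rightarrow> real poly mat \<times> real poly mat) \<Rightarrow> (real \<Rightarrow> nat) \<Rightarrow>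
    (real \<Rightarrow> nat \<Rightarrow> real) \<Rightarrow> bool" where
  "slds_traj w R G s v \<longleftrightarrow> switching_signal s \<and> (\<forall>t j. w \<le> j \<longrightarrow> v t j = 0) \<and>
     (\<forall>I t0. is_interval I \<and> open I \<and> t0 \<in> I \<and> I \<inter> switch_times s = {} \<longrightarrow>
         (\<exists>u\<in>behavior w (R (s t0)). \<forall>t\<in>I. v t = u t)) \<and>
     (\<forall>t\<in>switch_times s. \<forall>k. eventually (\<lambda>\<tau>. s \<tau> = k) (at_left t) \<longrightarrow>
        (\<forall>i<dim_row (fst (G k (s t))). \<exists>L.
            ((\<lambda>\<tau>. mat_diff (snd (G k (s t))) v \<tau> i) \<longlongrightarrow> L) (at_right t) \<and>
            ((\<lambda>\<tau>. mat_diff (fst (G k (s t))) v \<tau> i) \<longlongrightarrow> L) (at_left t)))"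

definition multiple_lyapunov :: "nat \<Rightarrow> (nat \<Rightarrow> real poly mat) \<Rightarrow>
    (nat \<Rightarrow> nat \<Rightarrow> real poly mat \<times> real poly mat) \<Rightarrow> (nat \<Rightarrow> real poly poly mat) \<Rightarrow> bool" where
  "multiple_lyapunov w R G Psi \<longleftrightarrow>
     (\<forall>i\<in>{1, 2}. \<forall>v\<in>behavior w (R i).
         (\<forall>t. 0 \<le> qdf (Psi i) v t) \<and>
         (\<forall>t. qdf (ddt_poly (Psi i)) v t \<le> 0) \<and>
         ((\<forall>t. qdf (ddt_poly (Psi i)) v t = 0) \<longrightarrow> (\<forall>t j. v t j = 0))) \<and>
     (\<forall>s v. slds_traj w R G s v \<longrightarrow>
        (\<forall>t\<in>switch_times s. \<forall>k. eventually (\<lambda>\<tau>. s \<tau> = k) (at_left t) \<longrightarrow>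
           (\<exists>a b. ((\<lambda>\<tau>. qdf (Psi k) v \<tau>) \<longlongrightarrow> a) (at_left t) \<and>
                  ((\<lambda>\<tau>. qdf (Psi (s t)) v \<tau>) \<longlongrightarrow> b) (at_right t) \<and> b \<le> a)))"

definition std_modes :: "real poly mat \<Rightarrow> real poly mat \<Rightarrow> nat \<Rightarrow> real poly mat" where
  "std_modes R1 R2 i = (if i = 1 then R1 else R2)"

definition std_gluing :: "real poly mat \<Rightarrow> real poly mat \<Rightarrow> real mat \<Rightarrow>
    nat \<Rightarrow> nat \<Rightarrow> real poly mat \<times> real poly mat" where
  "std_gluing X2 X1' Pm k l =
     (if k = 2 \<and> l = 1 then (X2 @\<^sub>r (const_mat Pm * X2), X2 @\<^sub>r X1') else (X2, X2))"

definition good_factor :: "nat \<Rightarrow> real poly mat \<Rightarrow> real poly poly mat \<Rightarrow> real poly mat \<Rightarrow> bool" where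
  "good_factor w R1 Phi Q \<longleftrightarrow> dim_col Q = w \<and>
     map_mat para_eval Phi = transpose_mat (neg_var Q) * Q \<and>
     (\<forall>z::complex. vec_space.rank (dim_row R1 + dim_row Q) (evalc (R1 @\<^sub>r Q) z) = w) \<and>
     right_sp Q R1"

end

theory Submission
  imports Defs "HOL-Complex_Analysis.Complex_Analysis" "HOL-Real_Asymp.Real_Asymp"
    "Jordan_Normal_Form.Char_Poly"
begin

text \<open>
  The factor \<open>Q\<close> is obtained from a complex square factor of \<open>\<Phi>(-\<xi>,\<xi>)\<close>, built by induction on the
  size through Schur complements: the rational factor has a scalar denominator, and once all zeros
  in the open left half-plane have been reflected by rank-one Blaschke factors, the numerator
  vanishes at the zeros of the denominator, which can therefore be cancelled.  Stacking real and
  imaginary parts gives a real \<open>Q\<close>; since the zeros of the square factor avoid the open left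
  half-plane and those of \<open>R1\<close> lie in it, \<open>col(R1, Q)\<close> has full column rank.

  For the Lyapunov property let \<open>S = lim s G(s)\<close> with \<open>G = R2 R1^(-1)\<close>.  By the maximum principle
  \<open>x^T G x\<close> is positive-real for every real \<open>x \<noteq> 0\<close>, hence has relative degree one, so \<open>S\<close> is
  positive definite; it is symmetric because \<open>Q R1^(-1)\<close> is strictly proper.  Comparing leading
  terms yields \<open>\<Psi>1(\<zeta>,\<eta>) = T(\<zeta>,\<eta>) + R2(\<zeta>)^T S^(-1) R2(\<eta>)\<close> with \<open>T\<close> symmetric and
  \<open>R2\<close>-canonical, so \<open>Q_T\<close> depends on the state \<open>X2\<close> only.  Therefore a switch from mode 1 to
  mode 2 can only decrease the storage, while a switch from 2 to 1 preserves it because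
  \<open>col(X2, \<Pi> X2) w = X1 w\<close> along mode 2.
\<close>

section \<open>Spectral factorization of para-Hermitian polynomial matrices\<close>

text \<open>Complex coefficients keep the factorization elementary: zeros are reflected or cancelled
  one at a time, without pairing conjugate zeros, and a real \<open>Q\<close> is recovered at the
  price of twice as many rows, which the free row number permits. \<open>\<Psi>1\<close> exists
  because \<Phi>(\<zeta>,\<eta>) - Q(\<zeta>)^T Q(\<eta>) vanishes at (-\<xi>,\<xi>). Nonnegativity
  of the storage needs no formula for it: along both modes its derivative is -|Q w|^2, and it tends
  to zero because both modes are Hurwitz. Strictness in mode 2 requires \<open>Q\<close> to be
  observable along the kernel of \<open>R2\<close> as well, which the rank condition does not state
  and the factorization identity supplies. For the matrix arguments, limits of G at infinity are
  replaced by coefficients: with the denominator \<open>det R1\<close> cleared, s G(s) is governed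
  by the coefficients of degree \<open>degree (det R1) - 1\<close>.\<close>

definition star :: "complex poly \<Rightarrow> complex poly" where
  "star p = map_poly cnj (pcompose p [:0, -1:])"

text \<open>Since - cnj z = z on the imaginary axis, \<open>star\<close> is the polynomial extension
  of pointwise conjugation there; its algebra is obtained by comparing values.\<close>

lemma poly_star [simp]: "poly (star p) z = cnj (poly p (- cnj z))"
  by (simp add: star_def poly_map_poly_cnj poly_pcompose)

lemma star_mult: "star (p * q) = star p * star q"
  by (simp add: poly_eq_poly_eq_iff[symmetric] fun_eq_iff)

lemma star_add: "star (p + q) = star p + star q"
  by (simp add: poly_eq_poly_eq_iff[symmetric] fun_eq_iff)

lemma star_diff: "star (p - q) = star p - star q"
  by (simp add: poly_eq_poly_eq_iff[symmetric] fun_eq_iff)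

lemma star_0 [simp]: "star 0 = 0"
  by (simp add: poly_eq_poly_eq_iff[symmetric] fun_eq_iff)

lemma star_sum: "star (sum f A) = (\<Sum>a\<in>A. star (f a))"
  by (simp add: poly_eq_poly_eq_iff[symmetric] fun_eq_iff poly_sum)

lemma star_star [simp]: "star (star p) = p"
  by (simp add: poly_eq_poly_eq_iff[symmetric] fun_eq_iff)

lemma star_const [simp]: "star [:c:] = [:cnj c:]"
  by (simp add: poly_eq_poly_eq_iff[symmetric] fun_eq_iff)

lemma star_linear: "star [:a, b:] = [:cnj a, - cnj b:]"
  by (simp add: poly_eq_poly_eq_iff[symmetric] fun_eq_iff)

lemma star_eq_0_iff [simp]: "star p = 0 \<longleftrightarrow> p = 0"
  by (metis star_0 star_star)

text \<open>Roots pair up as \<alpha> and - cnj \<alpha>, none on the axis. With \<open>l\<close>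
  the linear factor at \<alpha>, \<open>star l * l\<close> is |l|^2 on the axis, so dividing it out
  preserves both hypotheses and lowers the degree by two; the base case is the square root of a
  positive constant.\<close>

lemma scalar_spectral_factor:
  assumes "star a = a" "\<And>\<omega>::real. Re (poly a (\<i> * of_real \<omega>)) > 0"
  shows "\<exists>q. a = star q * q"
  using assms
proof (induction "degree a" arbitrary: a rule: less_induct)
  case less
  show ?case
  proof (cases "degree a = 0")
    case True
    then obtain c where c: "a = [:c:]" using degree_eq_zeroE by blast
    have "cnj c = c" using less.prems(1) c by simp
    moreover have "Re c > 0" using less.prems(2)[of 0] c by simp
    ultimately have "c = of_real (sqrt (Re c)) * of_real (sqrt (Re c))"
      by (simp add: complex_eq_iff)
    hence "a = star [:of_real (sqrt (Re c)):] * [:of_real (sqrt (Re c)):]"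
      using c by simp
    thus ?thesis by blast
  next
    case False
    then obtain \<alpha> where \<alpha>: "poly a \<alpha> = 0"
      using fundamental_theorem_of_algebra[of a] by (auto simp: constant_degree)
    have re: "Re \<alpha> \<noteq> 0"
    proof
      assume "Re \<alpha> = 0"
      hence "\<alpha> = \<i> * of_real (Im \<alpha>)" by (simp add: complex_eq_iff)
      thus False using less.prems(2)[of "Im \<alpha>"] \<alpha> by (metis less_irrefl zero_complex.sel(1))
    qed
    have "poly a (- cnj \<alpha>) = 0"
      using \<alpha> poly_star[of a "- cnj \<alpha>"] less.prems(1) by simp
    obtain b where b: "a = [:-\<alpha>, 1:] * b" using \<alpha> by (auto simp: poly_eq_0_iff_dvd elim: dvdE)
    have "poly b (- cnj \<alpha>) = 0"
    proof -
      have "(- cnj \<alpha> - \<alpha>) * poly b (- cnj \<alpha>) = 0"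
        using \<open>poly a (- cnj \<alpha>) = 0\<close> b by (simp add: algebra_simps)
      moreover have "- cnj \<alpha> - \<alpha> \<noteq> 0" using re by (simp add: complex_eq_iff)
      ultimately show ?thesis by simp
    qed
    then obtain c where c: "b = [:cnj \<alpha>, 1:] * c" by (auto simp: poly_eq_0_iff_dvd elim: dvdE)
    \<comment> \<open>\<open>star l\<close> has leading coefficient -1, so the cofactor to recurse
      on is \<open>- c\<close> and not \<open>c\<close>.\<close>
    define l where "l = [:-\<alpha>, 1:]"
    have sl: "star l * l = - ([:cnj \<alpha>, 1:] * [:-\<alpha>, 1:])" by (simp add: l_def star_linear)
    have a: "a = star l * l * (- c)" unfolding sl b c by (simp only: mult_ac mult_minus_left mult_minus_right minus_minus)
    have "l \<noteq> 0" by (simp add: l_def)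
    hence l0: "star l * l \<noteq> 0" by simp
    have "star (star l * l * (- c)) = star l * l * (- c)" using less.prems(1) a by simp
    hence "(star l * l) * star (-c) = (star l * l) * (- c)" by (simp only: star_mult star_star mult_ac)
    hence "star (-c) = - c" using l0 mult_cancel_left by blast
    moreover have "Re (poly (-c) (\<i> * of_real \<omega>)) > 0" for \<omega> :: real
    proof -
      have "poly (star l * l) (\<i> * of_real \<omega>) = of_real ((cmod (poly l (\<i> * of_real \<omega>)))\<^sup>2)"
        by (simp add: complex_norm_square mult.commute del: of_real_power)
      hence "Re (poly a (\<i> * of_real \<omega>)) = (cmod (poly l (\<i> * of_real \<omega>)))\<^sup>2 * Re (poly (-c) (\<i> * of_real \<omega>))"
        unfolding a by (simp only: poly_mult[of _ "-c"]) simp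
      thus ?thesis using less.prems(2)[of \<omega>] by (metis zero_less_mult_pos zero_le_power2 less_eq_real_def mult_zero_left less_irrefl)
    qed
    moreover have "degree (-c) < degree a"
    proof -
      have "c \<noteq> 0" using False a by auto
      hence "degree a = degree (star l * l) + degree (-c)" using l0 unfolding a by (subst degree_mult_eq) auto
      moreover have "degree (star l * l) = 2" by (simp add: l_def star_linear)
      ultimately show ?thesis by simp
    qed
    ultimately obtain q where "- c = star q * q" using less.hyps by blast
    hence "a = star (l * q) * (l * q)" using a by (simp add: star_mult algebra_simps)
    thus ?thesis by blast
  qed
qed

section \<open>Gram matrices; reflecting and cancelling zeros\<close>

definition gram :: "nat \<Rightarrow> (nat \<Rightarrow> nat \<Rightarrow> complex poly) \<Rightarrow> nat \<Rightarrow> nat \<Rightarrow> complex poly" where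
  "gram n M i j = (\<Sum>r<n. star (M r i) * M r j)"

text \<open>Matrices are kept as index functions, so that the Schur step can peel off row and column
  0 by \<open>Suc\<close>; this wrapper is the bridge to determinants.\<close>

definition fmat :: "nat \<Rightarrow> (nat \<Rightarrow> nat \<Rightarrow> 'a) \<Rightarrow> 'a mat" where
  "fmat n M = mat n n (\<lambda>(i, j). M i j)"

lemma fmat_carrier [simp]: "fmat n M \<in> carrier_mat n n" by (simp add: fmat_def)
lemma fmat_dim [simp]: "dim_row (fmat n M) = n" "dim_col (fmat n M) = n" by (simp_all add: fmat_def)
lemma fmat_index [simp]: "i < n \<Longrightarrow> j < n \<Longrightarrow> fmat n M $$ (i, j) = M i j" by (simp add: fmat_def)

text \<open>Zeros are counted with multiplicity; this is the quantity that each reflection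
  decreases.\<close>

definition lhp_count :: "complex poly \<Rightarrow> nat" where
  "lhp_count p = size (filter_mset (\<lambda>z. Re z < 0) (proots p))"

lemma lhp_count_mult: "p \<noteq> 0 \<Longrightarrow> q \<noteq> 0 \<Longrightarrow> lhp_count (p * q) = lhp_count p + lhp_count q"
  by (simp add: lhp_count_def proots_mult)

lemma det_fmat_eval: "poly (det (fmat n M)) z = det (fmat n (\<lambda>i j. poly (M i j) z))"
proof -
  have h: "comm_ring_hom (\<lambda>p. poly p z)" by unfold_locales auto
  have "map_mat (\<lambda>p. poly p z) (fmat n M) = fmat n (\<lambda>i j. poly (M i j) z)" by (auto simp: fmat_def)
  thus ?thesis using comm_ring_hom.hom_det[OF h, of "fmat n M"] by simp
qed

lemma det_fmat_zero_iff:
  fixes A :: "nat \<Rightarrow> nat \<Rightarrow> 'a :: field"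
  shows "det (fmat n A) = 0 \<longleftrightarrow> (\<exists>x. (\<exists>i<n. x i \<noteq> 0) \<and> (\<forall>i<n. (\<Sum>j<n. A i j * x j) = 0))"
proof
  assume "det (fmat n A) = 0"
  then obtain v where v: "v \<in> carrier_vec n" "v \<noteq> 0\<^sub>v n" "fmat n A *\<^sub>v v = 0\<^sub>v n"
    using det_0_iff_vec_prod_zero[of "fmat n A" n] by auto
  have "\<exists>i<n. vec_index v i \<noteq> 0" using v(1,2) by auto
  moreover have "(\<Sum>j<n. A i j * vec_index v j) = 0" if "i < n" for i
  proof -
    have "vec_index (fmat n A *\<^sub>v v) i = 0" using v(3) that by simp
    thus ?thesis using that v(1) by (simp add: scalar_prod_def fmat_def atLeast0LessThan)
  qed
  ultimately show "\<exists>x. (\<exists>i<n. x i \<noteq> 0) \<and> (\<forall>i<n. (\<Sum>j<n. A i j * x j) = 0)" by (intro exI[of _ "\<lambda>i. vec_index v i"]) auto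
next
  assume "\<exists>x. (\<exists>i<n. x i \<noteq> 0) \<and> (\<forall>i<n. (\<Sum>j<n. A i j * x j) = 0)"
  then obtain x where x: "\<exists>i<n. x i \<noteq> 0" "\<forall>i<n. (\<Sum>j<n. A i j * x j) = 0" by blast
  have "vec n x \<noteq> 0\<^sub>v n" using x(1) by (metis index_vec index_zero_vec(1))
  moreover have "fmat n A *\<^sub>v vec n x = 0\<^sub>v n"
    using x(2) by (intro eq_vecI) (auto simp: scalar_prod_def fmat_def atLeast0LessThan)
  ultimately show "det (fmat n A) = 0" using det_0_iff_vec_prod_zero[OF fmat_carrier] vec_carrier by blast
qed

lemma det_fmat_transpose: "det (fmat n (\<lambda>i j. A j i)) = det (fmat n A)"
proof -
  have "fmat n (\<lambda>i j. A j i) = transpose_mat (fmat n A)" by (auto simp: fmat_def)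
  thus ?thesis using det_transpose[of "fmat n A" n] by simp
qed

text \<open>
  For a left null vector \<open>p\<close> of \<open>M(\<beta>)\<close>, multiplication from the left by the Blaschke factor
  \<open>I + \<kappa> p p^* / (\<xi> - \<beta>)\<close> keeps \<open>M\<close> polynomial and moves the zero \<open>\<beta>\<close> to \<open>- cnj \<beta>\<close>.
\<close>

lemma blaschke_flip:
  assumes nz: "det (fmat n M) \<noteq> 0" and \<beta>: "Re \<beta> < 0" "poly (det (fmat n M)) \<beta> = 0"
  obtains M' where "\<And>i j. i < n \<Longrightarrow> j < n \<Longrightarrow> gram n M' i j = gram n M i j" "det (fmat n M') \<noteq> 0"
    "lhp_count (det (fmat n M')) < lhp_count (det (fmat n M))"
proof -
  \<comment> \<open>A left null vector is wanted, hence the transpose; conjugating it gives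
    \<open>p\<close> with p^H M(\<beta>) = 0.\<close>
  have "det (fmat n (\<lambda>i j. poly (M j i) \<beta>)) = 0"
    using \<beta>(2) det_fmat_transpose[of n "\<lambda>i j. poly (M i j) \<beta>"] by (simp add: det_fmat_eval)
  then obtain x where x: "\<exists>i<n. x i \<noteq> 0" "\<And>i. i < n \<Longrightarrow> (\<Sum>j<n. poly (M j i) \<beta> * x j) = 0"
    unfolding det_fmat_zero_iff by blast
  define p where "p i = cnj (x i)" for i
  define N where "N = (\<Sum>i<n. cnj (p i) * p i)"
  have N: "N = of_real (\<Sum>i<n. (cmod (p i))\<^sup>2)"
    by (simp add: N_def complex_norm_square mult.commute del: of_real_power)
  have "(\<Sum>i<n. (cmod (p i))\<^sup>2) > 0"
    using x(1) by (auto simp: p_def intro!: sum_pos2)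
  hence N0: "N \<noteq> 0" "cnj N = N" unfolding N of_real_eq_0_iff complex_cnj_complex_of_real by auto
  \<comment> \<open>The value that makes the factor para-unitary: the three correction terms share
    \<open>q j * star (q i)\<close>, and their remaining factors add up to (- cnj \<beta> - \<xi>) +
    (\<xi> - \<beta>) + \<kappa> N = 0.\<close>
  define \<kappa> where "\<kappa> = (\<beta> + cnj \<beta>) / N"
  have \<kappa>c: "cnj \<kappa> = \<kappa>" by (simp add: \<kappa>_def N0 add.commute)
  have \<kappa>N: "\<kappa> * N = \<beta> + cnj \<beta>" by (simp add: \<kappa>_def N0)
  define r where "r j = (\<Sum>k<n. [:cnj (p k):] * M k j)" for j
  have "\<exists>q. j < n \<longrightarrow> r j = [:-\<beta>, 1:] * q" for j
  proof (cases "j < n")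
    case True
    have "poly (r j) \<beta> = 0" using x(2)[OF True] by (simp add: r_def p_def poly_sum mult.commute)
    thus ?thesis by (auto simp: poly_eq_0_iff_dvd elim!: dvdE)
  qed auto
  then obtain q where q: "\<And>j. j < n \<Longrightarrow> r j = [:-\<beta>, 1:] * q j" by metis
  define M' where "M' i j = M i j + [:\<kappa> * p i:] * q j" for i j
  have gr: "gram n M' i j = gram n M i j" if "i < n" "j < n" for i j
  proof -
    have sr: "(\<Sum>k<n. star (M k i) * [:p k:]) = [:- cnj \<beta>, -1:] * star (q i)"
    proof -
      have "star (r i) = star ([:-\<beta>, 1:] * q i)" using q that by simp
      thus ?thesis by (simp only: r_def star_sum star_mult star_const star_linear complex_cnj_cnj) (simp add: mult.commute)
    qed
    have rr: "(\<Sum>k<n. [:cnj (p k):] * M k j) = [:-\<beta>, 1:] * q j" using q[OF that(2)] by (simp only: r_def)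
    have NN: "(\<Sum>k<n. [:cnj (p k):] * [:p k:]) = [:N:]" 
      unfolding N_def by (simp add: poly_eq_poly_eq_iff[symmetric] fun_eq_iff poly_sum mult.commute)
    have "gram n M' i j = (\<Sum>k<n. star (M k i) * M k j + [:\<kappa>:] * q j * (star (M k i) * [:p k:])
        + [:\<kappa>:] * star (q i) * ([:cnj (p k):] * M k j) + [:\<kappa>:] * [:\<kappa>:] * star (q i) * q j * ([:cnj (p k):] * [:p k:]))"
      unfolding gram_def using that
      by (intro sum.cong refl) (simp add: M'_def star_add star_mult \<kappa>c algebra_simps flip: poly_eq_poly_eq_iff, simp add: fun_eq_iff algebra_simps \<kappa>c)
    also have "\<dots> = gram n M i j + [:\<kappa>:] * q j * ([:- cnj \<beta>, -1:] * star (q i))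
        + [:\<kappa>:] * star (q i) * ([:-\<beta>, 1:] * q j) + [:\<kappa>:] * [:\<kappa>:] * star (q i) * q j * [:N:]"
      by (simp only: sum.distrib gram_def sr rr NN flip: sum_distrib_left)
    also have "\<dots> = gram n M i j + [:\<kappa>:] * q j * star (q i) * ([:- cnj \<beta>, -1:] + [:-\<beta>, 1:] + [:\<kappa> * N:])"
      by (simp add: algebra_simps flip: poly_eq_poly_eq_iff, simp add: fun_eq_iff algebra_simps)
    also have "\<dots> = gram n M i j" by (simp add: \<kappa>N)
    finally show ?thesis .
  qed
  \<comment> \<open>With A = \<beta> I - \<kappa> p p^H, the numerator (\<xi> - \<beta>) I +
    \<kappa> p p^H of the Blaschke factor is the characteristic matrix of \<open>A\<close>, so its
    determinant has the eigenvalues of \<open>A\<close> as zeros.\<close>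
  define A where "A = fmat n (\<lambda>i j. (if i = j then \<beta> else 0) - \<kappa> * p i * cnj (p j))"
  have Ac: "A \<in> carrier_mat n n" by (simp add: A_def)
  have cpc: "char_poly_matrix A \<in> carrier_mat n n" using Ac by simp
  hence cpd: "dim_row (char_poly_matrix A) = n" "dim_col (char_poly_matrix A) = n" by auto
  have cpm: "char_poly_matrix A $$ (i, k) = (if i = k then [:-\<beta>, 1:] else 0) + [:\<kappa> * p i:] * [:cnj (p k):]"
    if "i < n" "k < n" for i k
    using that Ac by (auto simp: char_poly_matrix_def A_def)
  have prod: "[:-\<beta>, 1:] \<cdot>\<^sub>m fmat n M' = char_poly_matrix A * fmat n M"
  proof (rule eq_matI)
    fix i j assume "i < dim_row (char_poly_matrix A * fmat n M)" "j < dim_col (char_poly_matrix A * fmat n M)"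
    hence ij: "i < n" "j < n" by (auto simp: cpd)
    have "(char_poly_matrix A * fmat n M) $$ (i, j) = (\<Sum>k<n. char_poly_matrix A $$ (i, k) * M k j)"
      using ij by (simp add: cpd scalar_prod_def atLeast0LessThan)
    also have "\<dots> = (\<Sum>k<n. (if i = k then [:-\<beta>, 1:] * M k j else 0) + [:\<kappa> * p i:] * ([:cnj (p k):] * M k j))"
      using ij by (intro sum.cong refl) (auto simp: cpm ring_distribs mult.assoc)
    also have "\<dots> = [:-\<beta>, 1:] * M i j + [:\<kappa> * p i:] * r j"
      using ij by (simp add: sum.distrib r_def sum_distrib_left)
    also have "\<dots> = [:-\<beta>, 1:] * M' i j"
      using ij q[OF ij(2)] by (simp only: M'_def ring_distribs mult_ac)
    finally show "([:-\<beta>, 1:] \<cdot>\<^sub>m fmat n M') $$ (i, j) = (char_poly_matrix A * fmat n M) $$ (i, j)"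
      using ij by (simp only: index_smult_mat fmat_dim fmat_index)
  qed (simp_all add: cpd)
  have dt: "[:-\<beta>, 1:] ^ n * det (fmat n M') = char_poly A * det (fmat n M)"
  proof -
    have "det ([:-\<beta>, 1:] \<cdot>\<^sub>m fmat n M') = [:-\<beta>, 1:] ^ n * det (fmat n M')" 
      by (simp add: fmat_def)
    moreover have "det (char_poly_matrix A * fmat n M) = char_poly A * det (fmat n M)"
      unfolding char_poly_def using Ac by (subst det_mult[of _ n]) auto
    ultimately show ?thesis using prod by metis
  qed
  have dA: "degree (char_poly A) = n" "monic (char_poly A)" using degree_monic_char_poly[OF Ac] by auto
  have cA0: "char_poly A \<noteq> 0" using dA by auto
  have b0: "[:-\<beta>, 1:] ^ n \<noteq> 0" by simp
  have nz': "det (fmat n M') \<noteq> 0"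
    using dt cA0 nz by auto
  \<comment> \<open>\<open>p\<close> is an eigenvector for \<beta> - \<kappa> N = - cnj \<beta>, a
    point of the right half-plane.\<close>
  have "poly (char_poly A) (- cnj \<beta>) = 0"
  proof -
    have "A *\<^sub>v vec n p = (- cnj \<beta>) \<cdot>\<^sub>v vec n p"
    proof (rule eq_vecI)
      fix i assume "i < dim_vec ((- cnj \<beta>) \<cdot>\<^sub>v vec n p)"
      hence i: "i < n" by simp
      have "vec_index (A *\<^sub>v vec n p) i = (\<Sum>j<n. ((if i = j then \<beta> else 0) - \<kappa> * p i * cnj (p j)) * p j)"
        using i by (simp add: A_def fmat_def scalar_prod_def atLeast0LessThan)
      also have "\<dots> = (\<Sum>j<n. (if i = j then \<beta> * p j else 0) - \<kappa> * p i * (cnj (p j) * p j))"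
        by (intro sum.cong refl) (auto simp: algebra_simps)
      also have "\<dots> = \<beta> * p i - (\<kappa> * N) * p i"
        using i by (simp add: sum_subtractf N_def sum_distrib_left mult_ac)
      also have "\<dots> = - cnj \<beta> * p i" unfolding \<kappa>N by (simp add: algebra_simps)
      finally show "vec_index (A *\<^sub>v vec n p) i = vec_index ((- cnj \<beta>) \<cdot>\<^sub>v vec n p) i" using i by simp
    qed (simp add: A_def fmat_def)
    moreover have "vec n p \<noteq> 0\<^sub>v n" using x(1) by (metis index_vec index_zero_vec(1) p_def complex_cnj_zero_iff)
    ultimately have "eigenvalue A (- cnj \<beta>)"
      unfolding eigenvalue_def eigenvector_def using Ac by (intro exI[of _ "vec n p"]) auto
    thus ?thesis using eigenvalue_root_char_poly[OF Ac] by simp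
  qed
  hence mem: "- cnj \<beta> \<in># proots (char_poly A)" using cA0 by simp
  \<comment> \<open>At most n - 1 eigenvalues lie in the left half-plane, whereas the power of \<xi>
    - \<beta> on the other side of \<open>dt\<close> contributes n such zeros; the count for
    \<open>M'\<close> is therefore strictly smaller than for \<open>M\<close>.\<close>
  have "lhp_count (char_poly A) < n"
  proof -
    have "filter_mset (\<lambda>z. Re z < 0) (proots (char_poly A)) \<subset># proots (char_poly A)"
      using mem \<beta>(1) by (metis (no_types, lifting) complex_cnj(1) complex_cnj_minus complex_cnj_cnj filter_mset_eq_conv multiset_filter_subset not_less_iff_gr_or_eq neg_less_0_iff_less subset_mset.less_le uminus_complex.sel(1) cnj.sel(1) order_less_asym)
    hence "lhp_count (char_poly A) < size (proots (char_poly A))"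
      unfolding lhp_count_def by (rule mset_subset_size)
    also have "\<dots> \<le> n" using size_proots_le[of "char_poly A"] dA by simp
    finally show ?thesis .
  qed
  moreover have "lhp_count ([:-\<beta>, 1:] ^ n) = n"
  proof -
    have "size (filter_mset (\<lambda>z. Re z < 0) (replicate_mset n \<beta>)) = n"
      using \<beta>(1) by (induction n) auto
    thus ?thesis by (simp add: lhp_count_def proots_power)
  qed
  moreover have "lhp_count ([:-\<beta>, 1:] ^ n) + lhp_count (det (fmat n M')) = lhp_count (char_poly A) + lhp_count (det (fmat n M))"
    using dt lhp_count_mult[OF b0 nz'] lhp_count_mult[OF cA0 nz] by metis
  ultimately have "lhp_count (det (fmat n M')) < lhp_count (det (fmat n M))" by linarith
  thus ?thesis using that[OF gr nz'] by blast
qed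


lemma antihurwitz_gram:
  assumes "det (fmat n M) \<noteq> 0"
  obtains M' where "\<And>i j. i < n \<Longrightarrow> j < n \<Longrightarrow> gram n M' i j = gram n M i j" "det (fmat n M') \<noteq> 0"
    "\<And>z. Re z < 0 \<Longrightarrow> poly (det (fmat n M')) z \<noteq> 0"
proof -
  have "\<exists>M'. (\<forall>i<n. \<forall>j<n. gram n M' i j = gram n M i j) \<and> det (fmat n M') \<noteq> 0 \<and>
    (\<forall>z. Re z < 0 \<longrightarrow> poly (det (fmat n M')) z \<noteq> 0)"
    using assms
  proof (induction "lhp_count (det (fmat n M))" arbitrary: M rule: less_induct)
    case less
    show ?case
    proof (cases "\<exists>\<beta>. Re \<beta> < 0 \<and> poly (det (fmat n M)) \<beta> = 0")
      case True
      then obtain \<beta> where "Re \<beta> < 0" "poly (det (fmat n M)) \<beta> = 0" by blast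
      from blaschke_flip[OF less.prems this] obtain M1 where M1:
        "\<And>i j. i < n \<Longrightarrow> j < n \<Longrightarrow> gram n M1 i j = gram n M i j" "det (fmat n M1) \<noteq> 0"
        "lhp_count (det (fmat n M1)) < lhp_count (det (fmat n M))" by blast
      from less.hyps[OF M1(3,2)] show ?thesis using M1(1) by simp
    next
      case False
      thus ?thesis using less.prems by blast
    qed
  qed
  thus ?thesis using that by blast
qed

text \<open>
  If \<open>q(\<alpha>) = 0\<close> then \<open>K(- cnj \<alpha>)^* K(\<alpha>) = 0 = K(\<alpha>)^* K(- cnj \<alpha>)\<close>.  One of the two points lies in
  the closed left half-plane, so for anti-Hurwitz \<open>K\<close> the value at the other one is zero.
\<close>

lemma antihurwitz_cancel:
  assumes "\<And>i j. i < n \<Longrightarrow> j < n \<Longrightarrow> gram n M i j = star q * q * F i j" "q \<noteq> 0"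
    "det (fmat n M) \<noteq> 0"
  obtains M' where "\<And>i j. i < n \<Longrightarrow> j < n \<Longrightarrow> gram n M' i j = F i j" "det (fmat n M') \<noteq> 0"
    "\<And>z. Re z < 0 \<Longrightarrow> poly (det (fmat n M')) z \<noteq> 0"
proof -
  have "\<exists>M'. (\<forall>i<n. \<forall>j<n. gram n M' i j = F i j) \<and> det (fmat n M') \<noteq> 0 \<and>
    (\<forall>z. Re z < 0 \<longrightarrow> poly (det (fmat n M')) z \<noteq> 0)"
    using assms
  proof (induction "degree q" arbitrary: q M rule: less_induct)
    case less
    from antihurwitz_gram[OF less.prems(3)] obtain K where K0:
      "\<And>i j. i < n \<Longrightarrow> j < n \<Longrightarrow> gram n K i j = gram n M i j" and K: "det (fmat n K) \<noteq> 0"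
      "\<And>z. Re z < 0 \<Longrightarrow> poly (det (fmat n K)) z \<noteq> 0" by metis
    have gK: "gram n K i j = star q * q * F i j" if "i < n" "j < n" for i j
      using K0 less.prems(1) that by simp
    show ?case
    proof (cases "degree q = 0")
      case True
      then obtain c where c: "q = [:c:]" using degree_eq_zeroE by blast
      have c0: "c \<noteq> 0" using less.prems(2) c by simp
      define K' where "K' i j = [:1 / c:] * K i j" for i j
      have "gram n K' i j = F i j" if "i < n" "j < n" for i j
      proof -
        have "gram n K' i j = ([:cnj (1/c):] * [:1/c:]) * gram n K i j"
          unfolding gram_def K'_def star_mult star_const sum_distrib_left
          by (intro sum.cong refl) (simp only: mult_ac)
        also have "\<dots> = ([:cnj (1/c):] * [:1/c:]) * ([:cnj c:] * [:c:]) * F i j"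
          unfolding gK[OF that] c star_const by (simp only: mult_ac)
        also have "([:cnj (1/c):] * [:1/c:]) * ([:cnj c:] * [:c:]) = 1" using c0 by simp
        finally show ?thesis by simp
      qed
      moreover have "det (fmat n K') = [:1/c:] ^ n * det (fmat n K)"
      proof -
        have "fmat n K' = [:1/c:] \<cdot>\<^sub>m fmat n K" by (rule eq_matI) (auto simp: K'_def)
        thus ?thesis by simp
      qed
      ultimately show ?thesis using K c0 by (intro exI[of _ K']) auto
    next
      case False
      then obtain \<alpha> where \<alpha>: "poly q \<alpha> = 0"
        using fundamental_theorem_of_algebra[of q] by (auto simp: constant_degree)
      have van: "\<exists>\<gamma>. (\<gamma> = \<alpha> \<or> \<gamma> = - cnj \<alpha>) \<and> (\<forall>i<n. \<forall>j<n. poly (K i j) \<gamma> = 0)"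
      proof -
        have key: "(\<Sum>r<n. cnj (poly (K r i) (- cnj z)) * poly (K r j) z) = 0"
          if "i < n" "j < n" "z = \<alpha> \<or> z = - cnj \<alpha>" for i j z
        proof -
          have "poly (gram n K i j) z = 0" unfolding gK[OF that(1,2)] using \<alpha> that(3) by auto
          thus ?thesis by (simp add: gram_def poly_sum)
        qed
        \<comment> \<open>Column j of K(z), conjugated, would be a null vector of the transpose of
          K(- cnj z), which is invertible since Re (- cnj z) < 0.\<close>
        have main: "poly (K i j) z = 0"
          if z: "z = \<alpha> \<or> z = - cnj \<alpha>" and re: "Re z > 0" and ij: "i < n" "j < n" for z i j
        proof (rule ccontr)
          assume nz: "poly (K i j) z \<noteq> 0"
          have "det (fmat n (\<lambda>a b. poly (K b a) (- cnj z))) = 0"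
            unfolding det_fmat_zero_iff
          proof (intro exI[of _ "\<lambda>r. cnj (poly (K r j) z)"] conjI allI impI)
            show "\<exists>r<n. cnj (poly (K r j) z) \<noteq> 0" using nz ij by auto
            fix a assume a: "a < n"
            have "cnj (\<Sum>r<n. cnj (poly (K r a) (- cnj z)) * poly (K r j) z) = 0"
              using key[OF a ij(2) z] by simp
            thus "(\<Sum>r<n. poly (K r a) (- cnj z) * cnj (poly (K r j) z)) = 0" by simp
          qed
          hence "poly (det (fmat n K)) (- cnj z) = 0"
            by (simp only: det_fmat_eval det_fmat_transpose[of n "\<lambda>a b. poly (K a b) (- cnj z)"])
          thus False using K(2)[of "- cnj z"] re by simp
        qed
        consider "Re \<alpha> > 0" | "Re (- cnj \<alpha>) > 0" | "Re \<alpha> = 0" by fastforce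
        thus ?thesis
        proof cases
          \<comment> \<open>On the axis the two points coincide, and the identity says that every
            column has norm zero.\<close>
          case 3
          hence c: "- cnj \<alpha> = \<alpha>" by (simp add: complex_eq_iff)
          have "poly (K i j) \<alpha> = 0" if "i < n" "j < n" for i j
          proof -
            have "(\<Sum>r<n. cnj (poly (K r j) \<alpha>) * poly (K r j) \<alpha>) = 0" using key[of j j \<alpha>] that c by simp
            moreover have "(\<Sum>r<n. cnj (poly (K r j) \<alpha>) * poly (K r j) \<alpha>) = of_real (\<Sum>r<n. (cmod (poly (K r j) \<alpha>))\<^sup>2)"
              by (simp add: complex_norm_square mult.commute del: of_real_power)
            ultimately have "(\<Sum>r<n. (cmod (poly (K r j) \<alpha>))\<^sup>2) = 0" by (metis of_real_eq_0_iff)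
            hence "\<forall>r\<in>{..<n}. (cmod (poly (K r j) \<alpha>))\<^sup>2 = 0" by (subst (asm) sum_nonneg_eq_0_iff) auto
            thus ?thesis using that by simp
          qed
          thus ?thesis by blast
        qed (use main in blast)+
      qed
      then obtain \<gamma> where \<gamma>: "\<gamma> = \<alpha> \<or> \<gamma> = - cnj \<alpha>" "\<And>i j. i < n \<Longrightarrow> j < n \<Longrightarrow> poly (K i j) \<gamma> = 0" by blast
      define l where "l = [:-\<gamma>, 1:]"
      have l0: "l \<noteq> 0" by (simp add: l_def)
      have "\<exists>K'. i < n \<longrightarrow> j < n \<longrightarrow> K i j = l * K'" for i j
        using \<gamma>(2)[of i j] unfolding l_def poly_eq_0_iff_dvd dvd_def by blast
      then obtain K' where K': "\<And>i j. i < n \<Longrightarrow> j < n \<Longrightarrow> K i j = l * K' i j" by metis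
      obtain q' where q': "q = [:-\<alpha>, 1:] * q'" using \<alpha> by (auto simp: poly_eq_0_iff_dvd elim: dvdE)
      \<comment> \<open>The pair product is the same for both candidates \<gamma>, so dividing
        \<open>K\<close> by \<xi> - \<gamma> cancels exactly what \<alpha> contributes to
        \<open>star q * q\<close>.\<close>
      have ll: "star [:-\<alpha>, 1:] * [:-\<alpha>, 1:] = star l * l"
        using \<gamma>(1) by (auto simp: l_def star_linear)
      have "gram n K' i j = star q' * q' * F i j" if "i < n" "j < n" for i j
      proof -
        have "(star l * l) * gram n K' i j = gram n K i j"
          unfolding gram_def sum_distrib_left using that
          by (intro sum.cong refl) (simp only: K' lessThan_iff star_mult mult_ac)
        also have "\<dots> = (star l * l) * (star q' * q' * F i j)"
          unfolding gK[OF that] q' ll[symmetric] star_mult by (simp only: mult_ac)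
        finally show ?thesis using l0 by simp
      qed
      moreover have "degree q' < degree q"
        using less.prems(2) q' by (subst q', subst degree_mult_eq) auto
      moreover have "q' \<noteq> 0" using less.prems(2) q' by auto
      moreover have "det (fmat n K') \<noteq> 0"
      proof -
        have "fmat n K = l \<cdot>\<^sub>m fmat n K'" by (rule eq_matI) (auto simp: K')
        thus ?thesis using K(1) by auto
      qed
      ultimately show ?thesis using less.hyps[of q' K'] by blast
    qed
  qed
  thus ?thesis using that by blast
qed

section \<open>Positivity on the imaginary axis and the induction on the size\<close>

definition axis_form :: "nat \<Rightarrow> (nat \<Rightarrow> nat \<Rightarrow> complex poly) \<Rightarrow> real \<Rightarrow> (nat \<Rightarrow> complex) \<Rightarrow> complex" where
  "axis_form n F \<omega> x = (\<Sum>i<n. \<Sum>j<n. cnj (x i) * poly (F i j) (\<i> * of_real \<omega>) * x j)"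

lemma sum_Suc_0: "(\<Sum>i<Suc n. f i) = f 0 + (\<Sum>i<n. f (Suc i))" for f :: "nat \<Rightarrow> 'a::comm_monoid_add"
  by (rule sum.lessThan_Suc_shift)

text \<open>A null vector x of M(0) would give c(0) x^H F(0) x = |M(0) x|^2 = 0, against positivity
  at frequency zero.\<close>

lemma det_fmat_nz_of_gram:
  assumes gr: "\<And>i j. i < n \<Longrightarrow> j < n \<Longrightarrow> gram n M i j = c * F i j" and c: "\<And>\<omega>::real. poly c (\<i> * of_real \<omega>) \<noteq> 0"
    and pos: "\<And>\<omega> x. \<exists>i<n. x i \<noteq> 0 \<Longrightarrow> Re (axis_form n F \<omega> x) > 0"
  shows "det (fmat n M) \<noteq> 0"
proof
  assume "det (fmat n M) = 0"
  hence "det (fmat n (\<lambda>i j. poly (M i j) 0)) = 0" using det_fmat_eval[of n M 0] by simp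
  then obtain x where x: "\<exists>i<n. x i \<noteq> 0" "\<And>i. i < n \<Longrightarrow> (\<Sum>j<n. poly (M i j) 0 * x j) = 0"
    unfolding det_fmat_zero_iff by blast
  have "poly c 0 * axis_form n F 0 x = (\<Sum>i<n. \<Sum>j<n. cnj (x i) * poly (gram n M i j) 0 * x j)"
    unfolding axis_form_def sum_distrib_left by (intro sum.cong refl) (simp add: gr)
  also have "\<dots> = (\<Sum>i<n. \<Sum>j<n. \<Sum>r<n. cnj (x i) * cnj (poly (M r i) 0) * (poly (M r j) 0 * x j))"
    by (simp add: gram_def poly_sum sum_distrib_left sum_distrib_right mult_ac)
  also have "\<dots> = (\<Sum>i<n. \<Sum>r<n. \<Sum>j<n. cnj (x i) * cnj (poly (M r i) 0) * (poly (M r j) 0 * x j))"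
    by (intro sum.cong refl sum.swap)
  also have "\<dots> = 0" using x(2) by (simp flip: sum_distrib_left)
  finally show False using c[of 0] pos[OF x(1), of 0] by simp
qed

text \<open>The recursion consumes the existence of some factor and produces one without zeros in
  the left half-plane, so both claims run through one induction. Clearing the denominator of the
  Schur complement costs a scalar \<open>star q * q\<close>, which \<open>antihurwitz_cancel\<close>
  takes away again.\<close>

theorem complex_spectral_factorization:
  assumes "\<And>i j. i < n \<Longrightarrow> j < n \<Longrightarrow> star (F i j) = F j i"
    and "\<And>\<omega> x. \<exists>i<n. x i \<noteq> 0 \<Longrightarrow> Re (axis_form n F \<omega> x) > 0"
  obtains M where "\<And>i j. i < n \<Longrightarrow> j < n \<Longrightarrow> gram n M i j = F i j" "det (fmat n M) \<noteq> 0"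
    "\<And>z. Re z < 0 \<Longrightarrow> poly (det (fmat n M)) z \<noteq> 0"
proof -
  have "\<exists>M. \<forall>i<n. \<forall>j<n. gram n M i j = F i j"
    and "\<exists>M. (\<forall>i<n. \<forall>j<n. gram n M i j = F i j) \<and> det (fmat n M) \<noteq> 0 \<and>
    (\<forall>z. Re z < 0 \<longrightarrow> poly (det (fmat n M)) z \<noteq> 0)"
    using assms
  proof (induction n arbitrary: F)
    case 0
    {
      case 1 show ?case by simp
    next
      case 2 show ?case by (simp add: fmat_def)
    }
  next
    case (Suc n)
    have goal2: "\<exists>M. (\<forall>i<Suc n. \<forall>j<Suc n. gram (Suc n) M i j = F i j) \<and> det (fmat (Suc n) M) \<noteq> 0 \<and>
      (\<forall>z. Re z < 0 \<longrightarrow> poly (det (fmat (Suc n) M)) z \<noteq> 0)"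
      if herm: "\<And>i j. i < Suc n \<Longrightarrow> j < Suc n \<Longrightarrow> star (F i j) = F j i"
       and pos: "\<And>\<omega> x. \<exists>i<Suc n. x i \<noteq> 0 \<Longrightarrow> Re (axis_form (Suc n) F \<omega> x) > 0" for F
    proof -
      define a where "a = F 0 0"
      have sa: "star a = a" using herm[of 0 0] by (simp add: a_def)
      have ap: "Re (poly a (\<i> * of_real \<omega>)) > 0" for \<omega> :: real
      proof -
        have "axis_form (Suc n) F \<omega> (\<lambda>i. if i = 0 then 1 else 0) = poly a (\<i> * of_real \<omega>)"
          unfolding axis_form_def sum_Suc_0 by (simp add: a_def)
        thus ?thesis using pos[of "\<lambda>i. if i = 0 then 1 else 0" \<omega>] by fastforce
      qed
      have areal: "poly a (\<i> * of_real \<omega>) = of_real (Re (poly a (\<i> * of_real \<omega>)))" for \<omega> :: real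
      proof -
        have "cnj (poly a (\<i> * of_real \<omega>)) = poly a (\<i> * of_real \<omega>)"
          using poly_star[of a "\<i> * of_real \<omega>"] sa by simp
        thus ?thesis by (simp add: complex_eq_iff)
      qed
      obtain q where q: "a = star q * q" using scalar_spectral_factor[OF sa ap] by blast
      \<comment> \<open>This is \<open>a\<close> times the Schur complement of the entry
        \<open>a\<close>, hence polynomial.\<close>
      define D where "D i j = a * F (Suc i) (Suc j) - F (Suc i) 0 * F 0 (Suc j)" for i j
      have "\<exists>K. \<forall>i<n. \<forall>j<n. gram n K i j = D i j"
      proof (rule Suc.IH(1))
        show "star (D i j) = D j i" if "i < n" "j < n" for i j
          using that by (simp add: D_def star_diff star_mult sa herm mult.commute)
        show "Re (axis_form n D \<omega> x) > 0" if x: "\<exists>i<n. x i \<noteq> 0" for \<omega> x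
        proof -
          define s where "s = \<i> * complex_of_real \<omega>"
          define A where "A = poly a s"
          define g where "g = (\<Sum>j<n. poly (F 0 (Suc j)) s * x j)"
          \<comment> \<open>The vector that eliminates the first coordinate, scaled by
            \<open>A\<close> to avoid division: the form of \<open>F\<close> at \<open>y\<close> is
            \<open>A\<close> times the form of \<open>D\<close> at \<open>x\<close>.\<close>
          define y where "y i = (case i of 0 \<Rightarrow> - g | Suc k \<Rightarrow> A * x k)" for i
          have cA: "cnj A = A" using areal[of \<omega>] by (metis A_def s_def complex_cnj_complex_of_real)
          have cF: "cnj (poly (F 0 0) s) = poly (F 0 0) s" using cA by (simp add: A_def a_def)
          have A0: "Re A > 0" using ap[of \<omega>] by (simp add: A_def s_def)
          have F0: "poly (F (Suc i) 0) s = cnj (poly (F 0 (Suc i)) s)" if "i < n" for i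
            using herm[of 0 "Suc i"] that poly_star[of "F 0 (Suc i)" s] by (simp add: s_def)
          have cg: "(\<Sum>i<n. cnj (x i) * poly (F (Suc i) 0) s) = cnj g"
            unfolding g_def cnj_sum by (intro sum.cong refl) (simp add: F0)
          define H where "H = (\<Sum>i<n. \<Sum>j<n. cnj (x i) * poly (F (Suc i) (Suc j)) s * x j)"
          have "axis_form n D \<omega> x = (\<Sum>i<n. \<Sum>j<n. A * (cnj (x i) * poly (F (Suc i) (Suc j)) s * x j)
               - (cnj (x i) * poly (F (Suc i) 0) s) * (poly (F 0 (Suc j)) s * x j))"
            unfolding axis_form_def s_def[symmetric] D_def A_def
            by (intro sum.cong refl) (simp add: algebra_simps)
          also have "\<dots> = A * H - cnj g * g"
            by (simp add: sum_subtractf H_def flip: sum_distrib_left sum_distrib_right cg g_def)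
          finally have D: "axis_form n D \<omega> x = A * H - cnj g * g" .
          have "axis_form (Suc n) F \<omega> y = cnj g * A * g - cnj g * (\<Sum>j<n. A * (poly (F 0 (Suc j)) s * x j))
              + (\<Sum>i<n. A * (- g) * (cnj (x i) * poly (F (Suc i) 0) s)
                 + (\<Sum>j<n. A * A * (cnj (x i) * poly (F (Suc i) (Suc j)) s * x j)))"
            unfolding axis_form_def s_def[symmetric] sum_Suc_0
            by (simp add: y_def cA cF A_def a_def sum_distrib_left sum_negf mult_ac)
          also have "\<dots> = A * (A * H - cnj g * g)"
            unfolding sum.distrib sum_distrib_left[symmetric] cg g_def[symmetric] H_def[symmetric]
            by (simp add: algebra_simps)
          finally have "axis_form (Suc n) F \<omega> y = A * axis_form n D \<omega> x" using D by simp
          also have "A = of_real (Re A)" using areal[of \<omega>] by (simp add: A_def s_def)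
          finally have "Re (axis_form (Suc n) F \<omega> y) = Re A * Re (axis_form n D \<omega> x)" by simp
          moreover have "\<exists>i<Suc n. y i \<noteq> 0"
          proof -
            obtain i where "i < n" "x i \<noteq> 0" using x by blast
            thus ?thesis using A0 by (intro exI[of _ "Suc i"]) (auto simp: y_def)
          qed
          ultimately show ?thesis using pos[of y \<omega>] A0 by (metis zero_less_mult_pos)
        qed
      qed
      then obtain K where K: "\<And>i j. i < n \<Longrightarrow> j < n \<Longrightarrow> gram n K i j = D i j" by blast
      \<comment> \<open>Block upper triangular with the first row of \<open>F\<close> on top: that
        row contributes F(i,0) F(0,j) to the Gram matrix and \<open>K\<close> contributes
        \<open>D\<close>, which add up to a F.\<close>
      define M where "M i j = (if i = 0 then F 0 j else if j = 0 then 0 else K (i - 1) (j - 1))" for i j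
      have gr: "gram (Suc n) M i j = star q * q * F i j" if ij: "i < Suc n" "j < Suc n" for i j
      proof -
        have "gram (Suc n) M i j = F i 0 * F 0 j + (\<Sum>r<n. star (M (Suc r) i) * M (Suc r) j)"
          unfolding gram_def sum_Suc_0 using herm[of 0 i] ij by (simp add: M_def)
        also have "\<dots> = a * F i j"
        proof (cases "i = 0 \<or> j = 0")
          case True thus ?thesis by (auto simp: M_def a_def)
        next
          case False
          then obtain i' j' where s: "i = Suc i'" "j = Suc j'" by (metis not0_implies_Suc)
          have "(\<Sum>r<n. star (M (Suc r) i) * M (Suc r) j) = gram n K i' j'"
            by (simp add: M_def s gram_def)
          thus ?thesis using K[of i' j'] ij s by (simp add: D_def)
        qed
        finally show ?thesis using q by simp
      qed
      have "poly (star q * q) (\<i> * of_real \<omega>) \<noteq> 0" for \<omega> :: real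
        using ap[of \<omega>] unfolding q[symmetric] by (metis less_irrefl zero_complex.sel(1))
      hence dM: "det (fmat (Suc n) M) \<noteq> 0" using det_fmat_nz_of_gram[OF gr _ pos] by blast
      have "q \<noteq> 0" using q ap[of 0] by auto
      from antihurwitz_cancel[OF gr this dM] show ?thesis by metis
    qed
    {
      case 1 from goal2[OF 1] show ?case by blast
    next
      case 2 from goal2[OF 2] show ?case by blast
    }
  qed
  thus ?thesis using that by blast
qed

section \<open>Strictly proper rational matrices and remainders\<close>

text \<open>Rank is tied to independence of the set of columns, so repeated columns need care: they
  push the rank below n in one direction, and yield the kernel vector e_i - e_j in the
  other.\<close>

lemma full_rank_iff:
  fixes A :: "'a :: field mat"
  assumes A: "A \<in> carrier_mat m n"
  shows "vec_space.rank m A = n \<longleftrightarrow> (\<forall>x\<in>carrier_vec n. A *\<^sub>v x = 0\<^sub>v m \<longrightarrow> x = 0\<^sub>v n)"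
proof -
  interpret vec_space "TYPE('a)" m .
  show ?thesis
  proof (intro iffI ballI impI)
    fix x assume r: "rank A = n" and x: "x \<in> carrier_vec n" "A *\<^sub>v x = 0\<^sub>v m"
    have "distinct (cols A)"
    proof (rule ccontr)
      assume nd: "\<not> distinct (cols A)"
      obtain S where S: "maximal S (\<lambda>T. T \<subseteq> set (cols A) \<and> lin_indpt T)"
        using maximal_exists[of "(\<lambda>T. T \<subseteq> set (cols A) \<and> lin_indpt T)" "card (set (cols A))" "{}"]
        by (meson List.finite_set card_mono empty_iff empty_subsetI finite_lin_indpt2 rev_finite_subset)
      then have "card S \<le> card (set (cols A))" by (simp add: card_mono maximal_def)
      also have "\<dots> < n" using nd A
        by (metis card_distinct card_length carrier_matD(2) cols_length nat_less_le)
      finally show False using rank_card_indpt[OF A S] r by simp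
    qed
    thus "x = 0\<^sub>v n" using full_rank_lin_indpt[OF A r] lin_depI[OF A x(1) _ x(2)] by blast
  next
    assume inj: "\<forall>x\<in>carrier_vec n. A *\<^sub>v x = 0\<^sub>v m \<longrightarrow> x = 0\<^sub>v n"
    have "distinct (cols A)"
    proof (rule ccontr)
      assume "\<not> distinct (cols A)"
      then obtain i j where ij: "i < n" "j < n" "i \<noteq> j" "col A i = col A j"
        using A by (auto simp: distinct_conv_nth)
      define x where "x = unit_vec n i - (unit_vec n j :: 'a Matrix.vec)"
      have x: "x \<in> carrier_vec n" by (simp add: x_def)
      have "A *\<^sub>v x = A *\<^sub>v unit_vec n i - A *\<^sub>v unit_vec n j"
        unfolding x_def by (rule mult_minus_distrib_mat_vec[OF A]) auto
      also have "\<dots> = 0\<^sub>v m"  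
      proof (rule eq_vecI)
        fix k assume k: "k < dim_vec (0\<^sub>v m :: 'a Matrix.vec)"
        have "vec_index (col A i) k = vec_index (col A j) k" using ij by simp
        hence "A $$ (k, i) = A $$ (k, j)" using ij k A by (metis carrier_matD index_col index_zero_vec(2))
        thus "vec_index (A *\<^sub>v unit_vec n i - A *\<^sub>v unit_vec n j) k = vec_index (0\<^sub>v m) k"
          using ij k A by simp
      qed (use A in simp)
      finally have "x = 0\<^sub>v n" using inj x by blast
      hence "vec_index x i = 0" using ij by simp
      thus False using ij by (simp add: x_def)
    qed
    moreover have "lin_indpt (set (cols A))"
      using inj lin_depE[OF A _ calculation] by metis
    ultimately show "rank A = n" using lin_indpt_full_rank[OF A] by blast
  qed
qed

section \<open>Evaluation of real polynomial matrices at complex points\<close>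

lemma cpoly_0 [simp]: "cpoly 0 z = 0" by (simp add: cpoly_def)
lemma cpoly_add: "cpoly (p + q) z = cpoly p z + cpoly q z" by (simp add: cpoly_def map_poly_add)
lemma cpoly_mult: "cpoly (p * q) z = cpoly p z * cpoly q z"
proof -
  interpret h: map_poly_comm_ring_hom complex_of_real ..
  show ?thesis by (simp add: cpoly_def h.hom_mult)
qed
lemma cpoly_sum: "cpoly (sum f A) z = (\<Sum>a\<in>A. cpoly (f a) z)"
  by (induction A rule: infinite_finite_induct) (auto simp: cpoly_add)
lemma cpoly_const [simp]: "cpoly [:c:] z = of_real c" by (cases "c = 0") (simp_all add: cpoly_def map_poly_pCons)

lemma cpoly_hom: "comm_ring_hom (\<lambda>p. cpoly p z)"
  by unfold_locales (auto simp: cpoly_add cpoly_mult, simp add: cpoly_def)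

lemma det_evalc: "det (evalc R z) = cpoly (det R) z"
  unfolding evalc_def by (rule comm_ring_hom.hom_det[OF cpoly_hom])

lemma evalc_kernel:
  assumes R: "R \<in> carrier_mat w w" and d: "cpoly (det R) z \<noteq> 0"
    and x: "\<And>i. i < w \<Longrightarrow> (\<Sum>j<w. cpoly (R $$ (i, j)) z * x j) = 0" and j: "j < w"
  shows "x j = 0"
proof (rule ccontr)
  assume "x j \<noteq> 0"
  have e: "evalc R z = fmat w (\<lambda>i j. cpoly (R $$ (i, j)) z)" using R by (auto simp: evalc_def fmat_def)
  have "det (evalc R z) = 0" unfolding e det_fmat_zero_iff using x \<open>x j \<noteq> 0\<close> j by blast
  thus False using d by (simp add: det_evalc)
qed

lemma append_rows_index:
  assumes "A \<in> carrier_mat m1 n" "B \<in> carrier_mat m2 n" "j < n"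
  shows "i < m1 \<Longrightarrow> (A @\<^sub>r B) $$ (i, j) = A $$ (i, j)"
    and "i < m2 \<Longrightarrow> (A @\<^sub>r B) $$ (m1 + i, j) = B $$ (i, j)"
  using assms by (auto simp: append_rows_def)

lemma all_less_add_iff: "(\<forall>i<a + b. P i) \<longleftrightarrow> (\<forall>i<a. P i) \<and> (\<forall>i<b. P (a + i))" for a b :: nat
proof (intro iffI conjI allI impI)
  fix i assume h: "(\<forall>i<a. P i) \<and> (\<forall>i<b. P (a + i))" "i < a + b"
  show "P i"
  proof (cases "i < a")
    case False
    hence i: "i = a + (i - a)" "i - a < b" using h(2) by auto
    show ?thesis by (subst i(1)) (use h(1) i(2) in blast)
  qed (use h in simp)
qed auto

lemma full_rank_stack:
  assumes R: "R \<in> carrier_mat w w" and Q: "Q \<in> carrier_mat q w"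
  shows "vec_space.rank (dim_row R + dim_row Q) (evalc (R @\<^sub>r Q) z) = w \<longleftrightarrow>
    (\<forall>x. (\<forall>i<w. (\<Sum>j<w. cpoly (R $$ (i, j)) z * x j) = 0) \<and> (\<forall>i<q. (\<Sum>j<w. cpoly (Q $$ (i, j)) z * x j) = 0)
      \<longrightarrow> (\<forall>j<w. x j = 0))" (is "_ \<longleftrightarrow> ?rhs")
proof -
  have RQ: "R @\<^sub>r Q \<in> carrier_mat (w + q) w" using R Q by (rule carrier_append_rows)
  hence E: "evalc (R @\<^sub>r Q) z \<in> carrier_mat (w + q) w" by (simp add: evalc_def)
  have prod: "evalc (R @\<^sub>r Q) z *\<^sub>v x = 0\<^sub>v (w + q) \<longleftrightarrow>
    (\<forall>i<w. (\<Sum>j<w. cpoly (R $$ (i, j)) z * vec_index x j) = 0) \<and>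
    (\<forall>i<q. (\<Sum>j<w. cpoly (Q $$ (i, j)) z * vec_index x j) = 0)" if x: "x \<in> carrier_vec w" for x
  proof -
    have comp: "vec_index (evalc (R @\<^sub>r Q) z *\<^sub>v x) i = (\<Sum>j<w. cpoly ((R @\<^sub>r Q) $$ (i, j)) z * vec_index x j)"
      if "i < w + q" for i
      using that x RQ E by (auto simp: scalar_prod_def atLeast0LessThan evalc_def intro!: sum.cong)
    have "evalc (R @\<^sub>r Q) z *\<^sub>v x = 0\<^sub>v (w + q) \<longleftrightarrow>
      (\<forall>i<w+q. (\<Sum>j<w. cpoly ((R @\<^sub>r Q) $$ (i, j)) z * vec_index x j) = 0)"
    proof
      assume "evalc (R @\<^sub>r Q) z *\<^sub>v x = 0\<^sub>v (w + q)"
      thus "\<forall>i<w+q. (\<Sum>j<w. cpoly ((R @\<^sub>r Q) $$ (i, j)) z * vec_index x j) = 0"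
        using comp by (metis index_zero_vec(1))
    next
      assume "\<forall>i<w+q. (\<Sum>j<w. cpoly ((R @\<^sub>r Q) $$ (i, j)) z * vec_index x j) = 0"
      thus "evalc (R @\<^sub>r Q) z *\<^sub>v x = 0\<^sub>v (w + q)" using comp E by (intro eq_vecI) auto
    qed
    also have "\<dots> \<longleftrightarrow> (\<forall>i<w. (\<Sum>j<w. cpoly ((R @\<^sub>r Q) $$ (i, j)) z * vec_index x j) = 0) \<and>
       (\<forall>i<q. (\<Sum>j<w. cpoly ((R @\<^sub>r Q) $$ (w + i, j)) z * vec_index x j) = 0)"
      by (rule all_less_add_iff)
    finally show ?thesis using append_rows_index[OF R Q] by simp
  qed
  have "vec_space.rank (dim_row R + dim_row Q) (evalc (R @\<^sub>r Q) z) = w \<longleftrightarrow>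
    (\<forall>x\<in>carrier_vec w. evalc (R @\<^sub>r Q) z *\<^sub>v x = 0\<^sub>v (w + q) \<longrightarrow> x = 0\<^sub>v w)"
    using full_rank_iff[OF E] R Q by simp
  also have "\<dots> \<longleftrightarrow> ?rhs"
  proof (intro iffI allI impI ballI)
    fix x j assume a: "\<forall>x\<in>carrier_vec w. evalc (R @\<^sub>r Q) z *\<^sub>v x = 0\<^sub>v (w + q) \<longrightarrow> x = 0\<^sub>v w"
      "(\<forall>i<w. (\<Sum>j<w. cpoly (R $$ (i, j)) z * x j) = 0) \<and> (\<forall>i<q. (\<Sum>j<w. cpoly (Q $$ (i, j)) z * x j) = 0)" "j < w"
    have "vec w x = 0\<^sub>v w" using a(1) prod[of "vec w x"] a(2) by simp
    thus "x j = 0" using a(3) by (metis index_vec index_zero_vec(1))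
  next
    fix x assume a: ?rhs "x \<in> carrier_vec w" "evalc (R @\<^sub>r Q) z *\<^sub>v x = 0\<^sub>v (w + q)"
    have "\<forall>j<w. vec_index x j = 0" using a(1) prod[OF a(2)] a(3) by blast
    thus "x = 0\<^sub>v w" using a(2) by (intro eq_vecI) auto
  qed
  finally show ?thesis .
qed

lemma sp_frac_0 [simp]: "sp_frac 0 q" by (simp add: sp_frac_def)

lemma sp_frac_add: "sp_frac p d \<Longrightarrow> sp_frac q d \<Longrightarrow> sp_frac (p + q) d"
  unfolding sp_frac_def by (metis add.left_neutral add.right_neutral degree_add_less)

lemma sp_frac_uminus [simp]: "sp_frac (- p) d \<longleftrightarrow> sp_frac p d"
  by (simp add: sp_frac_def)

lemma sp_frac_diff: "sp_frac p d \<Longrightarrow> sp_frac q d \<Longrightarrow> sp_frac (p - q) d"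
  using sp_frac_add[of p d "- q"] by simp

lemma sp_frac_const_mult: "sp_frac p d \<Longrightarrow> sp_frac ([:c:] * p) d"
  by (auto simp: sp_frac_def intro: le_less_trans[OF degree_smult_le])

lemma sp_frac_sum: "(\<And>a. a \<in> A \<Longrightarrow> sp_frac (f a) d) \<Longrightarrow> sp_frac (sum f A) d"
  by (induction A rule: infinite_finite_induct) (auto intro: sp_frac_add)

lemma mat_mult_index:
  assumes "A \<in> carrier_mat m n" "B \<in> carrier_mat n q" "i < m" "j < q"
  shows "(A * B) $$ (i, j) = (\<Sum>k<n. A $$ (i, k) * B $$ (k, j))"
  using assms by (auto simp: scalar_prod_def atLeast0LessThan intro!: sum.cong)

lemma mat_add_diff_cancel:
  fixes A S :: "'a :: ab_group_add mat"
  assumes "A \<in> carrier_mat m n" "S \<in> carrier_mat m n"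
  shows "A + S - A = S"
  by (rule eq_matI) (use assms in auto)

lemma mat_diff_diff_cancel:
  fixes A S :: "'a :: ab_group_add mat"
  assumes "A \<in> carrier_mat m n" "B \<in> carrier_mat m n" "S \<in> carrier_mat m n"
  shows "S - (A + S - B) = B - A"
  by (rule eq_matI) (use assms in auto)

lemma mat_diff_add_cancel:
  fixes A M :: "'a :: ab_group_add mat"
  assumes "A \<in> carrier_mat m n" "M \<in> carrier_mat m n"
  shows "A + (M - A) = M"
  by (rule eq_matI) (use assms in auto)

lemma mat_diff_zeroD:
  fixes A B :: "'a :: ab_group_add mat"
  assumes "A - B = 0\<^sub>m m n" "A \<in> carrier_mat m n" "B \<in> carrier_mat m n"
  shows "A = B"
proof (rule eq_matI)
  fix i j assume ij: "i < dim_row B" "j < dim_col B"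
  have "(A - B) $$ (i, j) = 0" unfolding assms(1) using ij assms by simp
  thus "A $$ (i, j) = B $$ (i, j)" using ij assms(2,3) by simp
qed (use assms in auto)

section \<open>Right division by a nonsingular polynomial matrix\<close>

context
  fixes R :: "real poly mat" and w :: nat
  assumes R: "R \<in> carrier_mat w w"
begin

lemma adjR: "adj_mat R \<in> carrier_mat w w" "R * adj_mat R = det R \<cdot>\<^sub>m 1\<^sub>m w" "adj_mat R * R = det R \<cdot>\<^sub>m 1\<^sub>m w"
  using adj_mat[OF R] by auto

lemma right_sp_iff:
  "M \<in> carrier_mat m w \<Longrightarrow> right_sp M R \<longleftrightarrow> (\<forall>i<m. \<forall>j<w. sp_frac ((M * adj_mat R) $$ (i, j)) (det R))"
  using R by (auto simp: right_sp_def)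

lemma right_sp_const_mult:
  assumes "M \<in> carrier_mat m w" "right_sp M R" "C \<in> carrier_mat q m"
  shows "right_sp (const_mat C * M) R"
proof -
  have C: "const_mat C \<in> carrier_mat q m" using assms(3) by (simp add: const_mat_def)
  have a: "const_mat C * M * adj_mat R = const_mat C * (M * adj_mat R)"
    by (rule assoc_mult_mat[OF C assms(1) adjR(1)])
  have "sp_frac ((const_mat C * (M * adj_mat R)) $$ (i, j)) (det R)" if "i < q" "j < w" for i j
  proof -
    have "(const_mat C * (M * adj_mat R)) $$ (i, j) = (\<Sum>k<m. [:C $$ (i, k):] * (M * adj_mat R) $$ (k, j))"
      using that C assms(1,3) adjR(1) by (auto simp: scalar_prod_def atLeast0LessThan const_mat_def intro!: sum.cong)
    also have "sp_frac \<dots> (det R)"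
      using assms that by (intro sp_frac_sum sp_frac_const_mult) (auto simp: right_sp_iff)
    finally show ?thesis .
  qed
  thus ?thesis unfolding right_sp_iff[OF mult_carrier_mat[OF C assms(1)]] a by blast
qed

lemma right_sp_diff:
  assumes "M \<in> carrier_mat m w" "N \<in> carrier_mat m w" "right_sp M R" "right_sp N R"
  shows "right_sp (M - N) R"
proof -
  have "(M - N) * adj_mat R = M * adj_mat R - N * adj_mat R"
    by (rule minus_mult_distrib_mat[OF assms(1,2) adjR(1)])
  moreover have "M - N \<in> carrier_mat m w" using assms(2) by (simp add: minus_carrier_mat)
  ultimately show ?thesis using assms adjR(1) right_sp_iff[of "M - N" m] right_sp_iff[of M m] right_sp_iff[of N m]
    by (auto intro!: sp_frac_diff)
qed

lemma mult_R_adj: "P \<in> carrier_mat m w \<Longrightarrow> P * R * adj_mat R = det R \<cdot>\<^sub>m P"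
  using assoc_mult_mat[of P m w R w "adj_mat R" w] R adjR mult_smult_distrib[of P m w "1\<^sub>m w" w "det R"] by simp

context
  assumes dR: "det R \<noteq> 0"
begin

text \<open>Since P R adj(R) = det(R) P, strict properness would ask nonzero multiples of det(R) to
  have smaller degree than det(R). This is the uniqueness of remainders.\<close>

lemma right_sp_mult_self_zero:
  assumes P: "P \<in> carrier_mat m w" and sp: "right_sp (P * R) R"
  shows "P = 0\<^sub>m m w"
proof (rule eq_matI)
  fix i j assume ij: "i < dim_row (0\<^sub>m m w)" "j < dim_col (0\<^sub>m m w)"
  have PR: "P * R \<in> carrier_mat m w" using P R by simp
  have "sp_frac (det R * P $$ (i, j)) (det R)"
    using sp ij P unfolding right_sp_iff[OF PR] mult_R_adj[OF P] by auto
  thus "P $$ (i, j) = (0\<^sub>m m w) $$ (i, j)"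
    using dR ij by (cases "P $$ (i, j) = 0") (auto simp: sp_frac_def degree_mult_eq)
qed (use P in auto)

text \<open>Entrywise Euclidean division of M adj(R) by det(R); the remainder satisfies S adj(R) =
  (M adj(R)) mod det(R).\<close>

lemma right_division:
  assumes M: "M \<in> carrier_mat m w"
  obtains P S where "P \<in> carrier_mat m w" "S \<in> carrier_mat m w" "S = M - P * R" "right_sp S R"
proof -
  define P where "P = mat m w (\<lambda>(i, j). (M * adj_mat R) $$ (i, j) div det R)"
  define S where "S = M - P * R"
  have P: "P \<in> carrier_mat m w" by (simp add: P_def)
  have PR: "P * R \<in> carrier_mat m w" using P R by simp
  have S: "S \<in> carrier_mat m w" using M PR by (simp add: S_def minus_carrier_mat)
  have "S * adj_mat R = M * adj_mat R - det R \<cdot>\<^sub>m P"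
    unfolding S_def minus_mult_distrib_mat[OF M PR adjR(1)] mult_R_adj[OF P] ..
  hence "(S * adj_mat R) $$ (i, j) = (M * adj_mat R) $$ (i, j) mod det R" if "i < m" "j < w" for i j
    using that M P adjR(1) by (simp add: P_def minus_mult_div_eq_mod)
  hence "right_sp S R" unfolding right_sp_iff[OF S]
    using degree_mod_less[OF dR] by (auto simp: sp_frac_def)
  thus ?thesis using that P S S_def by blast
qed

text \<open>The interface to the \<open>THE\<close> in \<open>rmod\<close>: two remainders differ by
  a left multiple of \<open>R\<close> that is strictly proper over \<open>R\<close>, hence by
  zero.\<close>

lemma rmod_eqI:
  assumes S: "S \<in> carrier_mat m w" and P: "P \<in> carrier_mat m w" and sp: "right_sp S R" and M: "M = P * R + S"
  shows "rmod M R = S"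
proof -
  have PR: "P * R \<in> carrier_mat m w" using P R by simp
  have dims: "dim_row M = m" "dim_col M = w" "dim_row R = w" unfolding M using S PR R by auto
  show ?thesis unfolding rmod_def dims
  proof (rule the_equality)
    have "S = M - P * R" unfolding M by (rule mat_add_diff_cancel[OF PR S, symmetric])
    thus "S \<in> carrier_mat m w \<and> right_sp S R \<and> (\<exists>P. P \<in> carrier_mat m w \<and> S = M - P * R)"
      using S P sp by blast
  next
    fix S' assume "S' \<in> carrier_mat m w \<and> right_sp S' R \<and> (\<exists>P. P \<in> carrier_mat m w \<and> S' = M - P * R)"
    then obtain P' where S': "S' \<in> carrier_mat m w" "right_sp S' R" and P': "P' \<in> carrier_mat m w" "S' = M - P' * R"
      by blast
    have P'R: "P' * R \<in> carrier_mat m w" using P' R by simp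
    have "S - S' = P' * R - P * R"
      unfolding P'(2) M by (rule mat_diff_diff_cancel[OF PR P'R S])
    also have "\<dots> = (P' - P) * R" by (rule minus_mult_distrib_mat[OF P'(1) P R, symmetric])
    finally have "right_sp ((P' - P) * R) R"
      using right_sp_diff[OF S S'(1) sp S'(2)] by simp
    hence z: "P' - P = 0\<^sub>m m w" using right_sp_mult_self_zero[of "P' - P" m] P by (simp add: minus_carrier_mat)
    hence "P' = P" using mat_diff_zeroD P P'(1) by blast
    thus "S' = S" unfolding P'(2) M by (simp only: mat_add_diff_cancel[OF PR S])
  qed
qed

lemma rmod_obtain:
  assumes M: "M \<in> carrier_mat m w"
  obtains P where "P \<in> carrier_mat m w" "M = P * R + rmod M R" "rmod M R \<in> carrier_mat m w" "right_sp (rmod M R) R"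
proof -
  obtain P S where PS: "P \<in> carrier_mat m w" "S \<in> carrier_mat m w" "S = M - P * R" "right_sp S R"
    using right_division[OF M] by blast
  have M': "M = P * R + S" unfolding PS(3) using mat_diff_add_cancel[of "P * R" m w M] M PS(1) R by simp
  have e: "rmod M R = S" by (rule rmod_eqI[OF PS(2,1,4) M'])
  show ?thesis by (rule that[OF PS(1)]; unfold e) (fact M' PS)+
qed

lemma rmod_self: "M \<in> carrier_mat m w \<Longrightarrow> right_sp M R \<Longrightarrow> rmod M R = M"
  by (rule rmod_eqI[of M m "0\<^sub>m m w"]) (use R in auto)

text \<open>Constant multipliers preserve strict properness, so remainders are real-linear in the
  rows; this is what makes \<open>bimod\<close> independent of the chosen factorization.\<close>

lemma rmod_const_mult:
  assumes M: "M \<in> carrier_mat m w" and C: "C \<in> carrier_mat q m"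
  shows "rmod (const_mat C * M) R = const_mat C * rmod M R"
proof -
  obtain P where P: "P \<in> carrier_mat m w" "M = P * R + rmod M R" "rmod M R \<in> carrier_mat m w" "right_sp (rmod M R) R"
    using rmod_obtain[OF M] .
  have C': "const_mat C \<in> carrier_mat q m" using C by (simp add: const_mat_def)
  have PR: "P * R \<in> carrier_mat m w" using P(1) R by simp
  have "const_mat C * M = const_mat C * (P * R) + const_mat C * rmod M R"
    using mult_add_distrib_mat[OF C' PR P(3)] P(2) by simp
  also have "const_mat C * (P * R) = const_mat C * P * R" using assoc_mult_mat[OF C' P(1) R] by simp
  finally show ?thesis
    using P C' C by (intro rmod_eqI[of _ q "const_mat C * P"]) (auto intro: right_sp_const_mult)
qed

end
end

section \<open>Two-variable polynomial matrices\<close>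

lemma bivar_carrier: "M \<in> carrier_mat m a \<Longrightarrow> L \<in> carrier_mat m b \<Longrightarrow> bivar M L \<in> carrier_mat a b"
  by (auto simp: bivar_def)

lemma const_mat_carrier [simp]: "const_mat C \<in> carrier_mat a b \<longleftrightarrow> C \<in> carrier_mat a b"
  by (auto simp: const_mat_def)

lemma bivar_index:
  assumes "M \<in> carrier_mat m a" "L \<in> carrier_mat m b" "i < a" "j < b"
  shows "bivar M L $$ (i, j) = (\<Sum>r<m. zeta_emb (M $$ (r, i)) * eta_emb (L $$ (r, j)))"
  using assms by (auto simp: bivar_def scalar_prod_def atLeast0LessThan intro!: sum.cong)

lemma coeff_zeta_eta: "coeff (zeta_emb p * eta_emb q) k = p * [:coeff q k:]"
  by (simp add: zeta_emb_def eta_emb_def coeff_map_poly)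

lemma coeff_bivar:
  assumes "M \<in> carrier_mat m a" "L \<in> carrier_mat m b" "i < a" "j < b"
  shows "coeff (coeff (bivar M L $$ (i, j)) k) h = (\<Sum>r<m. coeff (M $$ (r, i)) h * coeff (L $$ (r, j)) k)"
  unfolding bivar_index[OF assms] coeff_sum coeff_zeta_eta by (simp add: mult.commute)

lemma bivar_eq_iff:
  assumes "M \<in> carrier_mat m a" "L \<in> carrier_mat m b" "T \<in> carrier_mat a b"
  shows "T = bivar M L \<longleftrightarrow> (\<forall>i<a. \<forall>j<b. \<forall>k h. coeff (coeff (T $$ (i, j)) k) h =
     (\<Sum>r<m. coeff (M $$ (r, i)) h * coeff (L $$ (r, j)) k))"
proof
  assume "T = bivar M L" thus "\<forall>i<a. \<forall>j<b. \<forall>k h. coeff (coeff (T $$ (i, j)) k) h =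
     (\<Sum>r<m. coeff (M $$ (r, i)) h * coeff (L $$ (r, j)) k)" using coeff_bivar[OF assms(1,2)] by blast
next
  assume e: "\<forall>i<a. \<forall>j<b. \<forall>k h. coeff (coeff (T $$ (i, j)) k) h =
     (\<Sum>r<m. coeff (M $$ (r, i)) h * coeff (L $$ (r, j)) k)"
  show "T = bivar M L"
  proof (rule eq_matI)
    fix i j assume "i < dim_row (bivar M L)" "j < dim_col (bivar M L)"
    hence ij: "i < a" "j < b" using bivar_carrier[OF assms(1,2)] by auto
    show "T $$ (i, j) = bivar M L $$ (i, j)"
      using e coeff_bivar[OF assms(1,2) ij] ij by (intro poly_eqI) simp
  qed (use assms bivar_carrier[OF assms(1,2)] in auto)
qed

lemma bivar_swap:
  assumes "M \<in> carrier_mat m w" "L \<in> carrier_mat m w" "M' \<in> carrier_mat m' w" "L' \<in> carrier_mat m' w"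
    and "bivar M L = bivar M' L'"
  shows "bivar L M = bivar L' M'"
proof -
  have "(\<Sum>r<m. coeff (M $$ (r, i)) h * coeff (L $$ (r, j)) k) = (\<Sum>r<m'. coeff (M' $$ (r, i)) h * coeff (L' $$ (r, j)) k)"
    if "i < w" "j < w" for i j h k
    using coeff_bivar[OF assms(1,2) that] coeff_bivar[OF assms(3,4) that] assms(5) by metis
  thus ?thesis unfolding bivar_eq_iff[OF assms(4,3) bivar_carrier[OF assms(2,1)]]
    using coeff_bivar[OF assms(2,1)] by (simp add: mult.commute)
qed

text \<open>The \<eta>^k coefficient of column j of the product is a real combination of the rows of
  \<open>M\<close>, weighted by coefficients of \<open>L\<close>. Equal products give equal
  combinations, and \<open>rmod\<close> commutes with these.\<close>

lemma bivar_rmod_left: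
  assumes R: "R \<in> carrier_mat w w" "det R \<noteq> 0"
    and M: "M \<in> carrier_mat m w" and L: "L \<in> carrier_mat m w"
    and M': "M' \<in> carrier_mat m' w" and L': "L' \<in> carrier_mat m' w"
    and eq: "bivar M L = bivar M' L'"
  shows "bivar (rmod M R) L = bivar (rmod M' R) L'"
proof -
  have rM: "rmod M R \<in> carrier_mat m w" using rmod_obtain[OF R M] by blast
  have rM': "rmod M' R \<in> carrier_mat m' w" using rmod_obtain[OF R M'] by blast
  define c where "c j k = mat 1 m (\<lambda>(_, r). coeff (L $$ (r, j)) k)" for j k
  define c' where "c' j k = mat 1 m' (\<lambda>(_, r). coeff (L' $$ (r, j)) k)" for j k
  have cc: "c j k \<in> carrier_mat 1 m" "c' j k \<in> carrier_mat 1 m'" for j k by (auto simp: c_def c'_def)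
  have row: "coeff ((const_mat (c j k) * N) $$ (0, i)) h = (\<Sum>r<m. coeff (N $$ (r, i)) h * coeff (L $$ (r, j)) k)"
    if "i < w" "N \<in> carrier_mat m w" for N i j k h
    using that by (auto simp: c_def const_mat_def scalar_prod_def atLeast0LessThan coeff_sum mult.commute intro!: sum.cong)
  have row': "coeff ((const_mat (c' j k) * N) $$ (0, i)) h = (\<Sum>r<m'. coeff (N $$ (r, i)) h * coeff (L' $$ (r, j)) k)"
    if "i < w" "N \<in> carrier_mat m' w" for N i j k h
    using that by (auto simp: c'_def const_mat_def scalar_prod_def atLeast0LessThan coeff_sum mult.commute intro!: sum.cong)
  have "const_mat (c j k) * M = const_mat (c' j k) * M'" if "j < w" for j k
  proof (rule eq_matI)
    fix i i' assume "i < dim_row (const_mat (c' j k) * M')" "i' < dim_col (const_mat (c' j k) * M')"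
    hence ij: "i = 0" "i' < w" using M' cc by (auto simp: const_mat_def c'_def)
    show "(const_mat (c j k) * M) $$ (i, i') = (const_mat (c' j k) * M') $$ (i, i')"
      unfolding ij(1) poly_eq_iff row[OF ij(2) M] row'[OF ij(2) M']
      using coeff_bivar[OF M L ij(2) that] coeff_bivar[OF M' L' ij(2) that] eq by simp
  qed (use M M' cc in \<open>auto simp: const_mat_def c_def c'_def\<close>)
  hence r: "const_mat (c j k) * rmod M R = const_mat (c' j k) * rmod M' R" if "j < w" for j k
    using rmod_const_mult[OF R M cc(1)] rmod_const_mult[OF R M' cc(2)] that by metis
  have "(\<Sum>r<m. coeff (rmod M R $$ (r, i)) h * coeff (L $$ (r, j)) k) =
    (\<Sum>r<m'. coeff (rmod M' R $$ (r, i)) h * coeff (L' $$ (r, j)) k)" if "i < w" "j < w" for i j h k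
    using row[OF that(1) rM, of j k h] row'[OF that(1) rM', of j k h] r[OF that(2), of k] by simp
  thus ?thesis unfolding bivar_eq_iff[OF rM' L' bivar_carrier[OF rM L]]
    using coeff_bivar[OF rM L] by simp
qed

text \<open>\<open>bimod\<close> is a \<open>THE\<close> over factorizations of every size;
  uniqueness follows by reducing the left factor, swapping the variables, and reducing the other
  one.\<close>

lemma bimod_bivar:
  assumes R: "R \<in> carrier_mat w w" "det R \<noteq> 0"
    and M: "M \<in> carrier_mat m w" and L: "L \<in> carrier_mat m w"
  shows "bimod (bivar M L) R = bivar (rmod M R) (rmod L R)"
  unfolding bimod_def
proof (rule the_equality)
  show "\<exists>M' L'. dim_row M' = dim_row L' \<and> dim_col M' = dim_row R \<and> dim_col L' = dim_row R \<and>
      bivar M L = bivar M' L' \<and> bivar (rmod M R) (rmod L R) = bivar (rmod M' R) (rmod L' R)"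
    using M L R by blast
next
  fix T assume "\<exists>M' L'. dim_row M' = dim_row L' \<and> dim_col M' = dim_row R \<and> dim_col L' = dim_row R \<and>
      bivar M L = bivar M' L' \<and> T = bivar (rmod M' R) (rmod L' R)"
  then obtain M' L' m' where M': "M' \<in> carrier_mat m' w" and L': "L' \<in> carrier_mat m' w"
    and eq: "bivar M L = bivar M' L'" and T: "T = bivar (rmod M' R) (rmod L' R)"
    using R(1) by (metis carrier_matD(1) carrier_matI)
  have rM: "rmod M R \<in> carrier_mat m w" using rmod_obtain[OF R M] by blast
  have rM': "rmod M' R \<in> carrier_mat m' w" using rmod_obtain[OF R M'] by blast
  have rL: "rmod L R \<in> carrier_mat m w" using rmod_obtain[OF R L] by blast
  have rL': "rmod L' R \<in> carrier_mat m' w" using rmod_obtain[OF R L'] by blast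
  have "bivar (rmod M R) L = bivar (rmod M' R) L'" by (rule bivar_rmod_left[OF R M L M' L' eq])
  from bivar_rmod_left[OF R L rM L' rM' bivar_swap[OF rM L rM' L' this]]
  have "bivar (rmod L R) (rmod M R) = bivar (rmod L' R) (rmod M' R)" .
  from bivar_swap[OF rL rM rL' rM' this] show "T = bivar (rmod M R) (rmod L R)" using T by simp
qed

text \<open>Symmetry lets the reduction of \<open>C\<close> be computed on the other side, where
  \<open>X\<close> is its own remainder.\<close>

lemma canonical_bivar:
  assumes R: "R \<in> carrier_mat w w" "det R \<noteq> 0"
    and X: "X \<in> carrier_mat m w" "right_sp X R" and C: "C \<in> carrier_mat m w"
    and sym: "bivar C X = bivar X C"
  shows "canonical (bivar C X) R"
proof -
  have rX: "rmod X R = X" by (rule rmod_self[OF R X])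
  have "bimod (bivar C X) R = bivar (rmod C R) X" using bimod_bivar[OF R C X(1)] rX by simp
  also have "\<dots> = bivar X C" using bivar_rmod_left[OF R C X(1) X(1) C sym] rX by simp
  finally show ?thesis using sym by (simp add: canonical_def)
qed

section \<open>Coefficients in \<zeta> of a two-variable matrix\<close>

definition zslice :: "real poly poly mat \<Rightarrow> nat \<Rightarrow> real poly mat" where
  "zslice T h = map_mat (map_poly (\<lambda>c. coeff c h)) T"

lemma zslice_carrier [simp]: "zslice T h \<in> carrier_mat a b \<longleftrightarrow> T \<in> carrier_mat a b"
  by (auto simp: zslice_def)

lemma coeff_zslice:
  "T \<in> carrier_mat a b \<Longrightarrow> i < a \<Longrightarrow> j < b \<Longrightarrow> coeff (zslice T h $$ (i, j)) k = coeff (coeff (T $$ (i, j)) k) h"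
  by (auto simp: zslice_def coeff_map_poly)

text \<open>Every row of a \<zeta>^h slice is strictly proper over \<open>R\<close> and so has
  coordinates in the basis \<open>X\<close>; collected as \<zeta>^h coefficients, these coordinates
  form \<open>C\<close>.\<close>

lemma bivar_of_row_basis:
  assumes R: "R \<in> carrier_mat w w" and T: "T \<in> carrier_mat w w"
    and sp: "\<And>h. right_sp (zslice T h) R"
    and X: "X \<in> carrier_mat m w" "row_basis X R"
  obtains C where "C \<in> carrier_mat m w" "T = bivar C X"
proof -
  have ex: "\<exists>c. \<forall>j<w. zslice T h $$ (i, j) = (\<Sum>r<m. [:c r:] * X $$ (r, j))" if i: "i < w" for i h
  proof -
    define f where "f = mat 1 w (\<lambda>(_, j). zslice T h $$ (i, j))"
    have f: "f \<in> carrier_mat 1 w" by (simp add: f_def)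
    have z: "zslice T h \<in> carrier_mat w w" using T by simp
    have "(f * adj_mat R) $$ (0, j) = (zslice T h * adj_mat R) $$ (i, j)" if "j < w" for j
      using i that mat_mult_index[OF f adjR(1)[OF R], of 0 j] mat_mult_index[OF z adjR(1)[OF R], of i j] by (simp add: f_def)
    hence "right_sp f R" using sp[of h] i unfolding right_sp_iff[OF R f] right_sp_iff[OF R z] by simp
    moreover have "\<forall>f. f \<in> carrier_mat 1 w \<and> right_sp f R \<longrightarrow> (\<exists>c. c \<in> carrier_mat 1 m \<and> f = const_mat c * X)"
      using X R by (simp add: row_basis_def)
    ultimately obtain c where c: "c \<in> carrier_mat 1 m" "f = const_mat c * X"
      using f by blast
    have "zslice T h $$ (i, j) = (\<Sum>r<m. [:c $$ (0, r):] * X $$ (r, j))" if j: "j < w" for j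
    proof -
      have "zslice T h $$ (i, j) = f $$ (0, j)" using j by (simp add: f_def)
      also have "\<dots> = (\<Sum>r<m. [:c $$ (0, r):] * X $$ (r, j))"
        unfolding c(2) using c(1) X(1) j
        by (auto simp: const_mat_def scalar_prod_def atLeast0LessThan intro!: sum.cong)
      finally show ?thesis .
    qed
    thus ?thesis by (intro exI[of _ "\<lambda>r. c $$ (0, r)"]) blast
  qed
  define c where "c i h = (SOME c. \<forall>j<w. zslice T h $$ (i, j) = (\<Sum>r<m. [:c r:] * X $$ (r, j)))" for i h
  have c: "zslice T h $$ (i, j) = (\<Sum>r<m. [:c i h r:] * X $$ (r, j))" if "i < w" "j < w" for i j h
    using someI_ex[OF ex[OF that(1), of h]] that(2) unfolding c_def by blast
  \<comment> \<open>A crude bound on all \<zeta>-degrees, so that \<open>C\<close> has polynomial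
    entries.\<close>
  define N where "N = (\<Sum>i<w. \<Sum>j<w. \<Sum>k\<le>degree (T $$ (i, j)). degree (coeff (T $$ (i, j)) k))"
  have N: "coeff (coeff (T $$ (i, j)) k) h = 0" if "i < w" "j < w" "h > N" for i j k h
  proof (cases "k \<le> degree (T $$ (i, j))")
    case True
    have "degree (coeff (T $$ (i, j)) k) \<le> (\<Sum>k\<le>degree (T $$ (i, j)). degree (coeff (T $$ (i, j)) k))"
      by (rule member_le_sum) (use True in auto)
    also have "\<dots> \<le> (\<Sum>j<w. \<Sum>k\<le>degree (T $$ (i, j)). degree (coeff (T $$ (i, j)) k))"
      using that by (intro member_le_sum[of j "{..<w}" "\<lambda>j. \<Sum>k\<le>degree (T $$ (i, j)). degree (coeff (T $$ (i, j)) k)"]) auto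
    also have "\<dots> \<le> N" unfolding N_def
      using that by (intro member_le_sum[of i "{..<w}" "\<lambda>i. \<Sum>j<w. \<Sum>k\<le>degree (T $$ (i, j)). degree (coeff (T $$ (i, j)) k)"]) auto
    finally show ?thesis using that(3) by (intro coeff_eq_0) simp
  qed (simp add: coeff_eq_0)
  define C where "C = mat m w (\<lambda>(r, i). \<Sum>h\<le>N. monom (c i h r) h)"
  have C: "C \<in> carrier_mat m w" by (simp add: C_def)
  have cC: "coeff (C $$ (r, i)) h = (if h \<le> N then c i h r else 0)" if "r < m" "i < w" for r i h
    using that by (simp add: C_def coeff_sum)
  have "T = bivar C X"
    unfolding bivar_eq_iff[OF C X(1) T]
  proof (intro allI impI)
    fix i j k h assume ij: "i < w" "j < w"
    show "coeff (coeff (T $$ (i, j)) k) h = (\<Sum>r<m. coeff (C $$ (r, i)) h * coeff (X $$ (r, j)) k)"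
    proof (cases "h \<le> N")
      case True
      thus ?thesis using coeff_zslice[OF T ij, of h k] c[OF ij, of h] ij by (simp add: cC coeff_sum)
    next
      case False
      thus ?thesis using N[OF ij, of h k] ij by (simp add: cC)
    qed
  qed
  thus ?thesis using that C by blast
qed

lemma coeff_zeta_plus_eta:
  "coeff (coeff (zeta_plus_eta * e) k) h = (if k = 0 then 0 else coeff (coeff e (k - 1)) h) + (if h = 0 then 0 else coeff (coeff e k) (h - 1))"
proof -
  have "zeta_plus_eta * e = [:[:0, 1:]:] * e + pCons 0 e" by (simp add: zeta_plus_eta_def)
  hence "coeff (zeta_plus_eta * e) k = [:0, 1:] * coeff e k + (if k = 0 then 0 else coeff e (k - 1))"
    by (simp add: coeff_pCons split: nat.split)
  thus ?thesis by (simp add: coeff_pCons split: nat.split)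
qed

lemma zslice_ddt:
  assumes "T \<in> carrier_mat a b" "i < a" "j < b"
  shows "zslice (ddt_poly T) h $$ (i, j) = pCons 0 (zslice T h $$ (i, j)) + (if h = 0 then 0 else zslice T (h - 1) $$ (i, j))"
proof -
  have d: "ddt_poly T \<in> carrier_mat a b" using assms(1) by (simp add: ddt_poly_def)
  show ?thesis
  proof (rule poly_eqI)
    fix k
    show "coeff (zslice (ddt_poly T) h $$ (i, j)) k =
      coeff (pCons 0 (zslice T h $$ (i, j)) + (if h = 0 then 0 else zslice T (h - 1) $$ (i, j))) k"
      using coeff_zslice[OF assms] coeff_zslice[OF d assms(2,3)] assms
      by (auto simp: ddt_poly_def coeff_zeta_plus_eta coeff_pCons split: nat.split)
  qed
qed

text \<open>The symmetry T(\<zeta>,\<eta>) = T(\<eta>,\<zeta>)^T of a quadratic differential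
  form.\<close>

definition bisym :: "nat \<Rightarrow> real poly poly mat \<Rightarrow> bool" where
  "bisym w T \<longleftrightarrow> (\<forall>i<w. \<forall>j<w. \<forall>h k. coeff (coeff (T $$ (i, j)) k) h = coeff (coeff (T $$ (j, i)) h) k)"

text \<open>The coefficient of \<zeta>^(h+1) \<eta>^(k+1) in (\<zeta> + \<eta>) T is the sum of
  those of \<open>T\<close> at \<zeta>^(h+1) \<eta>^k and \<zeta>^h \<eta>^(k+1); the latter is
  symmetric by induction on h, hence so is the former.\<close>

lemma bisym_ddtD:
  assumes T: "T \<in> carrier_mat w w" and s: "bisym w (ddt_poly T)"
  shows "bisym w T"
proof -
  have d: "coeff (coeff (T $$ (i, j)) k) h = coeff (coeff (T $$ (j, i)) h) k" if ij: "i < w" "j < w" for i j h k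
    using ij
  proof (induction h arbitrary: k i j)
    case (0 k i j)
    have "coeff (coeff (ddt_poly T $$ (i, j)) (Suc k)) 0 = coeff (coeff (ddt_poly T $$ (j, i)) 0) (Suc k)"
      using s 0 unfolding bisym_def by blast
    thus ?case using T 0 by (simp add: ddt_poly_def coeff_zeta_plus_eta)
  next
    case (Suc h k i j)
    have "coeff (coeff (ddt_poly T $$ (i, j)) (Suc k)) (Suc h) = coeff (coeff (ddt_poly T $$ (j, i)) (Suc h)) (Suc k)"
      using s Suc.prems unfolding bisym_def by blast
    thus ?case using T Suc.prems Suc.IH[of i j "Suc k"] by (simp add: ddt_poly_def coeff_zeta_plus_eta)
  qed
  thus ?thesis by (simp add: bisym_def)
qed

lemma bisym_bivar_swap:
  assumes M: "M \<in> carrier_mat m w" and L: "L \<in> carrier_mat m w" and s: "bisym w (bivar M L)"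
  shows "bivar M L = bivar L M"
  unfolding bivar_eq_iff[OF L M bivar_carrier[OF M L]]
proof (intro allI impI)
  fix i j k h assume ij: "i < w" "j < w"
  have "coeff (coeff (bivar M L $$ (i, j)) k) h = coeff (coeff (bivar M L $$ (j, i)) h) k"
    using s ij unfolding bisym_def by blast
  thus "coeff (coeff (bivar M L $$ (i, j)) k) h = (\<Sum>r<m. coeff (L $$ (r, i)) h * coeff (M $$ (r, j)) k)"
    unfolding coeff_bivar[OF M L ij(2,1)] by (simp add: mult.commute)
qed

section \<open>Substitution of (-\<xi>,\<xi>) and division by \<zeta> + \<eta>\<close>

definition neg_poly :: "real poly \<Rightarrow> real poly" where "neg_poly p = pcompose p [:0, -1:]"

lemma neg_poly_hom: "comm_ring_hom neg_poly"
  by unfold_locales (auto simp: neg_poly_def pcompose_add pcompose_mult pcompose_1)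

lemma neg_poly_neg_poly [simp]: "neg_poly (neg_poly p) = p"
  by (simp add: neg_poly_def poly_eq_poly_eq_iff[symmetric] fun_eq_iff poly_pcompose)

text \<open>Substituting \<eta> := -\<zeta> before changing the sign of the variable puts the inner
  evaluation at the root of \<open>zeta_plus_eta\<close>, so that divisibility by \<zeta> + \<eta>
  becomes the factor theorem over \<open>real poly\<close>.\<close>

lemma para_eval_eq: "para_eval P = neg_poly (poly P [:0, -1:])"
proof -
  interpret comm_ring_hom neg_poly by (rule neg_poly_hom)
  have "poly (map_poly neg_poly P) (neg_poly [:0, -1:]) = neg_poly (poly P [:0, -1:])"
    by (rule poly_map_poly)
  moreover have "neg_poly [:0, -1:] = [:0, 1:]" by (simp add: neg_poly_def pcompose_pCons)
  ultimately show ?thesis unfolding para_eval_def neg_poly_def[abs_def] by simp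
qed

lemma para_eval_add: "para_eval (P + Q) = para_eval P + para_eval Q"
  and para_eval_diff: "para_eval (P - Q) = para_eval P - para_eval Q"
  by (simp_all add: para_eval_eq neg_poly_def pcompose_add pcompose_diff)

lemma para_eval_0 [simp]: "para_eval 0 = 0" by (simp add: para_eval_eq neg_poly_def)

lemma para_eval_sum: "para_eval (sum f A) = (\<Sum>a\<in>A. para_eval (f a))"
  by (induction A rule: infinite_finite_induct) (auto simp: para_eval_add)

lemma para_eval_zeta_eta: "para_eval (zeta_emb p * eta_emb q) = neg_poly p * q"
proof -
  have "poly (eta_emb q) [:0, -1:] = neg_poly q" unfolding eta_emb_def neg_poly_def pcompose_altdef ..
  hence "para_eval (zeta_emb p * eta_emb q) = neg_poly (p * neg_poly q)"
    by (simp add: para_eval_eq zeta_emb_def)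
  also have "\<dots> = neg_poly p * neg_poly (neg_poly q)" by (simp add: neg_poly_def pcompose_mult)
  finally show ?thesis by simp
qed

lemma para_eval_bivar:
  assumes "M \<in> carrier_mat m a" "L \<in> carrier_mat m b" "i < a" "j < b"
  shows "para_eval (bivar M L $$ (i, j)) = (\<Sum>r<m. neg_poly (M $$ (r, i)) * L $$ (r, j))"
  unfolding bivar_index[OF assms] by (simp add: para_eval_sum para_eval_zeta_eta)

lemma ddt_poly_divide:
  assumes T: "T \<in> carrier_mat a b" and z: "\<And>i j. i < a \<Longrightarrow> j < b \<Longrightarrow> para_eval (T $$ (i, j)) = 0"
  obtains S where "S \<in> carrier_mat a b" "ddt_poly S = T"
proof -
  have "\<exists>e. T $$ (i, j) = zeta_plus_eta * e" if "i < a" "j < b" for i j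
  proof -
    have "neg_poly (neg_poly (poly (T $$ (i, j)) [:0, -1:])) = neg_poly 0"
      using z[OF that] by (simp add: para_eval_eq)
    hence "poly (T $$ (i, j)) [:0, -1:] = 0" by (simp add: neg_poly_def[of 0])
    hence "[:- [:0, -1:], 1:] dvd T $$ (i, j)" by (simp add: poly_eq_0_iff_dvd)
    thus ?thesis by (simp add: zeta_plus_eta_def dvd_def)
  qed
  then obtain e where e: "\<And>i j. i < a \<Longrightarrow> j < b \<Longrightarrow> T $$ (i, j) = zeta_plus_eta * e i j" by metis
  have "ddt_poly (mat a b (\<lambda>(i, j). e i j)) = T"
    by (rule eq_matI) (use T e in \<open>auto simp: ddt_poly_def\<close>)
  thus ?thesis using that[of "mat a b (\<lambda>(i, j). e i j)"] by simp
qed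

section \<open>Differential operators and quadratic differential forms\<close>

lemma smooth_has_deriv:
  "smooth_fn f \<Longrightarrow> ((deriv ^^ k) f has_real_derivative (deriv ^^ Suc k) f t) (at t)"
  by (simp add: smooth_fn_def DERIV_deriv_iff_real_differentiable)

text \<open>A chain of functions, each the derivative of the previous one, certifies smoothness and
  identifies all iterates of \<open>deriv\<close> at once.\<close>

lemma smooth_fnI:
  assumes "\<And>k t. (g k has_real_derivative g (Suc k) t) (at t)"
  shows "smooth_fn (g 0)" "(deriv ^^ k) (g 0) = g k"
proof -
  have e: "(deriv ^^ k) (g 0) = g k" for k
  proof (induction k)
    case (Suc k)
    show ?case unfolding funpow.simps comp_def Suc by (rule ext, rule DERIV_imp_deriv, rule assms)
  qed simp
  show "(deriv ^^ k) (g 0) = g k" by (rule e)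
  show "smooth_fn (g 0)" unfolding smooth_fn_def e
    using assms real_differentiable_def by blast
qed

lemma smooth_deriv: "smooth_fn f \<Longrightarrow> smooth_fn ((deriv ^^ n) f)"
  by (simp add: smooth_fn_def flip: funpow_add[THEN fun_cong, simplified comp_def])

lemma smooth_add:
  assumes "smooth_fn f" "smooth_fn g"
  shows "smooth_fn (\<lambda>t. f t + g t)" "(deriv ^^ k) (\<lambda>t. f t + g t) t = (deriv ^^ k) f t + (deriv ^^ k) g t"
  using smooth_fnI[of "\<lambda>k t. (deriv ^^ k) f t + (deriv ^^ k) g t"] assms
  by (auto intro!: derivative_intros smooth_has_deriv simp del: funpow.simps(2) simp: fun_eq_iff)

lemma smooth_cmult:
  assumes "smooth_fn f"
  shows "smooth_fn (\<lambda>t. c * f t)" "(deriv ^^ k) (\<lambda>t. c * f t) t = c * (deriv ^^ k) f t"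
proof -
  have d: "((\<lambda>t. c * (deriv ^^ k) f t) has_real_derivative c * (deriv ^^ Suc k) f t) (at t)" for k t
    by (intro DERIV_cmult smooth_has_deriv assms)
  show "smooth_fn (\<lambda>t. c * f t)" "(deriv ^^ k) (\<lambda>t. c * f t) t = c * (deriv ^^ k) f t"
    using smooth_fnI[of "\<lambda>k t. c * (deriv ^^ k) f t", OF d] by (simp_all add: fun_eq_iff)
qed

lemma smooth_zero: "smooth_fn (\<lambda>t. 0)" "(deriv ^^ k) (\<lambda>t. 0) t = 0"
  using smooth_fnI[of "\<lambda>k t. 0"] by (auto simp: fun_eq_iff)

lemma smooth_sum:
  assumes "\<And>a. a \<in> A \<Longrightarrow> smooth_fn (f a)"
  shows "smooth_fn (\<lambda>t. \<Sum>a\<in>A. f a t) \<and> (\<forall>k t. (deriv ^^ k) (\<lambda>t. \<Sum>a\<in>A. f a t) t = (\<Sum>a\<in>A. (deriv ^^ k) (f a) t))"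
  using assms
  by (induction A rule: infinite_finite_induct) (simp_all add: smooth_zero smooth_add)

lemma pdiff_bound: "degree p \<le> n \<Longrightarrow> pdiff p f t = (\<Sum>k\<le>n. coeff p k * (deriv ^^ k) f t)"
  unfolding pdiff_def by (rule sum.mono_neutral_left) (auto simp: coeff_eq_0)

lemma pdiff_0 [simp]: "pdiff 0 f t = 0" by (simp add: pdiff_def)

lemma pdiff_add: "pdiff (p + q) f t = pdiff p f t + pdiff q f t"
proof -
  define n where "n = max (degree p) (degree q)"
  have "degree (p + q) \<le> n" "degree p \<le> n" "degree q \<le> n" by (auto simp: n_def degree_add_le_max)
  thus ?thesis by (simp add: pdiff_bound algebra_simps sum.distrib)
qed

lemma pdiff_sum: "pdiff (sum p A) f t = (\<Sum>a\<in>A. pdiff (p a) f t)"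
  by (induction A rule: infinite_finite_induct) (auto simp: pdiff_add)

lemma pdiff_pCons: "pdiff (pCons a p) f t = a * f t + pdiff p (deriv f) t"
proof -
  have "pdiff (pCons a p) f t = (\<Sum>k\<le>Suc (degree p). coeff (pCons a p) k * (deriv ^^ k) f t)"
    by (rule pdiff_bound) (simp add: degree_pCons_le)
  also have "\<dots> = a * f t + (\<Sum>k\<le>degree p. coeff p k * (deriv ^^ Suc k) f t)"
    by (subst sum.atMost_Suc_shift) simp
  finally show ?thesis by (simp only: pdiff_def funpow_Suc_right comp_def)
qed

lemma pdiff_const [simp]: "pdiff [:c:] f t = c * f t" by (simp add: pdiff_pCons)

lemma smooth_pdiff:
  assumes "smooth_fn f"
  shows "smooth_fn (pdiff p f)" "(deriv ^^ k) (pdiff p f) = pdiff p ((deriv ^^ k) f)"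
proof -
  have e: "pdiff p g = (\<lambda>t. \<Sum>j\<le>degree p. coeff p j * (deriv ^^ j) g t)" for g
    by (simp add: pdiff_def fun_eq_iff)
  have s: "smooth_fn (\<lambda>t. coeff p j * (deriv ^^ j) f t)" for j
    by (intro smooth_cmult smooth_deriv assms)
  show "smooth_fn (pdiff p f)" unfolding e using smooth_sum[of "{..degree p}" "\<lambda>j t. coeff p j * (deriv ^^ j) f t"] s by blast
  show "(deriv ^^ k) (pdiff p f) = pdiff p ((deriv ^^ k) f)"
  proof
    fix t
    have "(deriv ^^ k) (pdiff p f) t = (\<Sum>j\<le>degree p. (deriv ^^ k) (\<lambda>t. coeff p j * (deriv ^^ j) f t) t)"
      unfolding e using smooth_sum[of "{..degree p}" "\<lambda>j t. coeff p j * (deriv ^^ j) f t"] s by blast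
    also have "\<dots> = (\<Sum>j\<le>degree p. coeff p j * (deriv ^^ k) ((deriv ^^ j) f) t)"
      by (simp add: smooth_cmult(2) smooth_deriv assms)
    also have "\<dots> = pdiff p ((deriv ^^ k) f) t"
      unfolding pdiff_def by (simp flip: funpow_add[THEN fun_cong, simplified comp_def] add: add.commute)
    finally show "(deriv ^^ k) (pdiff p f) t = pdiff p ((deriv ^^ k) f) t" .
  qed
qed

lemma pdiff_mult: "smooth_fn f \<Longrightarrow> pdiff (p * q) f t = pdiff p (pdiff q f) t"
proof (induction p arbitrary: f t)
  case (pCons a p)
  have "pdiff (pCons a p * q) f t = pdiff ([:a:] * q + pCons 0 (p * q)) f t" by simp
  also have "\<dots> = pdiff ([:a:] * q) f t + pdiff (p * q) (deriv f) t"
    by (simp add: pdiff_add pdiff_pCons)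
  also have "pdiff ([:a:] * q) f t = a * pdiff q f t"
    by (subst pdiff_bound[of _ "degree q"]) (auto simp: pdiff_def sum_distrib_left mult_ac intro: degree_smult_le)
  also have "pdiff (p * q) (deriv f) t = pdiff p (pdiff q (deriv f)) t"
    using pCons.IH[of "deriv f"] smooth_deriv[OF pCons.prems, of 1] by simp
  also have "pdiff q (deriv f) = deriv (pdiff q f)"
    using smooth_pdiff(2)[OF pCons.prems, of 1 q] by simp
  finally show ?case by (simp add: pdiff_pCons)
qed simp

lemma pdiff_has_deriv:
  assumes "smooth_fn f"
  shows "(pdiff p f has_real_derivative pdiff (pCons 0 p) f t) (at t)"
  using smooth_has_deriv[OF smooth_pdiff(1)[OF assms], of 0 p t] smooth_pdiff(2)[OF assms, of 1 p]
  by (simp add: pdiff_pCons)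

lemma pdiff_fun_sum:
  assumes "\<And>a. a \<in> A \<Longrightarrow> smooth_fn (f a)"
  shows "pdiff p (\<lambda>t. \<Sum>a\<in>A. f a t) t = (\<Sum>a\<in>A. pdiff p (f a) t)"
proof -
  have "pdiff p (\<lambda>t. \<Sum>a\<in>A. f a t) t = (\<Sum>k\<le>degree p. \<Sum>a\<in>A. coeff p k * (deriv ^^ k) (f a) t)"
    unfolding pdiff_def using smooth_sum[of A f, OF assms] by (simp add: sum_distrib_left)
  also have "\<dots> = (\<Sum>a\<in>A. pdiff p (f a) t)" unfolding pdiff_def by (rule sum.swap)
  finally show ?thesis .
qed

lemma funpow_deriv_cong:
  assumes "open U" "\<And>t. t \<in> U \<Longrightarrow> f t = g t" "t \<in> U"
  shows "(deriv ^^ k) f t = (deriv ^^ k) (g :: real \<Rightarrow> real) t"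
  using assms(3)
proof (induction k arbitrary: t)
  case (Suc k)
  have "eventually (\<lambda>x. (deriv ^^ k) f x = (deriv ^^ k) g x) (nhds t)"
    using Suc assms(1) by (auto simp: eventually_nhds)
  thus ?case by (simp add: deriv_cong_ev)
qed (simp add: assms(2))

lemma pdiff_cong:
  assumes "open U" "\<And>t. t \<in> U \<Longrightarrow> f t = g t" "t \<in> U"
  shows "pdiff p f t = pdiff p g t"
  unfolding pdiff_def using funpow_deriv_cong[OF assms] by simp

definition smooth_traj :: "nat \<Rightarrow> (real \<Rightarrow> nat \<Rightarrow> real) \<Rightarrow> bool" where
  "smooth_traj w v \<longleftrightarrow> (\<forall>j<w. smooth_fn (\<lambda>t. v t j))"

lemma behavior_iff:
  "R \<in> carrier_mat m w \<Longrightarrow> v \<in> behavior w R \<longleftrightarrow>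
    smooth_traj w v \<and> (\<forall>t j. w \<le> j \<longrightarrow> v t j = 0) \<and> (\<forall>t. \<forall>i<m. mat_diff R v t i = 0)"
  by (auto simp: behavior_def smooth_traj_def)

lemma mat_diff_eq: "M \<in> carrier_mat m w \<Longrightarrow> mat_diff M v t i = (\<Sum>j<w. pdiff (M $$ (i, j)) (\<lambda>\<tau>. v \<tau> j) t)"
  by (auto simp: mat_diff_def)

lemma mat_diff_smooth:
  assumes "smooth_traj w v" "M \<in> carrier_mat m w"
  shows "smooth_fn (\<lambda>t. mat_diff M v t i)"
proof -
  have "smooth_fn (\<lambda>t. \<Sum>j<w. pdiff (M $$ (i, j)) (\<lambda>\<tau>. v \<tau> j) t)"
    using assms(1) smooth_sum[of "{..<w}" "\<lambda>j t. pdiff (M $$ (i, j)) (\<lambda>\<tau>. v \<tau> j) t"]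
    by (simp add: smooth_traj_def smooth_pdiff)
  thus ?thesis using assms(2) by (simp add: mat_diff_eq)
qed

lemma mat_diff_add:
  assumes "M \<in> carrier_mat m w" "N \<in> carrier_mat m w" "i < m"
  shows "mat_diff (M + N) v t i = mat_diff M v t i + mat_diff N v t i"
  using assms by (simp add: mat_diff_def pdiff_add sum.distrib)

lemma mat_diff_mult:
  assumes v: "smooth_traj w v" and A: "A \<in> carrier_mat a b" and B: "B \<in> carrier_mat b w" and i: "i < a"
  shows "mat_diff (A * B) v t i = (\<Sum>r<b. pdiff (A $$ (i, r)) (\<lambda>\<tau>. mat_diff B v \<tau> r) t)"
proof -
  have "mat_diff (A * B) v t i = (\<Sum>j<w. pdiff (\<Sum>r<b. A $$ (i, r) * B $$ (r, j)) (\<lambda>\<tau>. v \<tau> j) t)"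
    using A B i by (auto simp: mat_diff_def scalar_prod_def atLeast0LessThan intro!: sum.cong)
  also have "\<dots> = (\<Sum>j<w. \<Sum>r<b. pdiff (A $$ (i, r)) (pdiff (B $$ (r, j)) (\<lambda>\<tau>. v \<tau> j)) t)"
    using v by (simp add: pdiff_sum pdiff_mult smooth_traj_def)
  also have "\<dots> = (\<Sum>r<b. \<Sum>j<w. pdiff (A $$ (i, r)) (pdiff (B $$ (r, j)) (\<lambda>\<tau>. v \<tau> j)) t)"
    by (rule sum.swap)
  also have "\<dots> = (\<Sum>r<b. pdiff (A $$ (i, r)) (\<lambda>\<tau>. mat_diff B v \<tau> r) t)"
  proof (rule sum.cong[OF refl])
    fix r
    show "(\<Sum>j<w. pdiff (A $$ (i, r)) (pdiff (B $$ (r, j)) (\<lambda>\<tau>. v \<tau> j)) t) = pdiff (A $$ (i, r)) (\<lambda>\<tau>. mat_diff B v \<tau> r) t"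
      unfolding mat_diff_eq[OF B]
      by (rule pdiff_fun_sum[symmetric]) (use v in \<open>simp add: smooth_pdiff smooth_traj_def\<close>)
  qed
  finally show ?thesis .
qed

lemma mat_diff_mult_zero:
  assumes "smooth_traj w v" "A \<in> carrier_mat a b" "B \<in> carrier_mat b w" "i < a"
    and "\<And>t r. r < b \<Longrightarrow> mat_diff B v t r = 0"
  shows "mat_diff (A * B) v t i = 0"
proof -
  have "pdiff p (\<lambda>\<tau>. mat_diff B v \<tau> r) t = 0" if "r < b" for p r
    using assms(5)[OF that] by (simp add: pdiff_def smooth_zero)
  thus ?thesis using mat_diff_mult[OF assms(1-4)] by simp
qed

lemma mat_diff_const_mult:
  assumes "smooth_traj w v" "C \<in> carrier_mat a b" "B \<in> carrier_mat b w" "i < a"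
  shows "mat_diff (const_mat C * B) v t i = (\<Sum>r<b. C $$ (i, r) * mat_diff B v t r)"
proof -
  have "const_mat C \<in> carrier_mat a b" using assms(2) by simp
  from mat_diff_mult[OF assms(1) this assms(3,4)] show ?thesis
    using assms(2,4) by (simp add: const_mat_def)
qed

lemma mat_diff_cong:
  assumes "open U" "\<And>t. t \<in> U \<Longrightarrow> v t = u t" "t \<in> U"
  shows "mat_diff M v t i = mat_diff M u t i"
  unfolding mat_diff_def by (intro sum.cong refl pdiff_cong[OF assms(1) _ assms(3)]) (simp add: assms(2))

section \<open>Bilinear differential forms\<close>

definition bil_entry :: "real poly poly \<Rightarrow> (real \<Rightarrow> real) \<Rightarrow> (real \<Rightarrow> real) \<Rightarrow> real \<Rightarrow> real" where
  "bil_entry P f g t = (\<Sum>k\<le>degree P. pdiff (coeff P k) f t * (deriv ^^ k) g t)"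

text \<open>Polarized form of \<open>qdf\<close>: different trajectories in the two slots are needed
  when the modes before and after a switch are compared one slot at a time.\<close>

definition bil :: "real poly poly mat \<Rightarrow> (real \<Rightarrow> nat \<Rightarrow> real) \<Rightarrow> (real \<Rightarrow> nat \<Rightarrow> real) \<Rightarrow> real \<Rightarrow> real" where
  "bil T u v t = (\<Sum>i<dim_row T. \<Sum>j<dim_col T. bil_entry (T $$ (i, j)) (\<lambda>\<tau>. u \<tau> i) (\<lambda>\<tau>. v \<tau> j) t)"

lemma qdf_bil: "qdf T v t = bil T v v t"
  unfolding qdf_def bil_def bil_entry_def pdiff_def sum_distrib_right
  by (intro sum.cong refl) simp

lemma bil_entry_bound:
  "degree P \<le> n \<Longrightarrow> bil_entry P f g t = (\<Sum>k\<le>n. pdiff (coeff P k) f t * (deriv ^^ k) g t)"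
  unfolding bil_entry_def by (rule sum.mono_neutral_left) (auto simp: coeff_eq_0)

lemma bil_entry_0 [simp]: "bil_entry 0 f g t = 0" by (simp add: bil_entry_def)

lemma bil_entry_add: "bil_entry (P + Q) f g t = bil_entry P f g t + bil_entry Q f g t"
proof -
  define n where "n = max (degree P) (degree Q)"
  have "degree (P + Q) \<le> n" "degree P \<le> n" "degree Q \<le> n" by (auto simp: n_def degree_add_le_max)
  thus ?thesis by (simp add: bil_entry_bound pdiff_add algebra_simps sum.distrib)
qed

lemma bil_entry_sum: "bil_entry (sum P A) f g t = (\<Sum>a\<in>A. bil_entry (P a) f g t)"
  by (induction A rule: infinite_finite_induct) (auto simp: bil_entry_add)

lemma bil_entry_zeta_eta:
  assumes "smooth_fn f"
  shows "bil_entry (zeta_emb p * eta_emb q) f g t = pdiff p f t * pdiff q g t"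
proof -
  have "degree (zeta_emb p * eta_emb q) \<le> degree q"
    by (rule degree_le) (simp add: coeff_zeta_eta coeff_eq_0)
  hence "bil_entry (zeta_emb p * eta_emb q) f g t = (\<Sum>k\<le>degree q. pdiff (p * [:coeff q k:]) f t * (deriv ^^ k) g t)"
    unfolding coeff_zeta_eta[symmetric] by (rule bil_entry_bound)
  also have "\<dots> = (\<Sum>k\<le>degree q. pdiff p f t * (coeff q k * (deriv ^^ k) g t))"
  proof (rule sum.cong[OF refl])
    fix k
    have "pdiff (p * [:coeff q k:]) f t = pdiff ([:coeff q k:] * p) f t" by (simp add: mult.commute)
    also have "\<dots> = coeff q k * pdiff p f t" using pdiff_mult[OF assms, of "[:coeff q k:]" p t] by simp
    finally show "pdiff (p * [:coeff q k:]) f t * (deriv ^^ k) g t = pdiff p f t * (coeff q k * (deriv ^^ k) g t)" by simp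
  qed
  finally show ?thesis by (simp add: pdiff_def[of q] sum_distrib_left)
qed

lemma bil_bivar:
  assumes M: "M \<in> carrier_mat m a" and L: "L \<in> carrier_mat m b" and u: "smooth_traj a u"
  shows "bil (bivar M L) u v t = (\<Sum>r<m. mat_diff M u t r * mat_diff L v t r)"
proof -
  have "bil (bivar M L) u v t = (\<Sum>i<a. \<Sum>j<b. \<Sum>r<m. pdiff (M $$ (r, i)) (\<lambda>\<tau>. u \<tau> i) t * pdiff (L $$ (r, j)) (\<lambda>\<tau>. v \<tau> j) t)"
    unfolding bil_def using bivar_carrier[OF M L] u bivar_index[OF M L]
    by (simp add: bil_entry_sum bil_entry_zeta_eta smooth_traj_def)
  also have "\<dots> = (\<Sum>i<a. \<Sum>r<m. \<Sum>j<b. pdiff (M $$ (r, i)) (\<lambda>\<tau>. u \<tau> i) t * pdiff (L $$ (r, j)) (\<lambda>\<tau>. v \<tau> j) t)"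
    by (intro sum.cong refl sum.swap)
  also have "\<dots> = (\<Sum>r<m. \<Sum>i<a. \<Sum>j<b. pdiff (M $$ (r, i)) (\<lambda>\<tau>. u \<tau> i) t * pdiff (L $$ (r, j)) (\<lambda>\<tau>. v \<tau> j) t)"
    by (rule sum.swap)
  also have "\<dots> = (\<Sum>r<m. mat_diff M u t r * mat_diff L v t r)"
    by (simp add: mat_diff_eq[OF M] mat_diff_eq[OF L] sum_product)
  finally show ?thesis .
qed

lemma bil_add:
  assumes "S \<in> carrier_mat a b" "T \<in> carrier_mat a b"
  shows "bil (S + T) u v t = bil S u v t + bil T u v t"
  using assms by (simp add: bil_def bil_entry_add sum.distrib)

text \<open>Product rule: \<zeta> differentiates the left argument and \<eta> the right one.\<close>

lemma bil_entry_has_deriv: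
  assumes f: "smooth_fn f" and g: "smooth_fn g"
  shows "(bil_entry P f g has_real_derivative bil_entry (zeta_plus_eta * P) f g t) (at t)"
proof -
  have "zeta_plus_eta * P = [:[:0, 1:]:] * P + pCons 0 P" by (simp add: zeta_plus_eta_def)
  hence "bil_entry (zeta_plus_eta * P) f g t = bil_entry ([:[:0, 1:]:] * P) f g t + bil_entry (pCons 0 P) f g t"
    by (simp only: bil_entry_add)
  also have "bil_entry ([:[:0, 1:]:] * P) f g t = (\<Sum>k\<le>degree P. pdiff (coeff ([:[:0, 1:]:] * P) k) f t * (deriv ^^ k) g t)"
    by (rule bil_entry_bound) (simp add: degree_smult_le)
  also have "\<dots> = (\<Sum>k\<le>degree P. pdiff (pCons 0 (coeff P k)) f t * (deriv ^^ k) g t)" by simp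
  also have "bil_entry (pCons 0 P) f g t = (\<Sum>k\<le>Suc (degree P). pdiff (coeff (pCons 0 P) k) f t * (deriv ^^ k) g t)"
    by (rule bil_entry_bound) (simp add: degree_pCons_le)
  also have "\<dots> = (\<Sum>k\<le>degree P. pdiff (coeff P k) f t * (deriv ^^ Suc k) g t)"
    by (subst sum.atMost_Suc_shift) simp
  finally have e: "bil_entry (zeta_plus_eta * P) f g t =
    (\<Sum>k\<le>degree P. pdiff (pCons 0 (coeff P k)) f t * (deriv ^^ k) g t + (deriv ^^ Suc k) g t * pdiff (coeff P k) f t)"
    by (simp add: sum.distrib mult.commute)
  have b: "bil_entry P f g = (\<lambda>t. \<Sum>k\<le>degree P. pdiff (coeff P k) f t * (deriv ^^ k) g t)"
    by (simp add: bil_entry_def fun_eq_iff)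
  show ?thesis unfolding e b
    by (intro DERIV_sum DERIV_mult pdiff_has_deriv smooth_has_deriv f g)
qed

lemma qdf_has_deriv:
  assumes T: "T \<in> carrier_mat w w" and v: "smooth_traj w v"
  shows "(qdf T v has_real_derivative qdf (ddt_poly T) v t) (at t)"
proof -
  have "((\<lambda>t. bil T v v t) has_real_derivative bil (ddt_poly T) v v t) (at t)"
    unfolding bil_def using T v
    by (auto simp: ddt_poly_def smooth_traj_def intro!: DERIV_sum bil_entry_has_deriv)
  thus ?thesis by (simp add: qdf_bil[abs_def])
qed

lemma qdf_cong:
  assumes "open U" "\<And>t. t \<in> U \<Longrightarrow> v t = u t" "t \<in> U"
  shows "qdf T v t = qdf T u t"
proof -
  have "(deriv ^^ k) (\<lambda>\<tau>. v \<tau> i) t = (deriv ^^ k) (\<lambda>\<tau>. u \<tau> i) t" for k i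
    by (rule funpow_deriv_cong[OF assms(1) _ assms(3)]) (simp add: assms(2))
  thus ?thesis by (simp add: qdf_def)
qed

section \<open>Complex differential operators, exponential decay, observability\<close>

definition cpdiff :: "complex poly \<Rightarrow> (real \<Rightarrow> real) \<Rightarrow> real \<Rightarrow> complex" where
  "cpdiff q f t = (\<Sum>k\<le>degree q. coeff q k * of_real ((deriv ^^ k) f t))"

lemma cpdiff_bound: "degree q \<le> n \<Longrightarrow> cpdiff q f t = (\<Sum>k\<le>n. coeff q k * of_real ((deriv ^^ k) f t))"
  unfolding cpdiff_def by (rule sum.mono_neutral_left) (auto simp: coeff_eq_0)

lemma cpdiff_0 [simp]: "cpdiff 0 f t = 0" by (simp add: cpdiff_def)

lemma cpdiff_add: "cpdiff (p + q) f t = cpdiff p f t + cpdiff q f t"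
proof -
  define n where "n = max (degree p) (degree q)"
  have "degree (p + q) \<le> n" "degree p \<le> n" "degree q \<le> n" by (auto simp: n_def degree_add_le_max)
  thus ?thesis by (simp add: cpdiff_bound algebra_simps sum.distrib)
qed

lemma cpdiff_smult: "cpdiff (Polynomial.smult c q) f t = c * cpdiff q f t"
  by (subst cpdiff_bound[of _ "degree q"]) (auto simp: cpdiff_def sum_distrib_left mult_ac intro: degree_smult_le)

lemma cpdiff_of_real: "cpdiff (map_poly complex_of_real p) f t = of_real (pdiff p f t)"
  by (simp add: cpdiff_def pdiff_def coeff_map_poly)

lemma cpdiff_has_deriv:
  assumes "smooth_fn f"
  shows "(cpdiff q f has_vector_derivative cpdiff (pCons 0 q) f t) (at t)"
proof -
  have "cpdiff (pCons 0 q) f t = (\<Sum>k\<le>Suc (degree q). coeff (pCons 0 q) k * of_real ((deriv ^^ k) f t))"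
    by (rule cpdiff_bound) (simp add: degree_pCons_le)
  also have "\<dots> = (\<Sum>k\<le>degree q. coeff q k * of_real ((deriv ^^ Suc k) f t))"
    by (subst sum.atMost_Suc_shift) simp
  finally have e: "cpdiff (pCons 0 q) f t = (\<Sum>k\<le>degree q. coeff q k * of_real ((deriv ^^ Suc k) f t))" .
  have c: "cpdiff q f = (\<lambda>t. \<Sum>k\<le>degree q. coeff q k * of_real ((deriv ^^ k) f t))"
    by (simp add: cpdiff_def fun_eq_iff)
  show ?thesis unfolding c e
    by (intro has_vector_derivative_sum has_vector_derivative_mult_right has_vector_derivative_of_real
        has_real_derivative_iff_has_vector_derivative[THEN iffD1] smooth_has_deriv assms)
qed

lemma cpdiff_pCons_zero:
  assumes "smooth_fn f" "\<And>t. cpdiff q f t = 0"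
  shows "cpdiff (pCons 0 q) f t = 0"
proof -
  have "cpdiff q f = (\<lambda>t. 0)" using assms(2) by auto
  hence "((\<lambda>t. 0) has_vector_derivative cpdiff (pCons 0 q) f t) (at t)"
    using cpdiff_has_deriv[OF assms(1), of q t] by simp
  thus ?thesis using has_vector_derivative_const vector_derivative_unique_at by blast
qed

text \<open>Annihilators form an ideal: multiplication by \<xi> amounts to differentiating the zero
  function.\<close>

lemma cpdiff_mult_zero:
  assumes "smooth_fn f" "\<And>t. cpdiff q f t = 0"
  shows "cpdiff (s * q) f t = 0"
proof (induction s arbitrary: t)
  case (pCons a s)
  have "cpdiff (pCons a s * q) f t = a * cpdiff q f t + cpdiff (pCons 0 (s * q)) f t"
    by (simp add: cpdiff_add cpdiff_smult)
  also have "\<dots> = 0" using cpdiff_pCons_zero[OF assms(1) pCons.IH] assms(2) by simp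
  finally show ?case .
qed simp

lemma cpdiff_linear_factor: "cpdiff ([:-lam, 1:] * q) f t = cpdiff (pCons 0 q) f t - lam * cpdiff q f t"
proof -
  have "[:-lam, 1:] * q = Polynomial.smult (-lam) q + pCons 0 q" by simp
  thus ?thesis by (simp only: cpdiff_add cpdiff_smult) simp
qed

text \<open>The rate is existential because each first-order equation may lower it, which disposes
  of resonance.\<close>

definition exp_decay :: "(real \<Rightarrow> complex) \<Rightarrow> bool" where
  "exp_decay g \<longleftrightarrow> (\<exists>C \<mu>. \<mu> > 0 \<and> (\<forall>t\<ge>0. cmod (g t) \<le> C * exp (- \<mu> * t)))"

text \<open>Energy estimate for u = |g|^2: completing the square gives u' + m u \<le> C^2 exp(-2
  \<nu> t) / m with m = - Re lam, and a comparison function then bounds u.\<close>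

lemma exp_decay_ode:
  assumes g: "\<And>t. (g has_vector_derivative lam * g t + h t) (at t)"
    and lam: "Re lam < 0" and h: "exp_decay h"
  shows "exp_decay g"
proof -
  obtain C \<mu> where C: "\<mu> > 0" "\<And>t. t \<ge> 0 \<Longrightarrow> cmod (h t) \<le> C * exp (- \<mu> * t)"
    using h unfolding exp_decay_def by blast
  define m where "m = - Re lam"
  have m: "m > 0" using lam by (simp add: m_def)
  \<comment> \<open>A positive rate at most \<mu> and below m / 2: keeping 2 \<nu> strictly below m
    makes the denominator of \<open>K\<close> positive.\<close>
  define \<nu> where "\<nu> = min \<mu> (m / 4)"
  have \<nu>: "\<nu> > 0" "\<nu> \<le> \<mu>" "2 * \<nu> < m" using C(1) m by (auto simp: \<nu>_def)
  define u where "u t = (Re (g t))\<^sup>2 + (Im (g t))\<^sup>2" for t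
  define u' where "u' t = 2 * (Re (g t) * Re (lam * g t + h t) + Im (g t) * Im (lam * g t + h t))" for t
  have u: "(u has_real_derivative u' t) (at t)" for t
  proof -
    have "((\<lambda>t. Re (g t)) has_vector_derivative Re (lam * g t + h t)) (at t)"
      "((\<lambda>t. Im (g t)) has_vector_derivative Im (lam * g t + h t)) (at t)"
      by (rule bounded_linear.has_vector_derivative[OF bounded_linear_Re g],
          rule bounded_linear.has_vector_derivative[OF bounded_linear_Im g])
    hence d: "((\<lambda>t. Re (g t)) has_real_derivative Re (lam * g t + h t)) (at t)"
      "((\<lambda>t. Im (g t)) has_real_derivative Im (lam * g t + h t)) (at t)"
      by (simp_all add: has_real_derivative_iff_has_vector_derivative)
    show ?thesis unfolding u_def[abs_def] u'_def power2_eq_square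
      by (rule DERIV_cong[OF DERIV_add[OF DERIV_mult[OF d(1) d(1)] DERIV_mult[OF d(2) d(2)]]])
        (simp add: algebra_simps)
  qed
  have un: "u t = (cmod (g t))\<^sup>2" for t by (simp add: u_def cmod_power2)
  have bound: "u' t + m * u t \<le> C\<^sup>2 / m * exp (- 2 * \<nu> * t)" if t: "t \<ge> 0" for t
  proof -
    have "u' t = 2 * Re (cnj (g t) * (lam * g t + h t))" by (simp add: u'_def)
    also have "cnj (g t) * (lam * g t + h t) = lam * of_real (u t) + cnj (g t) * h t"
      by (simp add: un complex_norm_square algebra_simps del: of_real_power)
    finally have e: "u' t = - 2 * m * u t + 2 * Re (cnj (g t) * h t)" by (simp add: m_def)
    have "Re (cnj (g t) * h t) \<le> cmod (g t) * cmod (h t)"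
      using complex_Re_le_cmod[of "cnj (g t) * h t"] by (simp add: norm_mult)
    moreover have "2 * (cmod (g t) * cmod (h t)) \<le> m * u t + (cmod (h t))\<^sup>2 / m"
    proof -
      have "0 \<le> (m * cmod (g t) - cmod (h t))\<^sup>2 / m" using m by simp
      also have "\<dots> = m * u t + (cmod (h t))\<^sup>2 / m - 2 * (cmod (g t) * cmod (h t))"
        using m by (simp add: un field_simps power2_eq_square)
      finally show ?thesis by simp
    qed
    moreover have "(cmod (h t))\<^sup>2 / m \<le> C\<^sup>2 / m * exp (- 2 * \<nu> * t)"
    proof -
      have "(cmod (h t))\<^sup>2 \<le> (C * exp (- \<mu> * t))\<^sup>2" using C(2)[OF t] by (intro power_mono) auto
      also have "\<dots> = C\<^sup>2 * exp (- 2 * \<mu> * t)" by (simp add: power_mult_distrib exp_double[symmetric])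
      also have "\<dots> \<le> C\<^sup>2 * exp (- 2 * \<nu> * t)" using \<nu> t by (intro mult_left_mono) (auto intro: mult_right_mono)
      finally show ?thesis using m by (simp add: divide_right_mono)
    qed
    ultimately show ?thesis using e by linarith
  qed
  \<comment> \<open>Chosen so that K (m - 2 \<nu>) = C^2 / m: then K exp(-2 \<nu> t) satisfies the
    comparison inequality with equality, and \<phi> is nonincreasing.\<close>
  define K where "K = C\<^sup>2 / (m * (m - 2 * \<nu>))"
  have K: "K \<ge> 0" using m \<nu> by (simp add: K_def)
  define \<phi> where "\<phi> t = exp (m * t) * u t - K * exp ((m - 2 * \<nu>) * t)" for t
  have "u t \<le> (u 0 + K) * exp (- 2 * \<nu> * t)" if t: "t \<ge> 0" for t
  proof -
    have "\<phi> t \<le> \<phi> 0"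
    proof (rule DERIV_nonpos_imp_nonincreasing[OF t])
      fix x :: real assume x: "0 \<le> x" "x \<le> t"
      define \<phi>' where "\<phi>' = exp (m * x) * (u' x + m * u x) - K * (m - 2 * \<nu>) * exp ((m - 2 * \<nu>) * x)"
      have "(\<phi> has_real_derivative \<phi>') (at x)"
        unfolding \<phi>_def[abs_def] \<phi>'_def by (auto intro!: derivative_eq_intros u simp: algebra_simps)
      moreover have "\<phi>' \<le> 0"
      proof -
        have "exp (m * x) * (u' x + m * u x) \<le> exp (m * x) * (C\<^sup>2 / m * exp (- 2 * \<nu> * x))"
          using bound[OF x(1)] by (intro mult_left_mono) auto
        also have "\<dots> = C\<^sup>2 / m * exp ((m - 2 * \<nu>) * x)" by (simp add: algebra_simps flip: exp_add)
        also have "C\<^sup>2 / m = K * (m - 2 * \<nu>)" using m \<nu> by (simp add: K_def)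
        finally show ?thesis by (simp add: \<phi>'_def)
      qed
      ultimately show "\<exists>y. DERIV \<phi> x :> y \<and> y \<le> 0" by blast
    qed
    hence "exp (m * t) * u t \<le> u 0 - K + K * exp ((m - 2 * \<nu>) * t)" by (simp add: \<phi>_def)
    also have "\<dots> \<le> u 0 * exp ((m - 2 * \<nu>) * t) + K * exp ((m - 2 * \<nu>) * t)"
    proof -
      have "1 \<le> exp ((m - 2 * \<nu>) * t)" using \<nu> t by simp
      hence "u 0 * 1 \<le> u 0 * exp ((m - 2 * \<nu>) * t)" by (intro mult_left_mono) (auto simp: u_def)
      thus ?thesis using K by simp
    qed
    also have "\<dots> = exp (m * t) * ((u 0 + K) * exp (- 2 * \<nu> * t))"
      by (simp add: algebra_simps flip: exp_add)
    finally show ?thesis by simp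
  qed
  hence "cmod (g t) \<le> sqrt (u 0 + K) * exp (- \<nu> * t)" if "t \<ge> 0" for t
  proof -
    have "(cmod (g t))\<^sup>2 \<le> (u 0 + K) * exp (- 2 * \<nu> * t)" using that \<open>\<And>t. t \<ge> 0 \<Longrightarrow> u t \<le> _\<close> un by metis
    also have "\<dots> = (sqrt (u 0 + K) * exp (- \<nu> * t))\<^sup>2"
      using K by (simp add: power_mult_distrib u_def exp_double[symmetric])
    finally show ?thesis by (rule power2_le_imp_le) (use K in \<open>simp add: u_def\<close>)
  qed
  thus ?thesis unfolding exp_decay_def using \<nu>(1) by blast
qed

text \<open>Complex coefficients allow a split into linear factors. With \<xi> - lam peeled off, the
  signal (\<xi> - lam) q f decays by induction and drives a stable first-order equation for q
  f.\<close>

lemma cpdiff_decay: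
  assumes f: "smooth_fn f" and r: "r \<noteq> 0" "\<And>z. poly r z = 0 \<Longrightarrow> Re z < 0"
    and z: "\<And>t. cpdiff (r * q) f t = 0"
  shows "exp_decay (cpdiff q f)"
  using r z
proof (induction "degree r" arbitrary: r q rule: less_induct)
  case less
  show ?case
  proof (cases "degree r = 0")
    case True
    then obtain c where c: "r = [:c:]" using degree_eq_zeroE by blast
    hence "cpdiff q f t = 0" for t using less.prems(1) less.prems(3)[of t] by (simp add: cpdiff_smult)
    thus ?thesis by (auto simp: exp_decay_def intro!: exI[of _ 0] exI[of _ 1])
  next
    case False
    then obtain lam where lam: "poly r lam = 0"
      using fundamental_theorem_of_algebra[of r] by (auto simp: constant_degree)
    then obtain r' where r': "r = [:-lam, 1:] * r'" by (auto simp: poly_eq_0_iff_dvd elim: dvdE)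
    have r'0: "r' \<noteq> 0" using less.prems(1) r' by auto
    have "degree r' < degree r" using r'0 by (subst r', subst degree_mult_eq) auto
    moreover have "Re z < 0" if "poly r' z = 0" for z using less.prems(2)[of z] that by (simp add: r')
    moreover have "cpdiff (r' * ([:-lam, 1:] * q)) f t = 0" for t
    proof -
      have "r' * ([:-lam, 1:] * q) = r * q" unfolding r' by (simp only: mult_ac)
      thus ?thesis using less.prems(3) by simp
    qed
    ultimately have "exp_decay (cpdiff ([:-lam, 1:] * q) f)" using less.hyps[of r'] r'0 by blast
    moreover have "(cpdiff q f has_vector_derivative lam * cpdiff q f t + cpdiff ([:-lam, 1:] * q) f t) (at t)" for t
      using cpdiff_has_deriv[OF f, of q t] by (simp only: cpdiff_linear_factor) simp
    ultimately show ?thesis using exp_decay_ode less.prems(2)[OF lam] by blast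
  qed
qed

text \<open>The k-th derivative satisfies the same equation, so \<open>cpdiff_decay\<close> applies
  to it with cofactor 1.\<close>

lemma hurwitz_decay:
  assumes f: "smooth_fn f" and p: "p \<noteq> 0" "\<And>z. cpoly p z = 0 \<Longrightarrow> Re z < 0" and z: "\<And>t. pdiff p f t = 0"
  shows "((deriv ^^ k) f \<longlongrightarrow> 0) at_top"
proof -
  have sf: "smooth_fn ((deriv ^^ k) f)" by (rule smooth_deriv[OF f])
  have "(deriv ^^ k) (pdiff p f) t = 0" for t
  proof -
    have "pdiff p f = (\<lambda>t. 0)" using z by auto
    thus ?thesis using smooth_zero(2) by simp
  qed
  hence "pdiff p ((deriv ^^ k) f) t = 0" for t using smooth_pdiff(2)[OF f] by simp
  hence "cpdiff (map_poly complex_of_real p * 1) ((deriv ^^ k) f) t = 0" for t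
    by (simp add: cpdiff_of_real)
  moreover have "map_poly complex_of_real p \<noteq> 0" using p(1) by (simp add: map_poly_eq_0_iff)
  ultimately have "exp_decay (cpdiff 1 ((deriv ^^ k) f))"
    using cpdiff_decay[OF sf, of "map_poly complex_of_real p" 1] p(2) by (simp add: cpoly_def)
  hence "exp_decay (\<lambda>t. of_real ((deriv ^^ k) f t))" by (simp add: cpdiff_def[abs_def])
  then obtain C \<mu> where C: "\<mu> > 0" "\<And>t. t \<ge> 0 \<Longrightarrow> \<bar>(deriv ^^ k) f t\<bar> \<le> C * exp (- \<mu> * t)"
    unfolding exp_decay_def by auto
  have "((\<lambda>t. C * exp (- \<mu> * t)) \<longlongrightarrow> 0) at_top" using C(1) by real_asymp
  moreover have "\<forall>\<^sub>F t in at_top. norm ((deriv ^^ k) f t) \<le> C * exp (- \<mu> * t)"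
    using eventually_ge_at_top[of 0] by eventually_elim (use C(2) in simp)
  ultimately show ?thesis by (rule Lim_null_comparison[rotated])
qed

text \<open>
  If \<open>v \<noteq> 0\<close>, dividing an annihilating polynomial of minimal degree by a linear factor \<open>\<xi> - lam\<close>
  produces a nonzero exponential trajectory of frequency \<open>lam\<close>, contradicting the rank condition.
\<close>

lemma observable_zero:
  assumes M: "M \<in> carrier_mat m w" and v: "smooth_traj w v"
    and obs: "\<And>z x. \<forall>i<m. (\<Sum>j<w. cpoly (M $$ (i, j)) z * x j) = 0 \<Longrightarrow> \<forall>j<w. x j = 0"
    and Mv: "\<And>t i. i < m \<Longrightarrow> mat_diff M v t i = 0"
    and p: "p \<noteq> 0" "\<And>j t. j < w \<Longrightarrow> pdiff p (\<lambda>\<tau>. v \<tau> j) t = 0" and j: "j < w"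
  shows "v t j = 0"
proof -
  define A where "A q \<longleftrightarrow> q \<noteq> 0 \<and> (\<forall>j<w. \<forall>t. cpdiff q (\<lambda>\<tau>. v \<tau> j) t = 0)" for q
  have "A (map_poly complex_of_real p)"
    using p by (simp add: A_def cpdiff_of_real map_poly_eq_0_iff)
  then obtain q where q: "A q" "\<And>q'. A q' \<Longrightarrow> degree q \<le> degree q'"
    using ex_has_least_nat[of A _ degree] by blast
  have sv: "smooth_fn (\<lambda>\<tau>. v \<tau> j)" if "j < w" for j using v that by (simp add: smooth_traj_def)
  show ?thesis
  proof (cases "degree q = 0")
    case True
    then obtain c where c: "q = [:c:]" using degree_eq_zeroE by blast
    have "cpdiff q (\<lambda>\<tau>. v \<tau> j) t = c * of_real (v t j)" by (simp add: c cpdiff_def)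
    thus ?thesis using q(1) j c by (simp add: A_def)
  next
    case False
    then obtain lam where "poly q lam = 0"
      using fundamental_theorem_of_algebra[of q] by (auto simp: constant_degree)
    then obtain r where r: "q = [:-lam, 1:] * r" by (auto simp: poly_eq_0_iff_dvd elim: dvdE)
    have r0: "r \<noteq> 0" using q(1) r by (auto simp: A_def)
    have "degree r < degree q" using r0 by (subst r, subst degree_mult_eq) auto
    hence "\<not> A r" using q(2)[of r] by auto
    then obtain j0 t0 where j0: "j0 < w" "cpdiff r (\<lambda>\<tau>. v \<tau> j0) t0 \<noteq> 0"
      using r0 by (auto simp: A_def)
    \<comment> \<open>Since (\<xi> - lam) r = q annihilates every component, each polynomial acts on
      the signals r v as multiplication by its value at lam.\<close>
    have ev: "cpdiff (s * r) (\<lambda>\<tau>. v \<tau> j) t = poly s lam * cpdiff r (\<lambda>\<tau>. v \<tau> j) t" if "j < w" for s j t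
    proof -
      have "poly (s - [:poly s lam:]) lam = 0" by simp
      then obtain s' where s': "s - [:poly s lam:] = [:-lam, 1:] * s'"
        unfolding poly_eq_0_iff_dvd dvd_def by blast
      have "s = s' * [:-lam, 1:] + [:poly s lam:]" using s' by (simp add: algebra_simps)
      hence "s * r = s' * q + Polynomial.smult (poly s lam) r"
        by (metis (no_types, lifting) r distrib_right mult.assoc mult_smult_left smult_one mult_1 mult_pCons_left pCons_0_0 add.right_neutral)
      moreover have "cpdiff (s' * q) (\<lambda>\<tau>. v \<tau> j) t = 0"
        using q(1) that by (intro cpdiff_mult_zero sv) (auto simp: A_def)
      ultimately show ?thesis by (simp add: cpdiff_add cpdiff_smult)
    qed
    \<comment> \<open>M v = 0 survives composition with any complex operator s; for s = r, the fact
      \<open>ev\<close> turns it into M(lam) applied to a vector.\<close>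
    have zero: "(\<Sum>j<w. cpdiff (map_poly complex_of_real (M $$ (i, j)) * s) (\<lambda>\<tau>. v \<tau> j) t) = 0" if i: "i < m" for i s t
    proof (induction s arbitrary: t)
      case (pCons a s)
      have "((\<lambda>t. \<Sum>j<w. cpdiff (map_poly complex_of_real (M $$ (i, j)) * s) (\<lambda>\<tau>. v \<tau> j) t) has_vector_derivative
         (\<Sum>j<w. cpdiff (pCons 0 (map_poly complex_of_real (M $$ (i, j)) * s)) (\<lambda>\<tau>. v \<tau> j) t)) (at t)"
        by (intro has_vector_derivative_sum cpdiff_has_deriv sv) simp
      hence "((\<lambda>t. 0) has_vector_derivative
         (\<Sum>j<w. cpdiff (pCons 0 (map_poly complex_of_real (M $$ (i, j)) * s)) (\<lambda>\<tau>. v \<tau> j) t)) (at t)"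
        by (simp only: pCons.IH)
      hence d: "(\<Sum>j<w. cpdiff (pCons 0 (map_poly complex_of_real (M $$ (i, j)) * s)) (\<lambda>\<tau>. v \<tau> j) t) = 0"
        using has_vector_derivative_const vector_derivative_unique_at by blast
      have "(\<Sum>j<w. cpdiff (map_poly complex_of_real (M $$ (i, j))) (\<lambda>\<tau>. v \<tau> j) t) = of_real (mat_diff M v t i)"
        by (simp add: cpdiff_of_real mat_diff_eq[OF M])
      hence "(\<Sum>j<w. cpdiff (map_poly complex_of_real (M $$ (i, j))) (\<lambda>\<tau>. v \<tau> j) t) = 0"
        using Mv[OF i] by simp
      thus ?case using d by (simp add: cpdiff_add cpdiff_smult sum.distrib flip: sum_distrib_left)
    qed simp
    have "\<forall>j<w. cpdiff r (\<lambda>\<tau>. v \<tau> j) t0 = 0"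
    proof (rule obs[of lam], intro allI impI)
      fix i assume "i < m"
      from zero[OF this, of r t0] show "(\<Sum>j<w. cpoly (M $$ (i, j)) lam * cpdiff r (\<lambda>\<tau>. v \<tau> j) t0) = 0"
        by (simp add: ev cpoly_def)
    qed
    thus ?thesis using j0 by blast
  qed
qed

section \<open>Relative degree of positive-real functions\<close>

lemma degree_map_of_real [simp]: "degree (map_poly complex_of_real p) = degree p"
  by (rule degree_map_poly) simp

text \<open>Maximum modulus for exp(-g), whose modulus is exp(-Re g), on a large half-disc: on the
  diameter Re g is nonnegative, and on the arc g is small because it vanishes at infinity.\<close>

lemma rational_nonneg_rhp:
  fixes n d :: "complex poly"
  assumes deg: "degree n < degree d" and hur: "\<And>z. poly d z = 0 \<Longrightarrow> Re z < 0"
    and pos: "\<And>\<omega>::real. Re (poly n (\<i> * of_real \<omega>) / poly d (\<i> * of_real \<omega>)) \<ge> 0"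
    and s: "Re s > 0"
  shows "Re (poly n s / poly d s) \<ge> 0"
proof (rule ccontr)
  define g where "g z = poly n z / poly d z" for z
  assume "\<not> Re (poly n s / poly d s) \<ge> 0"
  \<comment> \<open>Half of the assumed violation: a bound of -Re g by \<open>e\<close> contradicts
    -Re (g s) = 2 e.\<close>
  define e where "e = - Re (g s) / 2"
  have e: "e > 0" using \<open>\<not> _\<close> by (simp add: e_def g_def)
  have "(g \<longlongrightarrow> 0) at_infinity" unfolding g_def by (rule poly_divide_tendsto_0_at_infinity[OF deg])
  hence "\<forall>\<^sub>F z in at_infinity. norm (g z) < e" using e by (auto simp: tendsto_iff)
  then obtain B where B: "\<And>z. norm z \<ge> B \<Longrightarrow> norm (g z) < e" by (auto simp: eventually_at_infinity)
  define r where "r = max B (norm s) + 1"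
  define S where "S = {z. Re z > 0} \<inter> ball 0 r"
  have oS: "open S" unfolding S_def by (intro open_Int open_halfspace_Re_gt open_ball)
  have cS: "closure S \<subseteq> {z. Re z \<ge> 0} \<inter> cball 0 r"
    by (rule closure_minimal) (auto simp: S_def intro!: closed_Int closed_halfspace_Re_ge)
  have d0: "poly d z \<noteq> 0" if "Re z \<ge> 0" for z using hur[of z] that by auto
  have hol: "(\<lambda>z. exp (- g z)) holomorphic_on {z. Re z \<ge> 0}"
    unfolding g_def using d0 by (auto intro!: holomorphic_intros)
  have "cmod (exp (- g s)) \<le> exp e"
  proof (rule maximum_modulus_frontier[where f = "\<lambda>z. exp (- g z)" and S = S and \<xi> = s])
    have "interior S \<subseteq> {z. Re z \<ge> 0}" using interior_subset[of S] by (auto simp: S_def)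
    thus "(\<lambda>z. exp (- g z)) holomorphic_on interior S" by (rule holomorphic_on_subset[OF hol])
    show "continuous_on (closure S) (\<lambda>z. exp (- g z))"
      by (rule continuous_on_subset[OF holomorphic_on_imp_continuous_on[OF hol]]) (use cS in auto)
    show "bounded S" by (rule bounded_subset[of "ball 0 r"]) (auto simp: S_def)
    show "s \<in> S" using s by (auto simp: S_def r_def)
    fix z assume "z \<in> frontier S"
    hence z: "z \<in> closure S" "z \<notin> S" using oS by (auto simp: frontier_def interior_open)
    have "- Re (g z) \<le> e"
    proof (cases "Re z = 0")
      case True
      hence "z = \<i> * of_real (Im z)" by (simp add: complex_eq_iff)
      hence "Re (g z) \<ge> 0" using pos[of "Im z"] by (metis g_def)
      thus ?thesis using e by simp
    next
      case False
      hence "norm z \<ge> r" using z cS by (auto simp: S_def)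
      hence "norm (g z) < e" by (intro B) (simp add: r_def)
      thus ?thesis using abs_Re_le_cmod[of "g z"] by linarith
    qed
    thus "cmod (exp (- g z)) \<le> exp e" by simp
  qed
  hence "- Re (g s) \<le> e" by simp
  thus False using e by (simp add: e_def)
qed

text \<open>
  If \<open>n(z)/d(z)\<close> behaves like \<open>c z^(-m)\<close> at infinity, nonnegativity of the real part along the ray of
  angle \<open>\<theta>\<close> forces \<open>c cos (m \<theta>) \<ge> 0\<close> for all \<open>\<bar>\<theta>\<bar> < pi / 2\<close>, hence \<open>m = 1\<close> and \<open>c > 0\<close>.
\<close>

lemma positive_real_relative_degree:
  fixes n d :: "real poly"
  assumes deg: "degree n < degree d" and hur: "\<And>z. cpoly d z = 0 \<Longrightarrow> Re z < 0"
    and pos: "\<And>\<omega>::real. Re (cpoly n (\<i> * of_real \<omega>) / cpoly d (\<i> * of_real \<omega>)) > 0"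
  shows "coeff n (degree d - 1) * lead_coeff d > 0"
proof -
  let ?n = "map_poly complex_of_real n" and ?d = "map_poly complex_of_real d"
  define m where "m = degree d - degree n"
  define c where "c = lead_coeff n / lead_coeff d"
  have n0: "n \<noteq> 0" using pos[of 0] by auto
  have d0: "d \<noteq> 0" using deg by auto
  have c0: "c \<noteq> 0" using n0 d0 by (simp add: c_def)
  have m0: "m > 0" using deg by (simp add: m_def)
  have lim: "((\<lambda>z. poly ?n z / poly ?d z * z ^ m) \<longlongrightarrow> of_real c) at_infinity"
  proof -
    have "((\<lambda>z. (poly ?n z / z ^ degree ?n) / (poly ?d z / z ^ degree ?d)) \<longlongrightarrow> lead_coeff ?n / lead_coeff ?d) at_infinity"
      using d0 by (intro tendsto_divide poly_divide_tendsto_aux) (auto simp: map_poly_eq_0_iff coeff_map_poly)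
    moreover have "\<forall>\<^sub>F z in at_infinity. (poly ?n z / z ^ degree ?n) / (poly ?d z / z ^ degree ?d) = poly ?n z / poly ?d z * z ^ m"
    proof -
      have "\<forall>\<^sub>F z :: complex in at_infinity. z \<noteq> 0"
        by (rule eventually_not_equal_at_infinity)
      thus ?thesis
      proof eventually_elim
        case (elim z)
        have e: "z ^ degree d = z ^ degree n * z ^ m" using deg by (simp add: m_def flip: power_add)
        have f: "(a / x) / (b / (x * y)) = a / b * y" if "x \<noteq> 0" "y \<noteq> 0" for a b x y :: complex
          using that by (cases "b = 0") (simp_all add: field_simps)
        show ?case unfolding degree_map_of_real e by (rule f) (use elim in auto)
      qed
    qed
    ultimately have "((\<lambda>z. poly ?n z / poly ?d z * z ^ m) \<longlongrightarrow> lead_coeff ?n / lead_coeff ?d) at_infinity"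
      by (rule Lim_transform_eventually)
    thus ?thesis by (simp add: c_def coeff_map_poly)
  qed
  \<comment> \<open>Multiplying n(z)/d(z) by z^m and rotating by -m \<theta> leaves n(z)/d(z) times
    \<rho>^m, whose real part is nonnegative by \<open>rational_nonneg_rhp\<close>, while the limit
    is c rotated by -m \<theta>.\<close>
  have cc: "c * cos (of_nat m * \<theta>) \<ge> 0" if \<theta>: "- pi / 2 < \<theta>" "\<theta> < pi / 2" for \<theta>
  proof -
    have cos: "cos \<theta> > 0" using \<theta> cos_gt_zero_pi by simp
    have "filterlim (\<lambda>\<rho>. of_real \<rho> * cis \<theta>) at_infinity at_top"
    proof -
      have "filterlim (\<lambda>\<rho>::real. norm (of_real \<rho> * cis \<theta>)) at_top at_top"
        by (simp add: norm_mult filterlim_abs_real)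
      thus ?thesis by (simp add: filterlim_norm_at_top_imp_at_infinity)
    qed
    from filterlim_compose[OF lim this]
    have "((\<lambda>\<rho>. poly ?n (of_real \<rho> * cis \<theta>) / poly ?d (of_real \<rho> * cis \<theta>) * (of_real \<rho> * cis \<theta>) ^ m * cis (- (of_nat m * \<theta>)))
        \<longlongrightarrow> of_real c * cis (- (of_nat m * \<theta>))) at_top" by (intro tendsto_mult tendsto_const)
    hence "((\<lambda>\<rho>. Re (poly ?n (of_real \<rho> * cis \<theta>) / poly ?d (of_real \<rho> * cis \<theta>) * (of_real \<rho> * cis \<theta>) ^ m * cis (- (of_nat m * \<theta>))))
        \<longlongrightarrow> Re (of_real c * cis (- (of_nat m * \<theta>)))) at_top" by (rule tendsto_Re)
    moreover have "\<forall>\<^sub>F \<rho> in at_top. 0 \<le> Re (poly ?n (of_real \<rho> * cis \<theta>) / poly ?d (of_real \<rho> * cis \<theta>) * (of_real \<rho> * cis \<theta>) ^ m * cis (- (of_nat m * \<theta>)))"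
      using eventually_gt_at_top[of 0]
    proof eventually_elim
      case (elim \<rho>)
      have "cis \<theta> ^ m * cis (- (of_nat m * \<theta>)) = 1"
        unfolding Complex.DeMoivre cis_mult by simp
      hence e: "(of_real \<rho> * cis \<theta>) ^ m * cis (- (of_nat m * \<theta>)) = of_real (\<rho> ^ m)"
        by (simp add: power_mult_distrib mult.assoc)
      have re: "Re (X * of_real r) = Re X * r" for X r by simp
      have "Re (poly ?n (of_real \<rho> * cis \<theta>) / poly ?d (of_real \<rho> * cis \<theta>)) \<ge> 0"
      proof (rule rational_nonneg_rhp)
        show "Re z < 0" if "poly ?d z = 0" for z using hur[of z] that by (simp add: cpoly_def)
        show "0 \<le> Re (poly ?n (\<i> * of_real \<omega>) / poly ?d (\<i> * of_real \<omega>))" for \<omega> :: real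
          using less_imp_le[OF pos[of \<omega>]] by (simp only: cpoly_def)
      qed (use deg cos elim in simp_all)
      hence "0 \<le> Re (poly ?n (of_real \<rho> * cis \<theta>) / poly ?d (of_real \<rho> * cis \<theta>) * of_real (\<rho> ^ m))"
        unfolding re by (intro mult_nonneg_nonneg) (use elim in simp_all)
      thus ?case by (simp only: mult.assoc e)
    qed
    ultimately have "0 \<le> Re (of_real c * cis (- (of_nat m * \<theta>)))"
      by (rule tendsto_lowerbound) simp
    thus ?thesis by simp
  qed
  have cpos: "c > 0" using cc[of 0] c0 by simp
  have "m = 1"
  proof (rule ccontr)
    assume "m \<noteq> 1"
    hence m2: "real m \<ge> 2" using m0 by simp
    \<comment> \<open>Makes m \<theta> = 3 pi / 4, where the cosine is negative; the angle is below
      pi / 2 as soon as m \<ge> 2.\<close>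
    define \<theta> where "\<theta> = 3 * pi / (4 * real m)"
    have "\<theta> \<le> 3 * pi / (4 * 2)" unfolding \<theta>_def using m2 by (intro divide_left_mono) auto
    hence "\<theta> < pi / 2" using pi_gt_zero by linarith
    moreover have "- pi / 2 < \<theta>"
    proof -
      have "0 < \<theta>" unfolding \<theta>_def using m2 by (intro divide_pos_pos mult_pos_pos pi_gt_zero) auto
      thus ?thesis using pi_gt_zero by linarith
    qed
    ultimately have "c * cos (real m * \<theta>) \<ge> 0" by (intro cc)
    moreover have "real m * \<theta> = pi / 2 + pi / 4" using m2 by (simp add: \<theta>_def field_simps)
    moreover have "cos (pi / 2 + pi / 4) < 0"
      unfolding cos_add by (simp add: sin_45)
    ultimately show False using cpos by (simp add: zero_le_mult_iff)
  qed
  hence "degree n = degree d - 1" using deg by (simp add: m_def)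
  hence "coeff n (degree d - 1) * lead_coeff d = c * (lead_coeff d)\<^sup>2"
    using d0 by (simp add: c_def power2_eq_square)
  thus ?thesis using cpos d0 by simp
qed

section \<open>The storage function\<close>

lemma coeff_mult_top:
  assumes "degree p \<le> a" "degree q \<le> b"
  shows "coeff (p * q) (a + b) = coeff p a * coeff (q :: 'a :: comm_semiring_0 poly) b"
proof -
  have "coeff (p * q) (a + b) = (\<Sum>i\<le>a + b. coeff p i * coeff q (a + b - i))" by (rule coeff_mult)
  also have "\<dots> = (\<Sum>i\<in>{a}. coeff p i * coeff q (a + b - i))"
  proof (rule sum.mono_neutral_right)
    show "\<forall>i\<in>{..a + b} - {a}. coeff p i * coeff q (a + b - i) = 0"
    proof
      fix i assume i: "i \<in> {..a + b} - {a}"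
      show "coeff p i * coeff q (a + b - i) = 0"
      proof (cases "i < a")
        case True
        hence "coeff q (a + b - i) = 0" using assms i by (intro coeff_eq_0) auto
        thus ?thesis by simp
      next
        case False
        hence "coeff p i = 0" using assms i by (intro coeff_eq_0) auto
        thus ?thesis by simp
      qed
    qed
  qed auto
  finally show ?thesis by simp
qed

lemma coeff_neg_poly: "coeff (neg_poly p) k = (-1) ^ k * coeff p k"
proof -
  have "neg_poly p = pcompose p (Polynomial.smult (-1) [:0, 1:])" by (simp add: neg_poly_def)
  thus ?thesis using coeff_pcompose_linear[of p "-1" k] by (simp add: neg_poly_def)
qed

lemma degree_neg_poly [simp]: "degree (neg_poly p) = degree p"
  by (simp add: neg_poly_def)

lemma neg_poly_add: "neg_poly (p + q) = neg_poly p + neg_poly q"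
  and neg_poly_mult: "neg_poly (p * q) = neg_poly p * neg_poly q"
  and neg_poly_0 [simp]: "neg_poly 0 = 0"
  by (simp_all add: neg_poly_def pcompose_add pcompose_mult)

lemma neg_poly_sum: "neg_poly (sum f A) = (\<Sum>a\<in>A. neg_poly (f a))"
  by (induction A rule: infinite_finite_induct) (auto simp: neg_poly_add)

text \<open>With A = adj(R1), this congruence turns statements about \<Phi> into statements about G
  over the denominator det(R1).\<close>

lemma para_congruence:
  assumes M: "M \<in> carrier_mat m w" and L: "L \<in> carrier_mat m w" and A: "A \<in> carrier_mat w w"
    and pq: "p < w" "q < w"
  shows "(\<Sum>i<w. \<Sum>j<w. neg_poly (A $$ (i, p)) * (\<Sum>r<m. neg_poly (M $$ (r, i)) * L $$ (r, j)) * A $$ (j, q)) =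
    (\<Sum>r<m. neg_poly ((M * A) $$ (r, p)) * (L * A) $$ (r, q))"
proof -
  have e: "(M * A) $$ (r, p) = (\<Sum>i<w. M $$ (r, i) * A $$ (i, p))" "(L * A) $$ (r, q) = (\<Sum>j<w. L $$ (r, j) * A $$ (j, q))"
    if "r < m" for r
    using M L A pq that by (auto simp: scalar_prod_def atLeast0LessThan intro!: sum.cong)
  have "(\<Sum>i<w. \<Sum>j<w. neg_poly (A $$ (i, p)) * (\<Sum>r<m. neg_poly (M $$ (r, i)) * L $$ (r, j)) * A $$ (j, q)) =
    (\<Sum>i<w. \<Sum>j<w. \<Sum>r<m. (neg_poly (M $$ (r, i)) * neg_poly (A $$ (i, p))) * (L $$ (r, j) * A $$ (j, q)))"
    by (simp add: sum_distrib_left sum_distrib_right mult_ac)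
  also have "\<dots> = (\<Sum>i<w. \<Sum>r<m. \<Sum>j<w. (neg_poly (M $$ (r, i)) * neg_poly (A $$ (i, p))) * (L $$ (r, j) * A $$ (j, q)))"
    by (intro sum.cong refl sum.swap)
  also have "\<dots> = (\<Sum>r<m. \<Sum>i<w. \<Sum>j<w. (neg_poly (M $$ (r, i)) * neg_poly (A $$ (i, p))) * (L $$ (r, j) * A $$ (j, q)))"
    by (rule sum.swap)
  also have "\<dots> = (\<Sum>r<m. neg_poly ((M * A) $$ (r, p)) * (L * A) $$ (r, q))"
    by (intro sum.cong refl) (simp add: e neg_poly_sum neg_poly_mult sum_product)
  finally show ?thesis .
qed

section \<open>Behaviour of G = R2 R1^(-1) at infinity\<close>

locale sp_pair =
  fixes w :: nat and R1 R2 :: "real poly mat"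
  assumes R1: "R1 \<in> carrier_mat w w" and R2: "R2 \<in> carrier_mat w w"
    and hur1: "hurwitz R1" and hur2: "hurwitz R2"
    and sp: "right_sp R2 R1"
    and spr: "strictly_positive_real (R2 * adj_mat R1) (det R1)"
begin

abbreviation "d1 \<equiv> det R1"
abbreviation "d2 \<equiv> det R2"
abbreviation "D \<equiv> degree d1"
text \<open>Numerator of G over the common denominator \<open>d1\<close>; the behaviour of G at
  infinity is read off the degrees and coefficients of its entries.\<close>

definition "N2 = R2 * adj_mat R1"

lemma d1_nz: "d1 \<noteq> 0" and d2_nz: "d2 \<noteq> 0" using hur1 hur2 by (auto simp: hurwitz_def)

lemma N2_carrier: "N2 \<in> carrier_mat w w" using R2 adjR(1)[OF R1] by (simp add: N2_def)

lemma N2_sp: "i < w \<Longrightarrow> j < w \<Longrightarrow> N2 $$ (i, j) = 0 \<or> degree (N2 $$ (i, j)) < D"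
  using sp unfolding right_sp_iff[OF R1 R2] by (auto simp: N2_def sp_frac_def)

definition Gval :: "nat \<Rightarrow> nat \<Rightarrow> real \<Rightarrow> complex" where
  "Gval i j \<omega> = cpoly (N2 $$ (i, j)) (\<i> * of_real \<omega>) / cpoly d1 (\<i> * of_real \<omega>)"

lemma cpoly_neg_axis: "cpoly p (- \<i> * of_real \<omega>) = cnj (cpoly p (\<i> * of_real \<omega>))"
proof -
  have "map_poly cnj (map_poly complex_of_real p) = map_poly complex_of_real p"
    by (rule poly_eqI) (simp add: coeff_map_poly)
  thus ?thesis by (simp add: cpoly_def poly_cnj)
qed

text \<open>Real coefficients make G(-i \<omega>)^T the conjugate transpose of G(i \<omega>), so the
  definite form in the hypothesis is twice the real part of the form of G.\<close>

lemma spr_form: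
  assumes x: "\<exists>i<w. x i \<noteq> 0"
  shows "Re (\<Sum>i<w. \<Sum>j<w. cnj (x i) * Gval i j \<omega> * x j) > 0"
proof -
  define M where "M = transpose_mat (rat_eval N2 d1 (- \<i> * of_real \<omega>)) + rat_eval N2 d1 (\<i> * of_real \<omega>)"
  have M: "M \<in> carrier_mat w w" using N2_carrier by (simp add: M_def rat_eval_def)
  have Mij: "M $$ (i, j) = cnj (Gval j i \<omega>) + Gval i j \<omega>" if "i < w" "j < w" for i j
    using that N2_carrier cpoly_neg_axis[of _ \<omega>] by (simp add: M_def rat_eval_def Gval_def)
  define xv where "xv = vec w x"
  have xv: "xv \<in> carrier_vec w" "xv \<noteq> 0\<^sub>v w"
    using x by (auto simp: xv_def) (metis index_vec index_zero_vec(1))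
  have "Re ((M *\<^sub>v xv) \<bullet>c xv) > 0"
    using spr xv N2_carrier unfolding strictly_positive_real_def N2_def[symmetric] M_def Let_def by auto
  also have "(M *\<^sub>v xv) \<bullet>c xv = (\<Sum>i<w. \<Sum>j<w. cnj (x i) * (cnj (Gval j i \<omega>) + Gval i j \<omega>) * x j)"
    using M by (simp add: scalar_prod_def xv_def atLeast0LessThan sum_distrib_left sum_distrib_right Mij mult_ac)
  also have "\<dots> = (\<Sum>i<w. \<Sum>j<w. cnj (x i) * cnj (Gval j i \<omega>) * x j) + (\<Sum>i<w. \<Sum>j<w. cnj (x i) * Gval i j \<omega> * x j)"
    by (simp add: algebra_simps sum.distrib)
  also have "(\<Sum>i<w. \<Sum>j<w. cnj (x i) * cnj (Gval j i \<omega>) * x j) = cnj (\<Sum>i<w. \<Sum>j<w. cnj (x i) * Gval i j \<omega> * x j)"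
    unfolding cnj_sum by (subst sum.swap) (simp add: mult_ac)
  finally have "0 < Re (cnj (\<Sum>i<w. \<Sum>j<w. cnj (x i) * Gval i j \<omega> * x j) + (\<Sum>i<w. \<Sum>j<w. cnj (x i) * Gval i j \<omega> * x j))" .
  moreover have "Re (cnj z + z) = 2 * Re z" for z by simp
  ultimately have "0 < 2 * Re (\<Sum>i<w. \<Sum>j<w. cnj (x i) * Gval i j \<omega> * x j)" by (simp only:)
  thus ?thesis by linarith
qed

text \<open>
  Up to the factor \<open>lead_coeff d1\<close>, \<open>Sg\<close> is the limit of \<open>s G(s)\<close> as \<open>s\<close> tends to infinity.
\<close>

definition Sg :: "nat \<Rightarrow> nat \<Rightarrow> real" where "Sg i j = coeff (N2 $$ (i, j)) (D - 1)"

lemma Sg_pos: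
  assumes x: "\<exists>i<w. x i \<noteq> 0"
  shows "lead_coeff d1 * (\<Sum>i<w. \<Sum>j<w. x i * Sg i j * x j) > 0" and "D > 0"
proof -
  define n where "n = (\<Sum>i<w. \<Sum>j<w. [:x i * x j:] * N2 $$ (i, j))"
  have "sp_frac n d1" unfolding n_def
    using N2_sp by (intro sp_frac_sum sp_frac_const_mult) (auto simp: sp_frac_def)
  have re: "Re (cpoly n (\<i> * of_real \<omega>) / cpoly d1 (\<i> * of_real \<omega>)) > 0" for \<omega> :: real
  proof -
    have "cpoly n (\<i> * of_real \<omega>) / cpoly d1 (\<i> * of_real \<omega>) = (\<Sum>i<w. \<Sum>j<w. cnj (of_real (x i)) * Gval i j \<omega> * of_real (x j))"
      by (simp only: n_def cpoly_sum cpoly_mult cpoly_const Gval_def sum_divide_distrib) (simp add: mult_ac)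
    thus ?thesis using spr_form[of "\<lambda>i. of_real (x i)" \<omega>] x by simp
  qed
  hence "n \<noteq> 0" by fastforce
  hence deg: "degree n < degree d1" using \<open>sp_frac n d1\<close> by (simp add: sp_frac_def)
  thus "D > 0" by simp
  have "coeff n (D - 1) * lead_coeff d1 > 0"
    using hur1 by (intro positive_real_relative_degree deg re) (auto simp: hurwitz_def)
  moreover have "coeff n (D - 1) = (\<Sum>i<w. \<Sum>j<w. x i * Sg i j * x j)"
    by (simp add: n_def coeff_sum Sg_def mult_ac)
  ultimately show "lead_coeff d1 * (\<Sum>i<w. \<Sum>j<w. x i * Sg i j * x j) > 0" by (simp add: mult.commute)
qed

lemma D_pos: "0 < w \<Longrightarrow> 0 < D"
  using Sg_pos(2)[of "\<lambda>_. 1"] by auto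

lemma N2_degree: "i < w \<Longrightarrow> j < w \<Longrightarrow> degree (N2 $$ (i, j)) \<le> D - 1"
  using N2_sp[of i j] by auto

text \<open>F R1^(-1) = (F R2^(-1)) G is a product of two strictly proper matrices, so the degree
  gap is at least two and the numerator cannot reach degree D - 1.\<close>

lemma right_sp_trans_degree:
  assumes F: "F \<in> carrier_mat m w" and rF: "right_sp F R2" and ij: "i < m" "j < w"
  shows "(F * adj_mat R1) $$ (i, j) = 0 \<or> degree ((F * adj_mat R1) $$ (i, j)) + 2 \<le> D"
proof (cases "(F * adj_mat R1) $$ (i, j) = 0")
  case False
  let ?p = "(F * adj_mat R1) $$ (i, j)" and ?f = "\<lambda>k. (F * adj_mat R2) $$ (i, k)"
  note a1 = adjR[OF R1] and a2 = adjR[OF R2]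
  have FA: "F * adj_mat R2 \<in> carrier_mat m w" using F a2 by simp
  have "adj_mat R2 * N2 = d2 \<cdot>\<^sub>m 1\<^sub>m w * adj_mat R1"
    unfolding N2_def assoc_mult_mat[OF a2(1) R2 a1(1), symmetric] a2(3) ..
  also have "\<dots> = d2 \<cdot>\<^sub>m adj_mat R1" using a1(1) by (simp add: mult_smult_assoc_mat[of _ w w _ w])
  finally have "(F * adj_mat R2) * N2 = F * (d2 \<cdot>\<^sub>m adj_mat R1)"
    unfolding assoc_mult_mat[OF F a2(1) N2_carrier] by simp
  also have "\<dots> = d2 \<cdot>\<^sub>m (F * adj_mat R1)" by (rule mult_smult_distrib[OF F a1(1)])
  finally have "((F * adj_mat R2) * N2) $$ (i, j) = d2 * ?p" using F a1 ij by simp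
  moreover have "((F * adj_mat R2) * N2) $$ (i, j) = (\<Sum>k<w. ?f k * N2 $$ (k, j))"
    by (rule mat_mult_index[OF FA N2_carrier ij])
  ultimately have e: "d2 * ?p = (\<Sum>k<w. ?f k * N2 $$ (k, j))" by simp
  have "degree (?f k * N2 $$ (k, j)) + 2 \<le> degree d2 + D \<or> ?f k * N2 $$ (k, j) = 0" if "k < w" for k
  proof (cases "?f k = 0 \<or> N2 $$ (k, j) = 0")
    case False
    hence "degree (?f k) < degree d2" "degree (N2 $$ (k, j)) < D"
      using rF N2_sp[OF that ij(2)] ij that unfolding right_sp_iff[OF R2 F] by (auto simp: sp_frac_def)
    thus ?thesis using False by (simp add: degree_mult_eq)
  qed auto
  hence dk: "degree (?f k * N2 $$ (k, j)) \<le> degree d2 + D - 2" if "k < w" for k using that by fastforce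
  have "d2 * ?p \<noteq> 0" using False d2_nz by simp
  then obtain k where "k < w" "?f k * N2 $$ (k, j) \<noteq> 0" unfolding e by (metis (no_types, lifting) sum.neutral lessThan_iff)
  \<comment> \<open>Guards the truncated subtraction in \<open>degree d2 + D - 2\<close>.\<close>
  hence two: "2 \<le> degree d2 + D" using \<open>\<And>k. k < w \<Longrightarrow> _ \<or> _\<close>[of k] by linarith
  have "degree (d2 * ?p) \<le> degree d2 + D - 2" unfolding e by (rule degree_sum_le) (use dk in auto)
  thus ?thesis using False d2_nz two by (simp add: degree_mult_eq)
qed simp

text \<open>In E adj(R1) = P N2 + F adj(R1), the coefficient of degree \<mu> + D - 1 of a row is p
  \<open>Sg\<close>, with p the \<mu>-th coefficient of that row of \<open>P\<close> and \<mu> a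
  bound for its degree. If the largest degree \<mu> were positive, strict properness would make this
  vanish, against definiteness; for \<mu> = 0 the identity computes \<open>P\<close>.\<close>

lemma quotient_constant:
  assumes E: "E \<in> carrier_mat m w" and rE: "right_sp E R1"
  obtains P F where "P \<in> carrier_mat m w" "F \<in> carrier_mat m w" "right_sp F R2" "E = const_mat P * R2 + F"
    "\<And>i j. i < m \<Longrightarrow> j < w \<Longrightarrow> (\<Sum>k<w. P $$ (i, k) * Sg k j) = coeff ((E * adj_mat R1) $$ (i, j)) (D - 1)"
proof -
  note a1 = adjR[OF R1]
  obtain P F where P: "P \<in> carrier_mat m w" and F: "F \<in> carrier_mat m w" "F = E - P * R2" "right_sp F R2"
    using right_division[OF R2 d2_nz E] .
  have PR: "P * R2 \<in> carrier_mat m w" using P R2 by simp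
  have E': "E = P * R2 + F" unfolding F(2) by (rule mat_diff_add_cancel[OF PR E, symmetric])
  have split: "(E * adj_mat R1) $$ (i, j) = (\<Sum>k<w. P $$ (i, k) * N2 $$ (k, j)) + (F * adj_mat R1) $$ (i, j)"
    if "i < m" "j < w" for i j
  proof -
    have "E * adj_mat R1 = P * N2 + F * adj_mat R1"
      unfolding E' add_mult_distrib_mat[OF PR F(1) a1(1)] N2_def assoc_mult_mat[OF P R2 a1(1)] ..
    moreover have "P * N2 \<in> carrier_mat m w" "F * adj_mat R1 \<in> carrier_mat m w" using P N2_carrier F(1) a1(1) by simp_all
    ultimately have "(E * adj_mat R1) $$ (i, j) = (P * N2) $$ (i, j) + (F * adj_mat R1) $$ (i, j)" using that
      by (metis carrier_matD index_add_mat(1))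
    thus ?thesis using mat_mult_index[OF P N2_carrier that] by simp
  qed
  have top: "(\<Sum>k<w. coeff (P $$ (i, k)) \<mu> * Sg k j) = coeff ((E * adj_mat R1) $$ (i, j)) (\<mu> + (D - 1))"
    if ij: "i < m" "j < w" and \<mu>: "\<And>k. k < w \<Longrightarrow> degree (P $$ (i, k)) \<le> \<mu>" for i j \<mu>
  proof -
    have "coeff (P $$ (i, k) * N2 $$ (k, j)) (\<mu> + (D - 1)) = coeff (P $$ (i, k)) \<mu> * Sg k j" if "k < w" for k
      unfolding Sg_def by (rule coeff_mult_top) (use \<mu> N2_degree that ij in auto)
    moreover have "coeff ((F * adj_mat R1) $$ (i, j)) (\<mu> + (D - 1)) = 0"
      using right_sp_trans_degree[OF F(1,3) ij]
      by (cases "(F * adj_mat R1) $$ (i, j) = 0") (auto intro!: coeff_eq_0)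
    ultimately show ?thesis unfolding split[OF ij] by (simp add: coeff_sum)
  qed
  have const: "degree (P $$ (i, k)) = 0" if ik: "i < m" "k < w" for i k
  proof (rule ccontr)
    assume nz: "degree (P $$ (i, k)) \<noteq> 0"
    define \<mu> where "\<mu> = Max ((\<lambda>k. degree (P $$ (i, k))) ` {..<w})"
    have le: "degree (P $$ (i, k)) \<le> \<mu>" if "k < w" for k unfolding \<mu>_def using that by (intro Max_ge) auto
    have "\<mu> \<in> (\<lambda>k. degree (P $$ (i, k))) ` {..<w}" unfolding \<mu>_def using ik by (intro Max_in) auto
    then obtain k0 where k0: "k0 < w" "degree (P $$ (i, k0)) = \<mu>" by auto
    have \<mu>0: "\<mu> > 0" using le[OF ik(2)] nz by simp
    hence "P $$ (i, k0) \<noteq> 0" using k0 by auto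
    hence nz0: "coeff (P $$ (i, k0)) \<mu> \<noteq> 0" using k0 by (metis leading_coeff_0_iff)
    have z: "(\<Sum>k<w. coeff (P $$ (i, k)) \<mu> * Sg k j) = 0" if j: "j < w" for j
    proof -
      have "coeff ((E * adj_mat R1) $$ (i, j)) (\<mu> + (D - 1)) = 0"
      proof (cases "(E * adj_mat R1) $$ (i, j) = 0")
        case False
        hence "degree ((E * adj_mat R1) $$ (i, j)) < D"
          using rE ik j unfolding right_sp_iff[OF R1 E] sp_frac_def by blast
        thus ?thesis using \<mu>0 by (intro coeff_eq_0) linarith
      qed simp
      thus ?thesis using top[OF ik(1) j le] by simp
    qed
    \<comment> \<open>Pairing p \<open>Sg\<close> = 0 with p itself gives the form that
      \<open>Sg_pos\<close> declares nonzero.\<close>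
    have "(\<Sum>k<w. \<Sum>j<w. coeff (P $$ (i, k)) \<mu> * Sg k j * coeff (P $$ (i, j)) \<mu>) = (\<Sum>j<w. (\<Sum>k<w. coeff (P $$ (i, k)) \<mu> * Sg k j) * coeff (P $$ (i, j)) \<mu>)"
      by (subst sum.swap) (simp add: sum_distrib_right)
    also have "\<dots> = 0" using z by simp
    finally show False using Sg_pos(1)[of "\<lambda>k. coeff (P $$ (i, k)) \<mu>"] nz0 k0(1) by auto
  qed
  define C where "C = map_mat (\<lambda>p. coeff p 0) P"
  have C: "C \<in> carrier_mat m w" using P by (simp add: C_def)
  have "const_mat C = P"
  proof (rule eq_matI)
    fix i k assume "i < dim_row P" "k < dim_col P"
    hence ik: "i < m" "k < w" using P by auto
    then obtain c where "P $$ (i, k) = [:c:]" using degree_eq_zeroE[OF const[OF ik]] by blast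
    thus "const_mat C $$ (i, k) = P $$ (i, k)" using ik P by (simp add: const_mat_def C_def)
  qed (use P in \<open>auto simp: const_mat_def C_def\<close>)
  hence EC: "E = const_mat C * R2 + F" using E' by simp
  have "(\<Sum>k<w. C $$ (i, k) * Sg k j) = coeff ((E * adj_mat R1) $$ (i, j)) (D - 1)"
    if "i < m" "j < w" for i j
    using top[OF that, of 0] const that P by (simp add: C_def)
  thus ?thesis by (rule that[OF C F(1,3) EC])
qed

end

lemma coeff_bisym_add_diff:
  assumes "S \<in> carrier_mat w w" "T \<in> carrier_mat w w" "bisym w S" "bisym w T"
  shows "bisym w (S + T)" "bisym w (S - T)"
  using assms by (simp_all add: bisym_def)

lemma bisym_bivar_self: "Q \<in> carrier_mat q w \<Longrightarrow> bisym w (bivar Q Q)"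
  by (simp add: bisym_def coeff_bivar[of Q q w Q w] mult.commute)

lemma bisym_bivar_pair:
  assumes "M \<in> carrier_mat m w" "L \<in> carrier_mat m w"
  shows "bisym w (bivar M L + bivar L M)"
  using assms bivar_carrier[OF assms] bivar_carrier[OF assms(2,1)] coeff_bivar[OF assms] coeff_bivar[OF assms(2,1)]
  by (simp add: bisym_def mult.commute)

lemma zslice_bivar:
  assumes "M \<in> carrier_mat m a" "L \<in> carrier_mat m b" "i < a" "j < b"
  shows "zslice (bivar M L) h $$ (i, j) = (\<Sum>r<m. [:coeff (M $$ (r, i)) h:] * L $$ (r, j))"
  by (rule poly_eqI) (simp add: coeff_zslice[OF bivar_carrier[OF assms(1,2)] assms(3,4)] coeff_bivar[OF assms] coeff_sum)

lemma zslice_add: "S \<in> carrier_mat a b \<Longrightarrow> T \<in> carrier_mat a b \<Longrightarrow> i < a \<Longrightarrow> j < b \<Longrightarrow>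
    zslice (S + T) h $$ (i, j) = zslice S h $$ (i, j) + zslice T h $$ (i, j)"
  using coeff_zslice[of "S + T" a b i j h] by (intro poly_eqI) (simp add: coeff_zslice)

lemma zslice_diff: "S \<in> carrier_mat a b \<Longrightarrow> T \<in> carrier_mat a b \<Longrightarrow> i < a \<Longrightarrow> j < b \<Longrightarrow>
    zslice (S - T) h $$ (i, j) = zslice S h $$ (i, j) - zslice T h $$ (i, j)"
  using coeff_zslice[of "S - T" a b i j h] minus_carrier_mat[of T a b S]
  by (intro poly_eqI) (simp add: coeff_zslice)

text \<open>Division by \<xi> moves every coefficient of t + c d down one place: the top coefficient
  of c d becomes the coefficient of p just below the degree of d, and t cannot interfere
  there.\<close>

lemma sp_frac_pCons:
  assumes D: "degree d > 0" and e: "pCons 0 p = t + [:c:] * d" and t: "sp_frac t d"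
  shows "sp_frac p d \<and> coeff p (degree d - 1) = c * lead_coeff d"
proof
  have t0: "coeff t k = 0" if "k \<ge> degree d" for k
    using t that by (cases "t = 0") (auto simp: sp_frac_def intro: coeff_eq_0)
  have ck: "coeff (pCons 0 p) k = coeff t k + c * coeff d k" for k unfolding e by simp
  have "coeff p k = 0" if "k > degree d - 1" for k
    using ck[of "Suc k"] t0[of "Suc k"] that D by (simp add: coeff_eq_0)
  hence "degree p \<le> degree d - 1" by (intro degree_le) auto
  thus "sp_frac p d" using D by (auto simp: sp_frac_def)
  show "coeff p (degree d - 1) = c * lead_coeff d"
    using ck[of "degree d"] t0[of "degree d"] D by (cases "degree d") (auto simp: coeff_pCons)
qed

section \<open>The spectral identity over \<open>d1\<close> and the storage matrix\<close>

context sp_pair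
begin

definition para_factor :: "nat \<Rightarrow> real poly mat \<Rightarrow> bool" where
  "para_factor q Q \<longleftrightarrow> Q \<in> carrier_mat q w \<and> (\<forall>i<w. \<forall>j<w.
     (\<Sum>r<w. neg_poly (R1 $$ (r, i)) * R2 $$ (r, j)) + (\<Sum>r<w. neg_poly (R2 $$ (r, i)) * R1 $$ (r, j)) =
     (\<Sum>r<q. neg_poly (Q $$ (r, i)) * Q $$ (r, j)))"

lemma para_factor_iff:
  assumes Q: "Q \<in> carrier_mat q w"
  shows "map_mat para_eval (bivar R1 R2 + bivar R2 R1) = transpose_mat (neg_var Q) * Q \<longleftrightarrow> para_factor q Q"
proof -
  have c: "bivar R1 R2 \<in> carrier_mat w w" "bivar R2 R1 \<in> carrier_mat w w" using bivar_carrier R1 R2 by blast+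
  have l: "map_mat para_eval (bivar R1 R2 + bivar R2 R1) $$ (i, j) =
     (\<Sum>r<w. neg_poly (R1 $$ (r, i)) * R2 $$ (r, j)) + (\<Sum>r<w. neg_poly (R2 $$ (r, i)) * R1 $$ (r, j))"
    if "i < w" "j < w" for i j
    using that c by (simp add: para_eval_add para_eval_bivar[OF R1 R2] para_eval_bivar[OF R2 R1])
  have r: "(transpose_mat (neg_var Q) * Q) $$ (i, j) = (\<Sum>r<q. neg_poly (Q $$ (r, i)) * Q $$ (r, j))"
    if "i < w" "j < w" for i j
    using that Q by (auto simp: neg_var_def neg_poly_def scalar_prod_def atLeast0LessThan intro!: sum.cong)
  have L: "map_mat para_eval (bivar R1 R2 + bivar R2 R1) \<in> carrier_mat w w" using c by simp
  have R: "transpose_mat (neg_var Q) * Q \<in> carrier_mat w w" using Q by (auto simp: neg_var_def)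
  show ?thesis
  proof
    assume "map_mat para_eval (bivar R1 R2 + bivar R2 R1) = transpose_mat (neg_var Q) * Q"
    thus "para_factor q Q" unfolding para_factor_def using Q by (auto simp flip: l r)
  next
    assume p: "para_factor q Q"
    show "map_mat para_eval (bivar R1 R2 + bivar R2 R1) = transpose_mat (neg_var Q) * Q"
    proof (rule eq_matI)
      fix i j assume "i < dim_row (transpose_mat (neg_var Q) * Q)" "j < dim_col (transpose_mat (neg_var Q) * Q)"
      hence ij: "i < w" "j < w" using R by auto
      show "map_mat para_eval (bivar R1 R2 + bivar R2 R1) $$ (i, j) = (transpose_mat (neg_var Q) * Q) $$ (i, j)"
        unfolding l[OF ij] r[OF ij] using p ij by (simp add: para_factor_def)
    qed (use c Q in \<open>auto simp: neg_var_def\<close>)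
  qed
qed

text \<open>Congruence of the factorization by adj(R1): divided by d1(-\<xi>) d1(\<xi>), it reads
  G(\<xi>) + G(-\<xi>)^T = Y(-\<xi>)^T Y(\<xi>) with Y = Q R1^(-1).\<close>

lemma para_factor_adj:
  assumes Q: "para_factor q Q" and ab: "a < w" "b < w"
  shows "neg_poly d1 * N2 $$ (a, b) + neg_poly (N2 $$ (b, a)) * d1 =
    (\<Sum>r<q. neg_poly ((Q * adj_mat R1) $$ (r, a)) * (Q * adj_mat R1) $$ (r, b))"
proof -
  note a1 = adjR[OF R1]
  have Qc: "Q \<in> carrier_mat q w" using Q by (simp add: para_factor_def)
  have RA: "(R1 * adj_mat R1) $$ (r, c) = (if r = c then d1 else 0)" if "r < w" "c < w" for r c
    using that by (simp add: a1(2))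
  have "(\<Sum>i<w. \<Sum>j<w. neg_poly (adj_mat R1 $$ (i, a)) * (\<Sum>r<q. neg_poly (Q $$ (r, i)) * Q $$ (r, j)) * adj_mat R1 $$ (j, b)) =
    (\<Sum>i<w. \<Sum>j<w. neg_poly (adj_mat R1 $$ (i, a)) * (\<Sum>r<w. neg_poly (R1 $$ (r, i)) * R2 $$ (r, j)) * adj_mat R1 $$ (j, b)) +
    (\<Sum>i<w. \<Sum>j<w. neg_poly (adj_mat R1 $$ (i, a)) * (\<Sum>r<w. neg_poly (R2 $$ (r, i)) * R1 $$ (r, j)) * adj_mat R1 $$ (j, b))"
    unfolding sum.distrib[symmetric] ring_distribs[symmetric] using Q
    by (intro sum.cong refl) (simp add: para_factor_def)
  hence "(\<Sum>r<q. neg_poly ((Q * adj_mat R1) $$ (r, a)) * (Q * adj_mat R1) $$ (r, b)) =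
    (\<Sum>r<w. neg_poly ((R1 * adj_mat R1) $$ (r, a)) * N2 $$ (r, b)) +
    (\<Sum>r<w. neg_poly (N2 $$ (r, a)) * (R1 * adj_mat R1) $$ (r, b))"
    unfolding para_congruence[OF Qc Qc a1(1) ab] para_congruence[OF R1 R2 a1(1) ab]
      para_congruence[OF R2 R1 a1(1) ab] N2_def .
  also have "(\<Sum>r<w. neg_poly ((R1 * adj_mat R1) $$ (r, a)) * N2 $$ (r, b)) = (\<Sum>r<w. if r = a then neg_poly d1 * N2 $$ (r, b) else 0)"
    using ab by (intro sum.cong refl) (simp add: RA)
  also have "\<dots> = neg_poly d1 * N2 $$ (a, b)" using ab by simp
  also have "(\<Sum>r<w. neg_poly (N2 $$ (r, a)) * (R1 * adj_mat R1) $$ (r, b)) = (\<Sum>r<w. if r = b then neg_poly (N2 $$ (r, a)) * d1 else 0)"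
    using ab by (intro sum.cong refl) (simp add: RA)
  also have "\<dots> = neg_poly (N2 $$ (b, a)) * d1" using ab by simp
  finally show ?thesis by simp
qed

text \<open>Compare coefficients of degree 2 D - 1. The right side has degree at most 2 D - 2, as Q
  R1^(-1) is strictly proper, and on the left the two terms carry the opposite signs (-1)^D and
  (-1)^(D - 1).\<close>

lemma Sg_sym:
  assumes Q: "para_factor q Q" "right_sp Q R1" and ab: "a < w" "b < w"
  shows "Sg a b = Sg b a"
proof -
  have Qc: "Q \<in> carrier_mat q w" using Q by (simp add: para_factor_def)
  have D0: "D > 0" using D_pos ab by auto
  have "coeff (neg_poly d1 * N2 $$ (a, b)) (D + (D - 1)) = coeff (neg_poly d1) D * Sg a b"
    unfolding Sg_def by (rule coeff_mult_top) (use N2_degree ab in auto)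
  moreover have "coeff (neg_poly (N2 $$ (b, a)) * d1) ((D - 1) + D) = coeff (neg_poly (N2 $$ (b, a))) (D - 1) * coeff d1 D"
    by (rule coeff_mult_top) (use N2_degree ab in auto)
  moreover have "coeff (\<Sum>r<q. neg_poly ((Q * adj_mat R1) $$ (r, a)) * (Q * adj_mat R1) $$ (r, b)) (D + (D - 1)) = 0"
  proof -
    have "coeff (neg_poly ((Q * adj_mat R1) $$ (r, a)) * (Q * adj_mat R1) $$ (r, b)) (D + (D - 1)) = 0" if r: "r < q" for r
    proof (cases "(Q * adj_mat R1) $$ (r, a) = 0 \<or> (Q * adj_mat R1) $$ (r, b) = 0")
      case False
      hence "degree ((Q * adj_mat R1) $$ (r, a)) < D" "degree ((Q * adj_mat R1) $$ (r, b)) < D"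
        using Q(2) r ab unfolding right_sp_iff[OF R1 Qc] sp_frac_def by blast+
      thus ?thesis
        using degree_mult_le[of "neg_poly ((Q * adj_mat R1) $$ (r, a))" "(Q * adj_mat R1) $$ (r, b)"]
        by (intro coeff_eq_0) simp
    qed auto
    thus ?thesis by (simp add: coeff_sum)
  qed
  ultimately have "(-1) ^ D * coeff d1 D * Sg a b + (-1) ^ (D - 1) * Sg b a * coeff d1 D = 0"
    using arg_cong[OF para_factor_adj[OF Q(1) ab], of "\<lambda>p. coeff p (D + (D - 1))"]
    by (simp add: coeff_neg_poly Sg_def add.commute)
  moreover have "(-1 :: real) ^ D = - ((-1) ^ (D - 1))" using D0 by (cases D) auto
  ultimately have "(-1) ^ (D - 1) * coeff d1 D * (Sg b a - Sg a b) = 0" by (simp add: algebra_simps)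
  thus ?thesis using d1_nz by simp
qed

lemma Sg_inverse:
  obtains W where "W \<in> carrier_mat w w" "fmat w Sg * W = 1\<^sub>m w" "W * fmat w Sg = 1\<^sub>m w"
proof -
  have "det (fmat w Sg) \<noteq> 0"
  proof
    assume "det (fmat w Sg) = 0"
    then obtain x where x: "\<exists>i<w. x i \<noteq> 0" "\<And>i. i < w \<Longrightarrow> (\<Sum>j<w. Sg i j * x j) = 0"
      unfolding det_fmat_zero_iff by blast
    have "(\<Sum>i<w. \<Sum>j<w. x i * Sg i j * x j) = (\<Sum>i<w. x i * (\<Sum>j<w. Sg i j * x j))"
      by (simp add: sum_distrib_left mult_ac)
    also have "\<dots> = 0" using x(2) by simp
    finally show False using Sg_pos(1)[OF x(1)] by simp
  qed
  hence "(1 / det (fmat w Sg)) \<cdot>\<^sub>m (det (fmat w Sg) \<cdot>\<^sub>m 1\<^sub>m w) = 1\<^sub>m w"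
    by (intro eq_matI) auto
  thus ?thesis
    using that[of "(1 / det (fmat w Sg)) \<cdot>\<^sub>m adj_mat (fmat w Sg)"] adj_mat[of "fmat w Sg" w]
    by (simp add: mult_smult_distrib[of _ w w _ w] mult_smult_assoc_mat[of _ w w _ w])
qed

text \<open>The \<zeta>^h slices of \<open>Psi\<close>, times adj(R1), obey a recursion in h whose
  only term that is not strictly proper is a constant multiple of \<open>d1\<close>. This yields
  strict properness of all slices over \<open>R1\<close> together with their coefficients of degree
  D - 1, and hence, by \<open>quotient_constant\<close>, their quotients by
  \<open>R2\<close>.\<close>

lemma storage_decomposition:
  assumes Q: "para_factor q Q" "right_sp Q R1"
    and Psi: "Psi \<in> carrier_mat w w" "ddt_poly Psi = (bivar R1 R2 + bivar R2 R1) - bivar Q Q"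
  obtains V T where "\<And>h. right_sp (zslice Psi h) R1" "V \<in> carrier_mat w w" "T \<in> carrier_mat w w"
    "Psi = T + bivar (const_mat V * R2) R2" "\<And>h. right_sp (zslice T h) R2" "bisym w Psi" "bisym w T"
    "\<And>y. (\<Sum>r<w. \<Sum>j<w. V $$ (r, j) * y j * y r) \<ge> 0"
proof -
  note a1 = adjR[OF R1]
  have Qc: "Q \<in> carrier_mat q w" using Q by (simp add: para_factor_def)
  have c: "bivar R1 R2 \<in> carrier_mat w w" "bivar R2 R1 \<in> carrier_mat w w" "bivar Q Q \<in> carrier_mat w w"
    using bivar_carrier R1 R2 Qc by blast+
  hence c12: "bivar R1 R2 + bivar R2 R1 \<in> carrier_mat w w" by simp
  define z where "z h i j = (zslice Psi h * adj_mat R1) $$ (i, j)" for h i j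
  have Zc: "zslice Psi h \<in> carrier_mat w w" for h using Psi(1) by simp
  have zsum: "z h i j = (\<Sum>k<w. zslice Psi h $$ (i, k) * adj_mat R1 $$ (k, j))" if "i < w" "j < w" for h i j
    unfolding z_def by (rule mat_mult_index[OF Zc a1(1) that])
  define s where "s h i j = (\<Sum>r<w. [:coeff (R1 $$ (r, i)) h:] * N2 $$ (r, j)) - (\<Sum>r<q. [:coeff (Q $$ (r, i)) h:] * (Q * adj_mat R1) $$ (r, j))" for h i j
  have s_sp: "sp_frac (s h i j) d1" if "i < w" "j < w" for h i j
    unfolding s_def using Q(2) sp that unfolding right_sp_iff[OF R1 Qc] right_sp_iff[OF R1 R2] N2_def
    by (intro sp_frac_diff sp_frac_sum sp_frac_const_mult) auto
  \<comment> \<open>The \<zeta>^h coefficient of (\<zeta> + \<eta>) Psi, times adj(R1); the multiple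
    of \<open>d1\<close> comes from R2(\<zeta>)^T R1(\<eta>), because R1 adj(R1) = d1 I.\<close>
  have rec: "pCons 0 (z h i j) + (if h = 0 then 0 else z (h - 1) i j) = s h i j + [:coeff (R2 $$ (j, i)) h:] * d1"
    if ij: "i < w" "j < w" for h i j
  proof -
    have sl: "pCons 0 (zslice Psi h $$ (i, k)) + (if h = 0 then 0 else zslice Psi (h - 1) $$ (i, k)) =
      (\<Sum>r<w. [:coeff (R1 $$ (r, i)) h:] * R2 $$ (r, k)) + (\<Sum>r<w. [:coeff (R2 $$ (r, i)) h:] * R1 $$ (r, k))
       - (\<Sum>r<q. [:coeff (Q $$ (r, i)) h:] * Q $$ (r, k))" if k: "k < w" for k
      unfolding zslice_ddt[OF Psi(1) ij(1) k, symmetric] Psi(2) zslice_diff[OF c12 c(3) ij(1) k]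
        zslice_add[OF c(1,2) ij(1) k] zslice_bivar[OF R1 R2 ij(1) k] zslice_bivar[OF R2 R1 ij(1) k] zslice_bivar[OF Qc Qc ij(1) k] ..
    have swap: "(\<Sum>k<w. (\<Sum>r<m. [:coeff (M $$ (r, i)) h:] * L $$ (r, k)) * adj_mat R1 $$ (k, j)) =
      (\<Sum>r<m. [:coeff (M $$ (r, i)) h:] * (L * adj_mat R1) $$ (r, j))" if L: "L \<in> carrier_mat m w" for M L m
    proof -
      have "(\<Sum>k<w. (\<Sum>r<m. [:coeff (M $$ (r, i)) h:] * L $$ (r, k)) * adj_mat R1 $$ (k, j)) =
        (\<Sum>k<w. \<Sum>r<m. [:coeff (M $$ (r, i)) h:] * (L $$ (r, k) * adj_mat R1 $$ (k, j)))"
        by (simp only: sum_distrib_right mult.assoc)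
      also have "\<dots> = (\<Sum>r<m. \<Sum>k<w. [:coeff (M $$ (r, i)) h:] * (L $$ (r, k) * adj_mat R1 $$ (k, j)))"
        by (rule sum.swap)
      also have "\<dots> = (\<Sum>r<m. [:coeff (M $$ (r, i)) h:] * (L * adj_mat R1) $$ (r, j))"
        by (intro sum.cong refl) (simp only: lessThan_iff mat_mult_index[OF L a1(1) _ ij(2)] sum_distrib_left)
      finally show ?thesis .
    qed
    have "pCons 0 (z h i j) + (if h = 0 then 0 else z (h - 1) i j) =
      [:0, 1:] * z h i j + (if h = 0 then 0 else z (h - 1) i j)" by simp
    also have "\<dots> = (\<Sum>k<w. (pCons 0 (zslice Psi h $$ (i, k)) + (if h = 0 then 0 else zslice Psi (h - 1) $$ (i, k))) * adj_mat R1 $$ (k, j))"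
      unfolding zsum[OF ij] by (simp add: sum_distrib_left ring_distribs sum.distrib)
    also have "\<dots> = (\<Sum>k<w. ((\<Sum>r<w. [:coeff (R1 $$ (r, i)) h:] * R2 $$ (r, k)) + (\<Sum>r<w. [:coeff (R2 $$ (r, i)) h:] * R1 $$ (r, k))
       - (\<Sum>r<q. [:coeff (Q $$ (r, i)) h:] * Q $$ (r, k))) * adj_mat R1 $$ (k, j))"
      by (intro sum.cong refl) (simp only: lessThan_iff sl)
    also have "\<dots> = (\<Sum>r<w. [:coeff (R1 $$ (r, i)) h:] * N2 $$ (r, j)) + (\<Sum>r<w. [:coeff (R2 $$ (r, i)) h:] * (R1 * adj_mat R1) $$ (r, j))
       - (\<Sum>r<q. [:coeff (Q $$ (r, i)) h:] * (Q * adj_mat R1) $$ (r, j))"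
      unfolding left_diff_distrib distrib_right sum_subtractf sum.distrib swap[OF R1] swap[OF R2] swap[OF Qc] N2_def ..
    also have "(\<Sum>r<w. [:coeff (R2 $$ (r, i)) h:] * (R1 * adj_mat R1) $$ (r, j)) = (\<Sum>r<w. if r = j then [:coeff (R2 $$ (r, i)) h:] * d1 else 0)"
      using ij by (intro sum.cong refl) (simp add: a1(2))
    also have "\<dots> = [:coeff (R2 $$ (j, i)) h:] * d1" using ij by simp
    finally show ?thesis by (simp add: s_def)
  qed
  have zprop: "sp_frac (z h i j) d1 \<and> coeff (z h i j) (D - 1) = coeff (R2 $$ (j, i)) h * lead_coeff d1"
    if ij: "i < w" "j < w" for h i j
  proof (induction h)
    have D0: "D > 0" using D_pos ij by auto
    case 0
    have "pCons 0 (z 0 i j) = s 0 i j + [:coeff (R2 $$ (j, i)) 0:] * d1" using rec[OF ij, of 0] by simp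
    thus ?case by (rule sp_frac_pCons[OF D0 _ s_sp[OF ij]])
  next
    have D0: "D > 0" using D_pos ij by auto
    case (Suc h)
    have "pCons 0 (z (Suc h) i j) = (s (Suc h) i j - z h i j) + [:coeff (R2 $$ (j, i)) (Suc h):] * d1"
      using rec[OF ij, of "Suc h"] by (simp add: algebra_simps)
    moreover have "sp_frac (s (Suc h) i j - z h i j) d1" using s_sp[OF ij] Suc by (intro sp_frac_diff) auto
    ultimately show ?case by (rule sp_frac_pCons[OF D0])
  qed
  have rZ: "right_sp (zslice Psi h) R1" for h
    unfolding right_sp_iff[OF R1 Zc] using zprop by (simp add: z_def)
  define S where "S = fmat w Sg"
  obtain W where W: "W \<in> carrier_mat w w" "S * W = 1\<^sub>m w" "W * S = 1\<^sub>m w" using Sg_inverse unfolding S_def .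
  have Sc: "S \<in> carrier_mat w w" by (simp add: S_def)
  have ST: "transpose_mat S = S" using Sg_sym[OF Q] by (intro eq_matI) (auto simp: S_def)
  have WT: "transpose_mat W = W"
  proof -
    have "transpose_mat W * S = 1\<^sub>m w"
      using transpose_mult[OF Sc W(1)] W(2) ST by simp
    hence "transpose_mat W * S * W = W" using W(1) by simp
    thus ?thesis using assoc_mult_mat[of "transpose_mat W" w w S w W w] Sc W by simp
  qed
  have Wsym: "W $$ (i, j) = W $$ (j, i)" if "i < w" "j < w" for i j
    using arg_cong[OF WT, of "\<lambda>X. X $$ (i, j)"] that W(1) by simp
  have SW: "(\<Sum>k<w. Sg i k * W $$ (k, j)) = (if i = j then 1 else 0)" if "i < w" "j < w" for i j
    using arg_cong[OF W(2), of "\<lambda>X. X $$ (i, j)"] mat_mult_index[OF Sc W(1) that] that by (simp add: S_def)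
  \<comment> \<open>\<open>Sg\<close> differs from the limit of s G(s) by the factor lead_coeff d1;
    \<open>V\<close> is the inverse of that limit.\<close>
  define V where "V = lead_coeff d1 \<cdot>\<^sub>m W"
  have V: "V \<in> carrier_mat w w" using W(1) by (simp add: V_def)
  have Vij: "V $$ (i, j) = lead_coeff d1 * W $$ (i, j)" if "i < w" "j < w" for i j using that W(1) by (simp add: V_def)
  define A where "A = const_mat V * R2"
  have cV: "const_mat V \<in> carrier_mat w w" using V by simp
  have A: "A \<in> carrier_mat w w" using cV R2 by (simp add: A_def)
  have Aij: "coeff (A $$ (r, i)) h = (\<Sum>j<w. V $$ (r, j) * coeff (R2 $$ (j, i)) h)" if "r < w" "i < w" for r i h
    unfolding A_def mat_mult_index[OF cV R2 that] using that V by (simp add: const_mat_def coeff_sum)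
  have bA: "bivar A R2 \<in> carrier_mat w w" by (rule bivar_carrier[OF A R2])
  define T where "T = Psi - bivar A R2"
  have T: "T \<in> carrier_mat w w" using bA by (simp add: T_def minus_carrier_mat)
  have PsiT: "Psi = T + bivar A R2" using mat_diff_add_cancel[OF bA Psi(1)] T bA unfolding T_def
    by (simp add: comm_add_mat[of _ w w])
  have rT: "right_sp (zslice T h) R2" for h
  proof -
    obtain P F where P: "P \<in> carrier_mat w w" and F: "F \<in> carrier_mat w w" "right_sp F R2"
      and E: "zslice Psi h = const_mat P * R2 + F"
      and PS: "\<And>i j. i < w \<Longrightarrow> j < w \<Longrightarrow> (\<Sum>k<w. P $$ (i, k) * Sg k j) = coeff (z h i j) (D - 1)"
      using quotient_constant[OF Zc rZ] unfolding z_def by blast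
    have cP: "const_mat P \<in> carrier_mat w w" using P by simp
    \<comment> \<open>The quotient of the \<zeta>^h slice by \<open>R2\<close> is the \<zeta>^h
      coefficient of the transpose of V R2(\<zeta>), so subtracting \<open>bivar A R2\<close>
      removes all quotients at once.\<close>
    have PA: "P $$ (i, r) = coeff (A $$ (r, i)) h" if "i < w" "r < w" for i r
    proof -
      have "coeff (A $$ (r, i)) h = (\<Sum>j<w. (coeff (R2 $$ (j, i)) h * lead_coeff d1) * W $$ (j, r))"
        unfolding Aij[OF that(2,1)] using that by (intro sum.cong refl) (simp add: Vij Wsym[of _ r])
      also have "\<dots> = (\<Sum>j<w. (\<Sum>k<w. P $$ (i, k) * Sg k j) * W $$ (j, r))"
        using that PS zprop by (intro sum.cong refl) simp
      also have "\<dots> = (\<Sum>k<w. P $$ (i, k) * (\<Sum>j<w. Sg k j * W $$ (j, r)))"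
        unfolding sum_distrib_left sum_distrib_right by (subst sum.swap) (simp add: mult_ac)
      also have "\<dots> = (\<Sum>k<w. if k = r then P $$ (i, k) else 0)"
        using that by (intro sum.cong refl) (simp add: SW)
      also have "\<dots> = P $$ (i, r)" using that by simp
      finally show ?thesis by simp
    qed
    have "zslice T h = F"
    proof (rule eq_matI)
      fix i j assume "i < dim_row F" "j < dim_col F"
      hence ij: "i < w" "j < w" using F by auto
      have "zslice T h $$ (i, j) = zslice Psi h $$ (i, j) - (\<Sum>r<w. [:coeff (A $$ (r, i)) h:] * R2 $$ (r, j))"
        unfolding T_def zslice_diff[OF Psi(1) bA ij] zslice_bivar[OF A R2 ij] ..
      also have "zslice Psi h $$ (i, j) = (const_mat P * R2) $$ (i, j) + F $$ (i, j)"
        unfolding E using ij F cP R2 by (metis carrier_matD index_add_mat(1))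
      also have "(const_mat P * R2) $$ (i, j) = (\<Sum>r<w. [:coeff (A $$ (r, i)) h:] * R2 $$ (r, j))"
        unfolding mat_mult_index[OF cP R2 ij] using ij P by (intro sum.cong refl) (simp add: const_mat_def PA)
      finally show "zslice T h $$ (i, j) = F $$ (i, j)" by simp
    qed (use F T in auto)
    thus ?thesis using F by simp
  qed
  have "bisym w (ddt_poly Psi)" unfolding Psi(2)
    by (rule coeff_bisym_add_diff[OF c12 c(3) bisym_bivar_pair[OF R1 R2] bisym_bivar_self[OF Qc]])
  hence sP: "bisym w Psi" by (rule bisym_ddtD[OF Psi(1)])
  have "bisym w (bivar A R2)"
    unfolding bisym_def
  proof (intro allI impI)
    fix i j h k assume ij: "i < w" "j < w"
    have "coeff (coeff (bivar A R2 $$ (i, j)) k) h = (\<Sum>r<w. \<Sum>s<w. V $$ (r, s) * coeff (R2 $$ (s, i)) h * coeff (R2 $$ (r, j)) k)"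
      unfolding coeff_bivar[OF A R2 ij] using ij by (simp add: Aij sum_distrib_right)
    also have "\<dots> = (\<Sum>s<w. \<Sum>r<w. V $$ (s, r) * coeff (R2 $$ (r, j)) k * coeff (R2 $$ (s, i)) h)"
      by (subst sum.swap, intro sum.cong refl) (simp add: Vij Wsym)
    also have "\<dots> = coeff (coeff (bivar A R2 $$ (j, i)) h) k"
      unfolding coeff_bivar[OF A R2 ij(2,1)] using ij by (simp add: Aij sum_distrib_right)
    finally show "coeff (coeff (bivar A R2 $$ (i, j)) k) h = coeff (coeff (bivar A R2 $$ (j, i)) h) k" .
  qed
  hence sT: "bisym w T" unfolding T_def by (rule coeff_bisym_add_diff(2)[OF Psi(1) bA sP])
  \<comment> \<open>With y = \<open>Sg\<close> x, the form of \<open>V\<close> at y is lead_coeff d1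
    times the form of \<open>Sg\<close> at x, which \<open>Sg_pos\<close> controls.\<close>
  have psd: "(\<Sum>r<w. \<Sum>j<w. V $$ (r, j) * y j * y r) \<ge> 0" for y
  proof -
    define x where "x r = (\<Sum>j<w. W $$ (r, j) * y j)" for r
    have y: "y i = (\<Sum>r<w. Sg i r * x r)" if i: "i < w" for i
    proof -
      have "(\<Sum>r<w. Sg i r * x r) = (\<Sum>j<w. (\<Sum>r<w. Sg i r * W $$ (r, j)) * y j)"
        unfolding x_def sum_distrib_left sum_distrib_right by (subst sum.swap) (simp add: mult_ac)
      also have "\<dots> = (\<Sum>j<w. if i = j then y j else 0)" using i by (intro sum.cong refl) (simp add: SW)
      finally show ?thesis using i by simp
    qed
    have "(\<Sum>r<w. \<Sum>j<w. V $$ (r, j) * y j * y r) = lead_coeff d1 * (\<Sum>r<w. x r * y r)"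
      unfolding x_def sum_distrib_left sum_distrib_right by (intro sum.cong refl) (simp add: Vij mult_ac)
    also have "(\<Sum>r<w. x r * y r) = (\<Sum>r<w. \<Sum>j<w. x r * Sg r j * x j)"
      by (intro sum.cong refl) (simp add: y sum_distrib_left mult_ac)
    finally show ?thesis
      using Sg_pos(1)[of x] by (cases "\<exists>i<w. x i \<noteq> 0") (simp_all add: less_imp_le)
  qed
  show ?thesis using that[OF rZ V T _ rT sP sT psd] PsiT by (simp add: A_def)
qed

end

section \<open>Existence of the spectral factor\<close>

abbreviation cp :: "real poly \<Rightarrow> complex poly" where "cp \<equiv> map_poly complex_of_real"

lemma coeff_star: "coeff (star p) k = (-1) ^ k * cnj (coeff p k)"
proof -
  have "star p = map_poly cnj (pcompose p (Polynomial.smult (-1) [:0, 1:]))" by (simp add: star_def)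
  thus ?thesis using coeff_pcompose_linear[of p "-1" k] by (simp add: star_def coeff_map_poly)
qed

lemma star_cp: "star (cp p) = cp (neg_poly p)"
  by (rule poly_eqI) (simp add: coeff_star coeff_map_poly coeff_neg_poly)

lemma cp_add: "cp (p + q) = cp p + cp q" by (simp add: map_poly_add)
lemma cp_diff: "cp (p - q) = cp p - cp q" by (rule poly_eqI) (simp add: coeff_map_poly)
lemma cp_sum: "cp (sum f A) = (\<Sum>a\<in>A. cp (f a))"
  by (induction A rule: infinite_finite_induct) (auto simp: cp_add)
lemma cp_mult: "cp (p * q) = cp p * cp q"
proof -
  interpret h: map_poly_comm_ring_hom complex_of_real ..
  show ?thesis by (rule h.hom_mult)
qed

lemma re_im_poly: "p = cp (map_poly Re p) + [:\<i>:] * cp (map_poly Im p)"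
  by (rule poly_eqI) (simp add: coeff_map_poly complex_eq_iff)

lemma cp_eq_re: "cp X + [:\<i>:] * cp Y = cp Z \<Longrightarrow> X = Z"
proof (rule poly_eqI)
  fix k assume "cp X + [:\<i>:] * cp Y = cp Z"
  hence "Re (coeff (cp X + [:\<i>:] * cp Y) k) = Re (coeff (cp Z) k)" by simp
  thus "coeff X k = coeff Z k" by (simp add: coeff_map_poly)
qed

context sp_pair
begin

definition Phi :: "nat \<Rightarrow> nat \<Rightarrow> real poly" where
  "Phi i j = (\<Sum>r<w. neg_poly (R1 $$ (r, i)) * R2 $$ (r, j)) + (\<Sum>r<w. neg_poly (R2 $$ (r, i)) * R1 $$ (r, j))"

lemma Phi_herm: "neg_poly (Phi i j) = Phi j i"
  by (simp add: Phi_def neg_poly_add neg_poly_sum neg_poly_mult mult.commute)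

lemma d1_axis: "cpoly d1 (\<i> * of_real \<omega>) \<noteq> 0"
  using hur1 by (auto simp: hurwitz_def)

lemma cpoly_neg_poly: "cpoly (neg_poly p) z = cpoly p (- z)"
proof -
  have "poly (star (cp p)) z = cnj (poly (cp p) (- cnj z))" by simp
  also have "\<dots> = poly (map_poly cnj (cp p)) (- z)" by (simp add: poly_map_poly_cnj)
  also have "map_poly cnj (cp p) = cp p" by (rule poly_eqI) (simp add: coeff_map_poly)
  finally show ?thesis by (simp add: star_cp cpoly_def)
qed

lemma R2_via_N2:
  assumes r: "r < w"
  shows "(\<Sum>j<w. cpoly (R2 $$ (r, j)) s * x j) * cpoly d1 s =
    (\<Sum>k<w. cpoly (N2 $$ (r, k)) s * (\<Sum>j<w. cpoly (R1 $$ (k, j)) s * x j))"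
proof -
  note a1 = adjR[OF R1]
  have e: "N2 * R1 = d1 \<cdot>\<^sub>m R2"
  proof -
    have "N2 * R1 = R2 * (adj_mat R1 * R1)" unfolding N2_def by (rule assoc_mult_mat[OF R2 a1(1) R1])
    also have "\<dots> = d1 \<cdot>\<^sub>m (R2 * 1\<^sub>m w)" unfolding a1(3) by (rule mult_smult_distrib[OF R2 one_carrier_mat])
    finally show ?thesis using R2 by simp
  qed
  have k: "(\<Sum>k<w. cpoly (N2 $$ (r, k)) s * cpoly (R1 $$ (k, j)) s) = cpoly d1 s * cpoly (R2 $$ (r, j)) s" if j: "j < w" for j
  proof -
    have "(\<Sum>k<w. N2 $$ (r, k) * R1 $$ (k, j)) = d1 * R2 $$ (r, j)"
      using mat_mult_index[OF N2_carrier R1 r j] e r j R2 by simp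
    hence "cpoly (\<Sum>k<w. N2 $$ (r, k) * R1 $$ (k, j)) s = cpoly (d1 * R2 $$ (r, j)) s" by simp
    thus ?thesis by (simp add: cpoly_sum cpoly_mult)
  qed
  have "(\<Sum>k<w. cpoly (N2 $$ (r, k)) s * (\<Sum>j<w. cpoly (R1 $$ (k, j)) s * x j)) =
    (\<Sum>j<w. (\<Sum>k<w. cpoly (N2 $$ (r, k)) s * cpoly (R1 $$ (k, j)) s) * x j)"
    unfolding sum_distrib_left sum_distrib_right by (subst sum.swap) (simp add: mult_ac)
  also have "\<dots> = (\<Sum>j<w. cpoly d1 s * cpoly (R2 $$ (r, j)) s * x j)"
    by (intro sum.cong refl) (simp only: lessThan_iff k)
  also have "\<dots> = (\<Sum>j<w. cpoly (R2 $$ (r, j)) s * x j) * cpoly d1 s"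
    unfolding sum_distrib_right by (intro sum.cong refl) (simp only: mult_ac)
  finally show ?thesis by simp
qed

text \<open>With y = R1(i \<omega>) x and R2(i \<omega>) x = G y, the form of \<Phi> is twice the
  real part of y^H G y; y is nonzero because \<open>d1\<close> has no zeros on the axis.\<close>

lemma Phi_axis_form:
  assumes x: "\<exists>i<w. x i \<noteq> 0"
  shows "Re (axis_form w (\<lambda>i j. cp (Phi i j)) \<omega> x) > 0"
proof -
  define s where "s = \<i> * complex_of_real \<omega>"
  define y where "y r = (\<Sum>j<w. cpoly (R1 $$ (r, j)) s * x j)" for r
  define v where "v r = (\<Sum>j<w. cpoly (R2 $$ (r, j)) s * x j)" for r
  have d: "cpoly d1 s \<noteq> 0" unfolding s_def by (rule d1_axis)
  have "\<exists>i<w. y i \<noteq> 0"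
    using evalc_kernel[OF R1 d, of x] x unfolding y_def by blast
  hence pos: "Re (\<Sum>i<w. \<Sum>j<w. cnj (y i) * Gval i j \<omega> * y j) > 0" by (rule spr_form)
  have v: "v r = (\<Sum>k<w. Gval r k \<omega> * y k)" if "r < w" for r
  proof -
    have "v r * cpoly d1 s = (\<Sum>k<w. cpoly (N2 $$ (r, k)) s * y k)"
      unfolding v_def y_def by (rule R2_via_N2[OF that])
    hence "v r = (\<Sum>k<w. cpoly (N2 $$ (r, k)) s * y k) / cpoly d1 s" using d by (simp add: field_simps)
    thus ?thesis by (simp add: Gval_def s_def sum_divide_distrib)
  qed
  have form: "(\<Sum>i<w. \<Sum>j<w. cnj (y i) * Gval i j \<omega> * y j) = (\<Sum>r<w. cnj (y r) * v r)"
    by (intro sum.cong refl) (simp add: v sum_distrib_left mult_ac)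
  have neg: "cpoly (neg_poly p) s = cnj (cpoly p s)" for p
    using cpoly_neg_axis[of p \<omega>] by (simp add: cpoly_neg_poly s_def)
  have quad: "(\<Sum>i<w. \<Sum>j<w. cnj (x i) * cpoly (\<Sum>r<w. neg_poly (M $$ (r, i)) * L $$ (r, j)) s * x j) =
    (\<Sum>r<w. cnj (\<Sum>i<w. cpoly (M $$ (r, i)) s * x i) * (\<Sum>j<w. cpoly (L $$ (r, j)) s * x j))" for M L
  proof -
    have "(\<Sum>i<w. \<Sum>j<w. cnj (x i) * cpoly (\<Sum>r<w. neg_poly (M $$ (r, i)) * L $$ (r, j)) s * x j) =
      (\<Sum>i<w. \<Sum>j<w. \<Sum>r<w. cnj (cpoly (M $$ (r, i)) s * x i) * (cpoly (L $$ (r, j)) s * x j))"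
      by (simp add: cpoly_sum cpoly_mult neg sum_distrib_left sum_distrib_right mult_ac)
    also have "\<dots> = (\<Sum>i<w. \<Sum>r<w. \<Sum>j<w. cnj (cpoly (M $$ (r, i)) s * x i) * (cpoly (L $$ (r, j)) s * x j))"
      by (intro sum.cong refl sum.swap)
    also have "\<dots> = (\<Sum>r<w. \<Sum>i<w. \<Sum>j<w. cnj (cpoly (M $$ (r, i)) s * x i) * (cpoly (L $$ (r, j)) s * x j))"
      by (rule sum.swap)
    finally show ?thesis by (simp only: cnj_sum sum_product)
  qed
  have "axis_form w (\<lambda>i j. cp (Phi i j)) \<omega> x = (\<Sum>i<w. \<Sum>j<w. cnj (x i) * cpoly (Phi i j) s * x j)"
    by (simp add: axis_form_def cpoly_def s_def)
  also have "\<dots> = (\<Sum>i<w. \<Sum>j<w. cnj (x i) * cpoly (\<Sum>r<w. neg_poly (R1 $$ (r, i)) * R2 $$ (r, j)) s * x j) +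
     (\<Sum>i<w. \<Sum>j<w. cnj (x i) * cpoly (\<Sum>r<w. neg_poly (R2 $$ (r, i)) * R1 $$ (r, j)) s * x j)"
    by (simp only: Phi_def cpoly_add ring_distribs sum.distrib)
  also have "\<dots> = (\<Sum>r<w. cnj (y r) * v r) + (\<Sum>r<w. cnj (v r) * y r)"
    unfolding quad y_def v_def ..
  also have "(\<Sum>r<w. cnj (v r) * y r) = cnj (\<Sum>r<w. cnj (y r) * v r)" by (simp add: mult.commute)
  finally have "axis_form w (\<lambda>i j. cp (Phi i j)) \<omega> x = (\<Sum>r<w. cnj (y r) * v r) + cnj (\<Sum>r<w. cnj (y r) * v r)" .
  moreover have "Re (c + cnj c) = 2 * Re c" for c by simp
  ultimately have "Re (axis_form w (\<lambda>i j. cp (Phi i j)) \<omega> x) = 2 * Re (\<Sum>r<w. cnj (y r) * v r)" by (simp only:)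
  thus ?thesis using pos unfolding form by linarith
qed

text \<open>On a diagonal entry of Y(-\<xi>)^T Y(\<xi>), Y = Q adj(R1), the top coefficients are
  real squares with one common sign and cannot cancel, while the other side of the identity has
  degree at most 2 D - 1.\<close>

lemma para_factor_right_sp:
  assumes Q: "para_factor q Q"
  shows "right_sp Q R1"
proof -
  have Qc: "Q \<in> carrier_mat q w" using Q by (simp add: para_factor_def)
  define y where "y r j = (Q * adj_mat R1) $$ (r, j)" for r j
  have "y r j = 0 \<or> degree (y r j) < D" if rj: "r < q" "j < w" for r j
  proof (rule ccontr)
    assume c: "\<not> (y r j = 0 \<or> degree (y r j) < D)"
    have D0: "D > 0" using D_pos rj by auto
    define \<mu> where "\<mu> = Max ((\<lambda>r. degree (y r j)) ` {..<q})"
    have le: "degree (y k j) \<le> \<mu>" if "k < q" for k unfolding \<mu>_def using that by (intro Max_ge) auto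
    have "\<mu> \<in> (\<lambda>r. degree (y r j)) ` {..<q}" unfolding \<mu>_def using rj by (intro Max_in) auto
    then obtain k0 where k0: "k0 < q" "degree (y k0 j) = \<mu>" by auto
    have \<mu>D: "\<mu> \<ge> D" using le[OF rj(1)] c by simp
    hence "y k0 j \<noteq> 0" using k0 D0 by auto
    hence nz: "coeff (y k0 j) \<mu> \<noteq> 0" using k0 by (metis leading_coeff_0_iff)
    have "coeff (\<Sum>r<q. neg_poly (y r j) * y r j) (\<mu> + \<mu>) = (\<Sum>r<q. (-1) ^ \<mu> * (coeff (y r j) \<mu>)\<^sup>2)"
      unfolding coeff_sum by (intro sum.cong refl) (simp add: coeff_mult_top le coeff_neg_poly power2_eq_square)
    also have "\<dots> = (-1) ^ \<mu> * (\<Sum>r<q. (coeff (y r j) \<mu>)\<^sup>2)" by (simp add: sum_distrib_left)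
    finally have "coeff (\<Sum>r<q. neg_poly (y r j) * y r j) (\<mu> + \<mu>) = (-1) ^ \<mu> * (\<Sum>r<q. (coeff (y r j) \<mu>)\<^sup>2)" .
    moreover have "(\<Sum>r<q. (coeff (y r j) \<mu>)\<^sup>2) > 0" using nz k0 by (intro sum_pos2[of _ k0]) auto
    moreover have "coeff (neg_poly d1 * N2 $$ (j, j) + neg_poly (N2 $$ (j, j)) * d1) (\<mu> + \<mu>) = 0"
    proof -
      have "degree (N2 $$ (j, j)) \<le> D - 1" using N2_degree rj by blast
      hence "degree (neg_poly d1 * N2 $$ (j, j)) < \<mu> + \<mu>" "degree (neg_poly (N2 $$ (j, j)) * d1) < \<mu> + \<mu>"
        using degree_mult_le[of "neg_poly d1" "N2 $$ (j, j)"] degree_mult_le[of "neg_poly (N2 $$ (j, j))" d1] \<mu>D D0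
        by auto
      thus ?thesis by (simp add: coeff_eq_0)
    qed
    ultimately show False using para_factor_adj[OF Q rj(2,2)] by (simp add: y_def)
  qed
  thus ?thesis unfolding right_sp_iff[OF R1 Qc] by (auto simp: y_def sp_frac_def)
qed

lemma good_factor_exists: "\<exists>Q. good_factor w R1 (bivar R1 R2 + bivar R2 R1) Q"
proof -
  have st: "star (cp (Phi i j)) = cp (Phi j i)" for i j by (simp add: star_cp Phi_herm)
  have "\<exists>M. (\<forall>i<w. \<forall>j<w. gram w M i j = cp (Phi i j)) \<and> (\<forall>z. Re z < 0 \<longrightarrow> poly (det (fmat w M)) z \<noteq> 0)" (is ?ex)
  proof (rule complex_spectral_factorization[where n = w and F = "\<lambda>i j. cp (Phi i j)"])
    fix M assume "\<And>i j. i < w \<Longrightarrow> j < w \<Longrightarrow> gram w M i j = cp (Phi i j)"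
      "\<And>z. Re z < 0 \<Longrightarrow> poly (det (fmat w M)) z \<noteq> 0"
    thus ?ex by (intro exI[of _ M]) simp
  qed (rule st, erule Phi_axis_form)
  then obtain M where "\<forall>i<w. \<forall>j<w. gram w M i j = cp (Phi i j)"
    and M2: "\<forall>z. Re z < 0 \<longrightarrow> poly (det (fmat w M)) z \<noteq> 0" by (elim exE conjE)
  hence M: "gram w M i j = cp (Phi i j)" if "i < w" "j < w" for i j using that by simp
  define A where "A r j = map_poly Re (M r j)" for r j
  define B where "B r j = map_poly Im (M r j)" for r j
  have MAB: "M r j = cp (A r j) + [:\<i>:] * cp (B r j)" for r j unfolding A_def B_def by (rule re_im_poly)
  \<comment> \<open>For M = A + i B, with ~ denoting transposition and \<xi> := -\<xi>, the Gram
    matrix has real part A~ A + B~ B. As \<Phi> is real, this is all of it, and it is the product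
    belonging to the stack col(A, B).\<close>
  define Q where "Q = mat (w + w) w (\<lambda>(r, j). if r < w then A r j else B (r - w) j)"
  have Qc: "Q \<in> carrier_mat (w + w) w" by (simp add: Q_def)
  have Q1: "Q $$ (r, j) = A r j" "Q $$ (w + r, j) = B r j" if "r < w" "j < w" for r j
    using that by (simp_all add: Q_def)
  have split: "(\<Sum>r<w + m. f r) = (\<Sum>r<w. f r) + (\<Sum>r<m. f (w + r))" for f :: "nat \<Rightarrow> real poly" and m
    by (induction m) (simp_all add: add.assoc)
  have pf: "para_factor (w + w) Q"
    unfolding para_factor_def
  proof (intro conjI Qc allI impI)
    fix i j assume ij: "i < w" "j < w"
    have "star (M r i) * M r j = cp (neg_poly (A r i) * A r j + neg_poly (B r i) * B r j) +
       [:\<i>:] * cp (neg_poly (A r i) * B r j - neg_poly (B r i) * A r j)" for r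
    proof -
      have "star (M r i) = cp (neg_poly (A r i)) - [:\<i>:] * cp (neg_poly (B r i))"
        unfolding MAB[of r i] star_add star_mult star_const star_cp by simp
      hence "star (M r i) * M r j = (cp (neg_poly (A r i)) - [:\<i>:] * cp (neg_poly (B r i))) * (cp (A r j) + [:\<i>:] * cp (B r j))"
        using MAB[of r j] by simp
      also have "\<dots> = cp (neg_poly (A r i)) * cp (A r j) - ([:\<i>:] * [:\<i>:]) * (cp (neg_poly (B r i)) * cp (B r j)) +
         [:\<i>:] * (cp (neg_poly (A r i)) * cp (B r j) - cp (neg_poly (B r i)) * cp (A r j))"
        by (simp only: ring_distribs mult_ac right_diff_distrib left_diff_distrib) (simp only: algebra_simps)
      also have "[:\<i>:] * [:\<i>:] = - 1" by (simp add: one_pCons)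
      finally show ?thesis by (simp add: cp_add cp_diff cp_mult)
    qed
    hence "gram w M i j = cp (\<Sum>r<w. neg_poly (A r i) * A r j + neg_poly (B r i) * B r j) +
       [:\<i>:] * cp (\<Sum>r<w. neg_poly (A r i) * B r j - neg_poly (B r i) * A r j)"
      unfolding gram_def cp_sum sum_distrib_left sum.distrib[symmetric] by simp
    from cp_eq_re[OF trans[OF this[symmetric] M[OF ij]]]
    have "(\<Sum>r<w. neg_poly (A r i) * A r j + neg_poly (B r i) * B r j) = Phi i j" .
    thus "(\<Sum>r<w. neg_poly (R1 $$ (r, i)) * R2 $$ (r, j)) + (\<Sum>r<w. neg_poly (R2 $$ (r, i)) * R1 $$ (r, j)) =
     (\<Sum>r<w + w. neg_poly (Q $$ (r, i)) * Q $$ (r, j))"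
      unfolding split Phi_def using ij by (simp add: Q1 sum.distrib)
  qed
  have "vec_space.rank (dim_row R1 + dim_row Q) (evalc (R1 @\<^sub>r Q) z) = w" for z
    unfolding full_rank_stack[OF R1 Qc]
  proof (intro allI impI)
    fix x j
    assume x: "(\<forall>i<w. (\<Sum>j<w. cpoly (R1 $$ (i, j)) z * x j) = 0) \<and> (\<forall>i<w + w. (\<Sum>j<w. cpoly (Q $$ (i, j)) z * x j) = 0)"
      and j: "j < w"
    show "x j = 0"
    proof (cases "Re z < 0")
      case False
      hence "cpoly d1 z \<noteq> 0" using hur1 by (auto simp: hurwitz_def)
      thus ?thesis using evalc_kernel[OF R1 _ _ j] x by blast
    next
      case True
      \<comment> \<open>Although \<open>x\<close> is complex, col(A, B) x = 0 makes both parts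
        vanish separately, hence M(z) x = 0.\<close>
      have "(\<Sum>j<w. poly (M i j) z * x j) = 0" if i: "i < w" for i
      proof -
        have "(\<Sum>j<w. cpoly (A i j) z * x j) = 0" 
        proof -
          have "(\<Sum>j<w. cpoly (Q $$ (i, j)) z * x j) = 0" using x i by simp
          thus ?thesis using i by (simp add: Q1)
        qed
        moreover have "(\<Sum>j<w. cpoly (B i j) z * x j) = 0"
        proof -
          have "(\<Sum>j<w. cpoly (Q $$ (w + i, j)) z * x j) = 0" using x i by simp
          thus ?thesis using i by (simp add: Q1)
        qed
        moreover have "(\<Sum>j<w. poly (M i j) z * x j) = (\<Sum>j<w. cpoly (A i j) z * x j) + \<i> * (\<Sum>j<w. cpoly (B i j) z * x j)"
          unfolding sum_distrib_left sum.distrib[symmetric]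
          by (intro sum.cong refl) (simp add: MAB[of i] cpoly_def algebra_simps)
        ultimately show ?thesis by simp
      qed
      moreover have "det (fmat w (\<lambda>i j. poly (M i j) z)) \<noteq> 0" using M2[rule_format, OF True] by (simp add: det_fmat_eval)
      ultimately show ?thesis using j unfolding det_fmat_zero_iff by blast
    qed
  qed
  moreover have "map_mat para_eval (bivar R1 R2 + bivar R2 R1) = transpose_mat (neg_var Q) * Q"
    using para_factor_iff[OF Qc] pf by simp
  moreover have "right_sp Q R1" by (rule para_factor_right_sp[OF pf])
  ultimately have "good_factor w R1 (bivar R1 R2 + bivar R2 R1) Q"
    using Qc by (simp add: good_factor_def)
  thus ?thesis by blast
qed

end

section \<open>Trajectories and switching\<close>

lemma bil_entry_diff: "bil_entry (P - Q) f g t = bil_entry P f g t - bil_entry Q f g t"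
  using bil_entry_add[of "P - Q" Q f g t] by simp

lemma bil_diff:
  assumes "S \<in> carrier_mat a b" "T \<in> carrier_mat a b"
  shows "bil (S - T) u v t = bil S u v t - bil T u v t"
  using assms by (simp add: bil_def bil_entry_diff sum_subtractf)

lemma behaviorD:
  assumes "v \<in> behavior w R" "R \<in> carrier_mat m w"
  shows "smooth_traj w v" "\<And>t j. w \<le> j \<Longrightarrow> v t j = 0" "\<And>t i. i < m \<Longrightarrow> mat_diff R v t i = 0"
  using assms by (auto simp: behavior_iff)

text \<open>From adj(R) R = det(R) I: each component is annihilated by a scalar operator, which
  reduces decay to the scalar case.\<close>

lemma behavior_det:
  assumes v: "v \<in> behavior w R" and R: "R \<in> carrier_mat w w" and j: "j < w"
  shows "pdiff (det R) (\<lambda>\<tau>. v \<tau> j) t = 0"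
proof -
  note a = adjR[OF R] and b = behaviorD[OF v R]
  have "mat_diff (adj_mat R * R) v t j = 0"
    by (rule mat_diff_mult_zero[OF b(1) a(1) R j b(3)])
  moreover have "mat_diff (adj_mat R * R) v t j = (\<Sum>k<w. if k = j then pdiff (det R) (\<lambda>\<tau>. v \<tau> k) t else 0)"
  proof -
    have "mat_diff (det R \<cdot>\<^sub>m 1\<^sub>m w) v t j = (\<Sum>k<w. pdiff ((det R \<cdot>\<^sub>m 1\<^sub>m w) $$ (j, k)) (\<lambda>\<tau>. v \<tau> k) t)"
      by (rule mat_diff_eq[of _ w w]) simp
    also have "\<dots> = (\<Sum>k<w. if k = j then pdiff (det R) (\<lambda>\<tau>. v \<tau> k) t else 0)"
    proof (rule sum.cong[OF refl])
      fix k assume "k \<in> {..<w}"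
      thus "pdiff ((det R \<cdot>\<^sub>m 1\<^sub>m w) $$ (j, k)) (\<lambda>\<tau>. v \<tau> k) t = (if k = j then pdiff (det R) (\<lambda>\<tau>. v \<tau> k) t else 0)"
        using j by (cases "k = j") auto
    qed
    finally show ?thesis unfolding a(3) .
  qed
  ultimately show ?thesis using j by simp
qed

lemma behavior_decay:
  assumes v: "v \<in> behavior w R" and R: "R \<in> carrier_mat w w" "hurwitz R" and j: "j < w"
  shows "((\<lambda>t. (deriv ^^ k) (\<lambda>\<tau>. v \<tau> j) t) \<longlongrightarrow> 0) at_top"
proof (rule hurwitz_decay)
  show "smooth_fn (\<lambda>\<tau>. v \<tau> j)" using behaviorD(1)[OF v R(1)] j by (simp add: smooth_traj_def)
  show "det R \<noteq> 0" using R(2) by (simp add: hurwitz_def)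
  show "Re z < 0" if "cpoly (det R) z = 0" for z using R(2) that by (simp add: hurwitz_def)
  show "pdiff (det R) (\<lambda>\<tau>. v \<tau> j) t = 0" for t by (rule behavior_det[OF v R(1) j])
qed

lemma qdf_decay:
  assumes v: "v \<in> behavior w R" and R: "R \<in> carrier_mat w w" "hurwitz R" and T: "T \<in> carrier_mat w w"
  shows "(qdf T v \<longlongrightarrow> 0) at_top"
proof -
  have "((\<lambda>t. \<Sum>i<w. \<Sum>j<w. \<Sum>k\<le>degree (T $$ (i, j)). \<Sum>h\<le>degree (coeff (T $$ (i, j)) k).
      (deriv ^^ h) (\<lambda>\<tau>. v \<tau> i) t * coeff (coeff (T $$ (i, j)) k) h * (deriv ^^ k) (\<lambda>\<tau>. v \<tau> j) t) \<longlongrightarrow>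
     (\<Sum>i<w. \<Sum>j<w. \<Sum>k\<le>degree (T $$ (i, j)). \<Sum>h\<le>degree (coeff (T $$ (i, j)) k).
      0 * coeff (coeff (T $$ (i, j)) k) h * 0)) at_top"
    by (intro tendsto_sum tendsto_mult tendsto_const behavior_decay[OF v R]) simp_all
  thus ?thesis using T by (simp add: qdf_def[abs_def])
qed

text \<open>\<open>M\<close> and its remainder differ by a left multiple of \<open>R\<close>, which
  vanishes along the behavior.\<close>

lemma mat_diff_rmod:
  assumes v: "v \<in> behavior w R" and R: "R \<in> carrier_mat w w" "det R \<noteq> 0" and M: "M \<in> carrier_mat m w" and i: "i < m"
  shows "mat_diff (rmod M R) v t i = mat_diff M v t i"
proof -
  obtain P where P: "P \<in> carrier_mat m w" and MP: "M = P * R + rmod M R" and r: "rmod M R \<in> carrier_mat m w"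
    using rmod_obtain[OF R M] by metis
  note b = behaviorD[OF v R(1)]
  have PR: "P * R \<in> carrier_mat m w" using P R by simp
  have "mat_diff M v t i = mat_diff (P * R) v t i + mat_diff (rmod M R) v t i"
    by (subst MP) (rule mat_diff_add[OF PR r i])
  thus ?thesis using mat_diff_mult_zero[OF b(1) P R(1) i b(3)] by simp
qed

lemma qdf_bimod:
  assumes v: "v \<in> behavior w R" and R: "R \<in> carrier_mat w w" "det R \<noteq> 0"
    and M: "M \<in> carrier_mat m w" and L: "L \<in> carrier_mat m w"
  shows "qdf (bimod (bivar M L) R) v t = qdf (bivar M L) v t"
proof -
  have rM: "rmod M R \<in> carrier_mat m w" using rmod_obtain[OF R M] by blast
  have rL: "rmod L R \<in> carrier_mat m w" using rmod_obtain[OF R L] by blast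
  note b = behaviorD[OF v R(1)]
  show ?thesis
    unfolding bimod_bivar[OF R M L] qdf_bil bil_bivar[OF rM rL b(1)] bil_bivar[OF M L b(1)]
    by (intro sum.cong refl) (simp add: mat_diff_rmod[OF v R M] mat_diff_rmod[OF v R L])
qed

lemma bimod_carrier:
  assumes R: "R \<in> carrier_mat w w" "det R \<noteq> 0" and M: "M \<in> carrier_mat m w" and L: "L \<in> carrier_mat m w"
  shows "bimod (bivar M L) R \<in> carrier_mat w w"
  unfolding bimod_bivar[OF R M L]
  using rmod_obtain[OF R M] rmod_obtain[OF R L] bivar_carrier by metis

text \<open>Symmetry allows \<open>C\<close> to move to the other slot, so trajectories with equal
  \<open>X\<close> state can be exchanged in one slot after the other.\<close>

lemma qdf_state:
  assumes C: "C \<in> carrier_mat m w" and X: "X \<in> carrier_mat m w" and sym: "bivar C X = bivar X C"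
    and u: "smooth_traj w u" and v: "smooth_traj w v"
    and eq: "\<And>i. i < m \<Longrightarrow> mat_diff X u t i = mat_diff X v t i"
  shows "qdf (bivar C X) u t = qdf (bivar C X) v t"
proof -
  have "qdf (bivar C X) u t = (\<Sum>r<m. mat_diff C u t r * mat_diff X v t r)"
    unfolding qdf_bil bil_bivar[OF C X u] by (simp add: eq)
  also have "\<dots> = bil (bivar X C) u v t" unfolding sym[symmetric] bil_bivar[OF C X u] ..
  also have "\<dots> = (\<Sum>r<m. mat_diff X v t r * mat_diff C v t r)"
    unfolding bil_bivar[OF X C u] by (simp add: eq)
  also have "\<dots> = qdf (bivar C X) v t" unfolding sym qdf_bil bil_bivar[OF X C v] ..
  finally show ?thesis .
qed

lemma mat_diff_append_rows:
  assumes A: "A \<in> carrier_mat a w" and B: "B \<in> carrier_mat b w"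
  shows "i < a \<Longrightarrow> mat_diff (A @\<^sub>r B) v t i = mat_diff A v t i"
    and "i < b \<Longrightarrow> mat_diff (A @\<^sub>r B) v t (a + i) = mat_diff B v t i"
  using append_rows_index[OF A B] mat_diff_eq[OF carrier_append_rows[OF A B]] mat_diff_eq[OF A] mat_diff_eq[OF B]
  by simp_all

lemma observable_pair:
  assumes R: "R \<in> carrier_mat w w" "det R \<noteq> 0" and Q: "Q \<in> carrier_mat q w" and v: "v \<in> behavior w R"
    and obs: "\<And>z x. (\<forall>i<w. (\<Sum>j<w. cpoly (R $$ (i, j)) z * x j) = 0) \<Longrightarrow>
      (\<forall>i<q. (\<Sum>j<w. cpoly (Q $$ (i, j)) z * x j) = 0) \<Longrightarrow> \<forall>j<w. x j = 0"
    and Qv: "\<And>t i. i < q \<Longrightarrow> mat_diff Q v t i = 0"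
  shows "v t j = 0"
proof (cases "j < w")
  case True
  note b = behaviorD[OF v R(1)]
  show ?thesis
  proof (rule observable_zero[OF carrier_append_rows[OF R(1) Q] b(1) _ _ R(2) behavior_det[OF v R(1)] True])
    fix z x assume a: "\<forall>i<w + q. (\<Sum>j<w. cpoly ((R @\<^sub>r Q) $$ (i, j)) z * x j) = 0"
    show "\<forall>j<w. x j = 0"
      by (rule obs[of z]) (use a append_rows_index[OF R(1) Q] in \<open>simp_all add: all_less_add_iff\<close>)
  next
    fix t i assume "i < w + q"
    moreover have "\<forall>i<w + q. mat_diff (R @\<^sub>r Q) v t i = 0"
      unfolding all_less_add_iff using b(3) Qv by (simp add: mat_diff_append_rows[OF R(1) Q])
    ultimately show "mat_diff (R @\<^sub>r Q) v t i = 0" by blast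
  qed
qed (use behaviorD[OF v R(1)] in simp)

section \<open>One-sided limits at a switching instant\<close>

lemma interval_left:
  assumes fin: "finite (S \<inter> {t - 1..t})" and ev: "eventually P (at_left (t :: real))"
  obtains a where "a < t" "{a<..<t} \<inter> S = {}" "\<forall>\<tau>\<in>{a<..<t}. P \<tau>"
proof -
  obtain b where b: "b < t" "\<And>\<tau>. b < \<tau> \<Longrightarrow> \<tau> < t \<Longrightarrow> P \<tau>"
    using ev eventually_at_left[of "t - 1" t P] by auto
  \<comment> \<open>\<open>t\<close> itself is removed since it may be a switching time; the maximum
    of the rest lies strictly to its left.\<close>
  define F where "F = insert (t - 1) (insert b (S \<inter> {t - 1..t} - {t}))"
  have F: "finite F" "F \<noteq> {}" using fin by (auto simp: F_def)
  have "Max F \<in> F" using F by simp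
  hence "Max F < t" using b(1) by (auto simp: F_def)
  moreover have "b \<in> F" "t - 1 \<in> F" by (simp_all add: F_def)
  hence "b \<le> Max F" "t - 1 \<le> Max F" using Max_ge[OF F(1)] by blast+
  moreover have "\<tau> \<notin> S" if "Max F < \<tau>" "\<tau> < t" for \<tau>
  proof
    assume "\<tau> \<in> S"
    hence "\<tau> \<in> F" using that \<open>t - 1 \<le> Max F\<close> by (simp add: F_def)
    thus False using Max_ge[OF F(1), of \<tau>] that by simp
  qed
  ultimately show ?thesis using that[of "Max F"] b(2) by force
qed

lemma interval_right:
  assumes fin: "finite (S \<inter> {t..t + 1})" and ev: "eventually P (at_right (t :: real))"
  obtains a where "t < a" "{t<..<a} \<inter> S = {}" "\<forall>\<tau>\<in>{t<..<a}. P \<tau>"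
proof -
  obtain b where b: "t < b" "\<And>\<tau>. t < \<tau> \<Longrightarrow> \<tau> < b \<Longrightarrow> P \<tau>"
    using ev eventually_at_right[of t "t + 1" P] by auto
  define F where "F = insert (t + 1) (insert b (S \<inter> {t..t + 1} - {t}))"
  have F: "finite F" "F \<noteq> {}" using fin by (auto simp: F_def)
  have "Min F \<in> F" using F by simp
  hence "t < Min F" using b(1) by (auto simp: F_def)
  moreover have "b \<in> F" "t + 1 \<in> F" by (simp_all add: F_def)
  hence "Min F \<le> b" "Min F \<le> t + 1" using Min_le[OF F(1)] by blast+
  moreover have "\<tau> \<notin> S" if "t < \<tau>" "\<tau> < Min F" for \<tau>
  proof
    assume "\<tau> \<in> S"
    hence "\<tau> \<in> F" using that \<open>Min F \<le> t + 1\<close> by (simp add: F_def)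
    thus False using Min_le[OF F(1), of \<tau>] that by simp
  qed
  ultimately show ?thesis using that[of "Min F"] b(2) by force
qed

lemma switch_pieces:
  assumes traj: "slds_traj w R G s v" and k: "eventually (\<lambda>\<tau>. s \<tau> = k) (at_left t)"
  obtains a b ul ur where "a < t" "t < b" "ul \<in> behavior w (R k)" "ur \<in> behavior w (R (s t))"
    "\<forall>\<tau>\<in>{a<..<t}. v \<tau> = ul \<tau>" "\<forall>\<tau>\<in>{t<..<b}. v \<tau> = ur \<tau>"
proof -
  have sig: "switching_signal s" using traj by (simp add: slds_traj_def)
  have piece: "\<exists>u\<in>behavior w (R (s t0)). \<forall>\<tau>\<in>{a<..<b}. v \<tau> = u \<tau>"
    if "t0 \<in> {a<..<b}" "{a<..<b} \<inter> switch_times s = {}" for t0 a b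
  proof -
    have "is_interval {a<..<b} \<and> open {a<..<b} \<and> t0 \<in> {a<..<b} \<and> {a<..<b} \<inter> switch_times s = {}"
      using that by (simp add: is_interval_oo)
    thus ?thesis using traj unfolding slds_traj_def by blast
  qed
  have fin: "finite (switch_times s \<inter> {c..d})" for c d using sig unfolding switching_signal_def by blast
  obtain a where a: "a < t" "{a<..<t} \<inter> switch_times s = {}" "\<forall>\<tau>\<in>{a<..<t}. s \<tau> = k"
    by (rule interval_left[OF fin[of "t - 1" t] k])
  have kr: "eventually (\<lambda>\<tau>. s \<tau> = s t) (at_right t)" using sig unfolding switching_signal_def by blast
  obtain b where b: "t < b" "{t<..<b} \<inter> switch_times s = {}"
    "\<forall>\<tau>\<in>{t<..<b}. s \<tau> = s t"
    by (rule interval_right[OF fin[of t "t + 1"] kr])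
  have m: "(a + t) / 2 \<in> {a<..<t}" "(t + b) / 2 \<in> {t<..<b}" using a(1) b(1) by auto
  have sk: "s ((a + t) / 2) = k" "s ((t + b) / 2) = s t" using m a(3) b(3) by auto
  obtain ul where ul: "ul \<in> behavior w (R k)" "\<forall>\<tau>\<in>{a<..<t}. v \<tau> = ul \<tau>"
    using piece[OF m(1) a(2)] sk(1) by auto
  obtain ur where ur: "ur \<in> behavior w (R (s t))" "\<forall>\<tau>\<in>{t<..<b}. v \<tau> = ur \<tau>"
    using piece[OF m(2) b(2)] sk(2) by auto
  show ?thesis by (rule that[OF a(1) b(1) ul(1) ur(1) ul(2) ur(2)])
qed

lemma left_limit_eq:
  fixes f g :: "real \<Rightarrow> real"
  assumes "isCont f t" "a < t" "\<And>\<tau>. a < \<tau> \<Longrightarrow> \<tau> < t \<Longrightarrow> g \<tau> = f \<tau>"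
  shows "(g \<longlongrightarrow> f t) (at_left t)"
proof (rule Lim_transform_eventually)
  show "(f \<longlongrightarrow> f t) (at_left t)" using assms(1) by (simp add: isCont_def filterlim_at_split)
  show "\<forall>\<^sub>F x in at_left t. f x = g x"
    using assms(2,3) by (subst eventually_at_left[OF assms(2)]) auto
qed

lemma right_limit_eq:
  fixes f g :: "real \<Rightarrow> real"
  assumes "isCont f t" "t < b" "\<And>\<tau>. t < \<tau> \<Longrightarrow> \<tau> < b \<Longrightarrow> g \<tau> = f \<tau>"
  shows "(g \<longlongrightarrow> f t) (at_right t)"
proof (rule Lim_transform_eventually)
  show "(f \<longlongrightarrow> f t) (at_right t)" using assms(1) by (simp add: isCont_def filterlim_at_split)
  show "\<forall>\<^sub>F x in at_right t. f x = g x"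
    using assms(2,3) by (subst eventually_at_right[OF assms(2)]) auto
qed

lemma qdf_isCont: "T \<in> carrier_mat w w \<Longrightarrow> smooth_traj w v \<Longrightarrow> isCont (qdf T v) t"
  using qdf_has_deriv DERIV_isCont by blast

lemma mat_diff_isCont:
  assumes "smooth_traj w v" "M \<in> carrier_mat m w"
  shows "isCont (\<lambda>\<tau>. mat_diff M v \<tau> i) t"
  using smooth_has_deriv[OF mat_diff_smooth[OF assms, of i], of 0] DERIV_isCont by fastforce

text \<open>\<open>v\<close> need not be smooth at \<open>t\<close>, but on each side it coincides
  with a mode trajectory defined on the whole line; one-sided limits thus become values at
  \<open>t\<close> of these two trajectories.\<close>

lemma switch_limits:
  assumes traj: "slds_traj w R G s v" and t: "t \<in> switch_times s" and k: "eventually (\<lambda>\<tau>. s \<tau> = k) (at_left t)"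
    and R: "\<And>i. R i \<in> carrier_mat w w"
    and Gf: "fst (G k (s t)) \<in> carrier_mat m w" and Gs: "snd (G k (s t)) \<in> carrier_mat m w"
  obtains ul ur where "ul \<in> behavior w (R k)" "ur \<in> behavior w (R (s t))"
    "\<forall>T\<in>carrier_mat w w. (qdf T v \<longlongrightarrow> qdf T ul t) (at_left t)"
    "\<forall>T\<in>carrier_mat w w. (qdf T v \<longlongrightarrow> qdf T ur t) (at_right t)"
    "\<forall>i<m. mat_diff (snd (G k (s t))) ur t i = mat_diff (fst (G k (s t))) ul t i"
proof -
  obtain a b ul ur where ab: "a < t" "t < b" and ul: "ul \<in> behavior w (R k)" and ur: "ur \<in> behavior w (R (s t))"
    and vl: "\<forall>\<tau>\<in>{a<..<t}. v \<tau> = ul \<tau>" and vr: "\<forall>\<tau>\<in>{t<..<b}. v \<tau> = ur \<tau>"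
    by (rule switch_pieces[OF traj k])
  note sl = behaviorD(1)[OF ul R] and sr = behaviorD(1)[OF ur R]
  have ql: "(qdf T v \<longlongrightarrow> qdf T ul t) (at_left t)" if "T \<in> carrier_mat w w" for T
  proof (rule left_limit_eq[OF qdf_isCont[OF that sl] ab(1)])
    fix \<tau> assume "a < \<tau>" "\<tau> < t"
    thus "qdf T v \<tau> = qdf T ul \<tau>" using vl by (intro qdf_cong[of "{a<..<t}"]) auto
  qed
  have qr: "(qdf T v \<longlongrightarrow> qdf T ur t) (at_right t)" if "T \<in> carrier_mat w w" for T
  proof (rule right_limit_eq[OF qdf_isCont[OF that sr] ab(2)])
    fix \<tau> assume "t < \<tau>" "\<tau> < b"
    thus "qdf T v \<tau> = qdf T ur \<tau>" using vr by (intro qdf_cong[of "{t<..<b}"]) auto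
  qed
  have "mat_diff (snd (G k (s t))) ur t i = mat_diff (fst (G k (s t))) ul t i" if i: "i < m" for i
  proof -
    have d: "i < dim_row (fst (G k (s t)))" using i Gf by simp
    have "\<forall>t\<in>switch_times s. \<forall>k. eventually (\<lambda>\<tau>. s \<tau> = k) (at_left t) \<longrightarrow>
        (\<forall>i<dim_row (fst (G k (s t))). \<exists>L.
            ((\<lambda>\<tau>. mat_diff (snd (G k (s t))) v \<tau> i) \<longlongrightarrow> L) (at_right t) \<and>
            ((\<lambda>\<tau>. mat_diff (fst (G k (s t))) v \<tau> i) \<longlongrightarrow> L) (at_left t))"
      using traj unfolding slds_traj_def by (elim conjE)
    from this[rule_format, OF t k d] obtain L where L: "((\<lambda>\<tau>. mat_diff (snd (G k (s t))) v \<tau> i) \<longlongrightarrow> L) (at_right t)"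
      "((\<lambda>\<tau>. mat_diff (fst (G k (s t))) v \<tau> i) \<longlongrightarrow> L) (at_left t)"
      by (elim exE conjE)
    have "((\<lambda>\<tau>. mat_diff (fst (G k (s t))) v \<tau> i) \<longlongrightarrow> mat_diff (fst (G k (s t))) ul t i) (at_left t)"
    proof (rule left_limit_eq[OF mat_diff_isCont[OF sl Gf] ab(1)])
      fix \<tau> assume "a < \<tau>" "\<tau> < t"
      thus "mat_diff (fst (G k (s t))) v \<tau> i = mat_diff (fst (G k (s t))) ul \<tau> i"
        using vl by (intro mat_diff_cong[of "{a<..<t}"]) auto
    qed
    hence "L = mat_diff (fst (G k (s t))) ul t i" by (rule tendsto_unique[OF trivial_limit_at_left_real L(2)])
    moreover have "((\<lambda>\<tau>. mat_diff (snd (G k (s t))) v \<tau> i) \<longlongrightarrow> mat_diff (snd (G k (s t))) ur t i) (at_right t)"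
    proof (rule right_limit_eq[OF mat_diff_isCont[OF sr Gs] ab(2)])
      fix \<tau> assume "t < \<tau>" "\<tau> < b"
      thus "mat_diff (snd (G k (s t))) v \<tau> i = mat_diff (snd (G k (s t))) ur \<tau> i"
        using vr by (intro mat_diff_cong[of "{t<..<b}"]) auto
    qed
    hence "L = mat_diff (snd (G k (s t))) ur t i" by (rule tendsto_unique[OF trivial_limit_at_right_real L(1)])
    ultimately show ?thesis by simp
  qed
  thus ?thesis using that[OF ul ur] ql qr by simp
qed

lemma switch_modes:
  assumes sig: "switching_signal s" and t: "t \<in> switch_times s" and k: "eventually (\<lambda>\<tau>. s \<tau> = k) (at_left t)"
  shows "k = 1 \<and> s t = 2 \<or> k = 2 \<and> s t = 1"
proof -
  have "\<exists>\<tau>. s \<tau> = k" using eventually_happens'[OF trivial_limit_at_left_real k] by blast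
  hence "k \<in> {1, 2}" using sig unfolding switching_signal_def by metis
  moreover have "s t \<in> {1, 2}" using sig unfolding switching_signal_def by blast
  moreover have "s t \<noteq> k" using t k unfolding switch_times_def by auto
  ultimately show ?thesis by auto
qed

text \<open>A storage that decreases towards zero can never have been below it.\<close>

lemma nonneg_of_dissipation:
  fixes f f' :: "real \<Rightarrow> real"
  assumes "\<And>t. (f has_real_derivative f' t) (at t)" "\<And>t. f' t \<le> 0" "(f \<longlongrightarrow> 0) at_top"
  shows "0 \<le> f t"
proof (rule tendsto_upperbound[OF assms(3)])
  show "\<forall>\<^sub>F s in at_top. f s \<le> f t"
    using eventually_ge_at_top[of t]
  proof eventually_elim
    case (elim s)
    show ?case by (rule DERIV_nonpos_imp_nonincreasing[OF elim]) (use assms(1,2) in blast)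
  qed
qed simp

section \<open>Dissipation and the Lyapunov inequalities\<close>

context sp_pair
begin

text \<open>Both \<Phi> terms are products of R1 v and R2 v, so they vanish whichever mode is
  active; this is why one storage matrix serves both modes.\<close>

lemma qdf_dissipation:
  assumes Q: "Q \<in> carrier_mat q w"
    and Psi: "ddt_poly Psi = (bivar R1 R2 + bivar R2 R1) - bivar Q Q"
    and v: "v \<in> behavior w R1 \<or> v \<in> behavior w R2"
  shows "qdf (ddt_poly Psi) v t = - (\<Sum>r<q. (mat_diff Q v t r)\<^sup>2)"
proof -
  have s: "smooth_traj w v" using v behaviorD(1)[OF _ R1] behaviorD(1)[OF _ R2] by blast
  have c: "bivar R1 R2 \<in> carrier_mat w w" "bivar R2 R1 \<in> carrier_mat w w" "bivar Q Q \<in> carrier_mat w w"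
    using bivar_carrier R1 R2 Q by blast+
  have "(\<Sum>r<w. mat_diff R1 v t r * mat_diff R2 v t r) = 0" "(\<Sum>r<w. mat_diff R2 v t r * mat_diff R1 v t r) = 0"
    using v behaviorD(3)[OF _ R1] behaviorD(3)[OF _ R2] by auto
  thus ?thesis
    unfolding qdf_bil Psi bil_diff[OF add_carrier_mat[OF c(2)] c(3)] bil_add[OF c(1,2)]
      bil_bivar[OF R1 R2 s] bil_bivar[OF R2 R1 s] bil_bivar[OF Q Q s]
    by (simp add: power2_eq_square)
qed

text \<open>
  For \<open>R2(z) x = 0\<close> and \<open>Q(z) x = 0\<close> the identity \<open>\<Phi>(-z,z) = Q(-z)^T Q(z)\<close> reduces to
  \<open>R2(-z)^T R1(z) x = 0\<close>, and \<open>R2(-z)\<close> is invertible when \<open>Re z < 0\<close>.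
\<close>

lemma kernel_R2_Q:
  assumes Q: "para_factor q Q"
    and obs1: "\<And>z x. (\<forall>i<w. (\<Sum>j<w. cpoly (R1 $$ (i, j)) z * x j) = 0) \<Longrightarrow>
      (\<forall>i<q. (\<Sum>j<w. cpoly (Q $$ (i, j)) z * x j) = 0) \<Longrightarrow> \<forall>j<w. x j = 0"
    and x2: "\<forall>i<w. (\<Sum>j<w. cpoly (R2 $$ (i, j)) z * x j) = 0"
    and xQ: "\<forall>i<q. (\<Sum>j<w. cpoly (Q $$ (i, j)) z * x j) = 0"
  shows "\<forall>j<w. x j = 0"
proof (cases "Re z < 0")
  case False
  hence "cpoly d2 z \<noteq> 0" using hur2 by (auto simp: hurwitz_def)
  thus ?thesis using evalc_kernel[OF R2 _ x2[rule_format]] by blast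
next
  case True
  define y where "y r = (\<Sum>j<w. cpoly (R1 $$ (r, j)) z * x j)" for r
  have par: "(\<Sum>j<w. cpoly (\<Sum>r<m. neg_poly (M $$ (r, i)) * L $$ (r, j)) z * x j) =
    (\<Sum>r<m. cpoly (M $$ (r, i)) (- z) * (\<Sum>j<w. cpoly (L $$ (r, j)) z * x j))" for M L i m
  proof -
    have "(\<Sum>j<w. cpoly (\<Sum>r<m. neg_poly (M $$ (r, i)) * L $$ (r, j)) z * x j) =
      (\<Sum>j<w. \<Sum>r<m. cpoly (M $$ (r, i)) (- z) * (cpoly (L $$ (r, j)) z * x j))"
      by (simp add: cpoly_sum cpoly_mult cpoly_neg_poly sum_distrib_left sum_distrib_right mult_ac)
    also have "\<dots> = (\<Sum>r<m. \<Sum>j<w. cpoly (M $$ (r, i)) (- z) * (cpoly (L $$ (r, j)) z * x j))"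
      by (rule sum.swap)
    finally show ?thesis by (simp only: sum_distrib_left)
  qed
  have "(\<Sum>r<w. cpoly (R2 $$ (r, i)) (- z) * y r) = 0" if i: "i < w" for i
  proof -
    have "(\<Sum>j<w. cpoly ((\<Sum>r<w. neg_poly (R1 $$ (r, i)) * R2 $$ (r, j)) + (\<Sum>r<w. neg_poly (R2 $$ (r, i)) * R1 $$ (r, j))) z * x j)
       = (\<Sum>j<w. cpoly (\<Sum>r<q. neg_poly (Q $$ (r, i)) * Q $$ (r, j)) z * x j)"
      using Q i by (intro sum.cong refl) (simp add: para_factor_def)
    hence "(\<Sum>r<w. cpoly (R1 $$ (r, i)) (- z) * (\<Sum>j<w. cpoly (R2 $$ (r, j)) z * x j)) +
       (\<Sum>r<w. cpoly (R2 $$ (r, i)) (- z) * y r) =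
       (\<Sum>r<q. cpoly (Q $$ (r, i)) (- z) * (\<Sum>j<w. cpoly (Q $$ (r, j)) z * x j))"
      by (simp only: cpoly_add ring_distribs sum.distrib par y_def)
    thus ?thesis using x2 xQ by simp
  qed
  hence k: "(\<Sum>r<w. cpoly (transpose_mat R2 $$ (i, r)) (- z) * y r) = 0" if "i < w" for i using that R2 by simp
  have R2T: "transpose_mat R2 \<in> carrier_mat w w" "det (transpose_mat R2) = d2" using R2 det_transpose by auto
  have "cpoly (det (transpose_mat R2)) (- z) \<noteq> 0" unfolding R2T(2)
  proof
    assume "cpoly d2 (- z) = 0"
    hence "Re (- z) < 0" using hur2 unfolding hurwitz_def by blast
    thus False using True by simp
  qed
  hence "y r = 0" if "r < w" for r using evalc_kernel[OF R2T(1) _ k that] by simp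
  hence "\<forall>i<w. (\<Sum>j<w. cpoly (R1 $$ (i, j)) z * x j) = 0" by (simp add: y_def)
  thus ?thesis using obs1 xQ by blast
qed

theorem storage_function_multiple_lyapunov:
  fixes X2 X1' :: "real poly mat" and Pm :: "real mat"
  assumes X2: "X2 \<in> carrier_mat n2 w" "row_basis X2 R2"
    and X1': "X1' \<in> carrier_mat n1' w" "row_basis (X2 @\<^sub>r X1') R1"
    and Pm: "Pm \<in> carrier_mat n1' n2" and modX: "rmod X1' R2 = const_mat Pm * X2"
    and Q: "good_factor w R1 (bivar R1 R2 + bivar R2 R1) Q"
  shows "\<exists>Psi1. ddt_poly Psi1 = (bivar R1 R2 + bivar R2 R1) - bivar Q Q \<and> canonical Psi1 R1 \<and>
    multiple_lyapunov w (std_modes R1 R2) (std_gluing X2 X1' Pm) (\<lambda>i. if i = 1 then Psi1 else bimod Psi1 R2)"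
proof -
  define q where "q = dim_row Q"
  have Qc: "Q \<in> carrier_mat q w" using Q by (auto simp: good_factor_def q_def)
  have pf: "para_factor q Q" using Q para_factor_iff[OF Qc] by (simp add: good_factor_def)
  have rQ: "right_sp Q R1" using Q by (simp add: good_factor_def)
  have obs1: "\<forall>j<w. x j = 0" if "\<forall>i<w. (\<Sum>j<w. cpoly (R1 $$ (i, j)) z * x j) = 0"
      "\<forall>i<q. (\<Sum>j<w. cpoly (Q $$ (i, j)) z * x j) = 0" for z x
  proof -
    have "vec_space.rank (dim_row R1 + dim_row Q) (evalc (R1 @\<^sub>r Q) z) = w"
      using Q by (simp add: good_factor_def)
    thus ?thesis unfolding full_rank_stack[OF R1 Qc] using that by blast
  qed
  have c: "bivar R1 R2 \<in> carrier_mat w w" "bivar R2 R1 \<in> carrier_mat w w" "bivar Q Q \<in> carrier_mat w w"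
    using bivar_carrier R1 R2 Qc by blast+
  have c12: "bivar R1 R2 + bivar R2 R1 \<in> carrier_mat w w" using c by simp
  \<comment> \<open>Vanishing at (-\<xi>,\<xi>) is what permits the division by \<zeta> +
    \<eta>.\<close>
  have "para_eval (((bivar R1 R2 + bivar R2 R1) - bivar Q Q) $$ (i, j)) = 0" if ij: "i < w" "j < w" for i j
  proof -
    have "((bivar R1 R2 + bivar R2 R1) - bivar Q Q) $$ (i, j) = bivar R1 R2 $$ (i, j) + bivar R2 R1 $$ (i, j) - bivar Q Q $$ (i, j)"
      using ij c by simp
    thus ?thesis
      using pf ij by (simp add: para_eval_diff para_eval_add para_eval_bivar[OF R1 R2] para_eval_bivar[OF R2 R1]
        para_eval_bivar[OF Qc Qc] para_factor_def)
  qed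
  then obtain Psi where Psi: "Psi \<in> carrier_mat w w" "ddt_poly Psi = (bivar R1 R2 + bivar R2 R1) - bivar Q Q"
    using ddt_poly_divide[OF minus_carrier_mat[OF c(3)]] by blast
  obtain V T where rP: "\<And>h. right_sp (zslice Psi h) R1" and V: "V \<in> carrier_mat w w" and T: "T \<in> carrier_mat w w"
    and PsiT: "Psi = T + bivar (const_mat V * R2) R2" and rT: "\<And>h. right_sp (zslice T h) R2"
    and sP: "bisym w Psi" and sT: "bisym w T"
    and psd: "\<And>y. (\<Sum>r<w. \<Sum>j<w. V $$ (r, j) * y j * y r) \<ge> 0"
    using storage_decomposition[OF pf rQ Psi] by blast
  define X1 where "X1 = X2 @\<^sub>r X1'"
  have X1: "X1 \<in> carrier_mat (n2 + n1') w" unfolding X1_def by (rule carrier_append_rows[OF X2(1) X1'(1)])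
  have rX1: "row_basis X1 R1" using X1'(2) by (simp add: X1_def)
  obtain C1 where C1: "C1 \<in> carrier_mat (n2 + n1') w" "Psi = bivar C1 X1"
    by (rule bivar_of_row_basis[OF R1 Psi(1) rP X1 rX1])
  obtain C2 where C2: "C2 \<in> carrier_mat n2 w" "T = bivar C2 X2"
    by (rule bivar_of_row_basis[OF R2 T rT X2])
  have sym1: "bivar C1 X1 = bivar X1 C1" using bisym_bivar_swap[OF C1(1) X1] sP C1(2) by simp
  have sym2: "bivar C2 X2 = bivar X2 C2" using bisym_bivar_swap[OF C2(1) X2(1)] sT C2(2) by simp
  have can: "canonical Psi R1"
    using canonical_bivar[OF R1 d1_nz X1 _ C1(1) sym1] rX1 C1(2) by (simp add: row_basis_def)
  define Psi2 where "Psi2 = bimod Psi R2"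
  have Psi2: "Psi2 \<in> carrier_mat w w" unfolding Psi2_def C1(2) by (rule bimod_carrier[OF R2 d2_nz C1(1) X1])
  have q2: "qdf Psi2 v t = qdf Psi v t" if "v \<in> behavior w R2" for v t
    unfolding Psi2_def C1(2) by (rule qdf_bimod[OF that R2 d2_nz C1(1) X1])
  have ddt: "qdf (ddt_poly Psi) v t = - (\<Sum>r<q. (mat_diff Q v t r)\<^sup>2)"
    if "v \<in> behavior w R1 \<or> v \<in> behavior w R2" for v t
    by (rule qdf_dissipation[OF Qc Psi(2) that])
  \<comment> \<open>The derivative of the reduced form is not expanded: the two functions of time
    coincide along mode 2, hence so do their derivatives.\<close>
  have ddt2: "qdf (ddt_poly Psi2) v t = qdf (ddt_poly Psi) v t" if v: "v \<in> behavior w R2" for v t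
  proof -
    have s: "smooth_traj w v" by (rule behaviorD(1)[OF v R2])
    have "qdf Psi2 v = qdf Psi v" using q2[OF v] by auto
    thus ?thesis using qdf_has_deriv[OF Psi2 s, of t] qdf_has_deriv[OF Psi(1) s, of t] DERIV_unique by metis
  qed
  have nonpos: "- (\<Sum>r<q. (mat_diff Q v t r)\<^sup>2) \<le> 0" for v t by (simp add: sum_nonneg)
  have nonneg: "0 \<le> qdf Psi v t" if v: "v \<in> behavior w R" and R: "R = R1 \<or> R = R2" for v t R
  proof (rule nonneg_of_dissipation[where f = "qdf Psi v" and f' = "qdf (ddt_poly Psi) v"])
    have RR: "R \<in> carrier_mat w w" "hurwitz R" using R R1 R2 hur1 hur2 by auto
    show "(qdf Psi v has_real_derivative qdf (ddt_poly Psi) v t) (at t)" for t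
      by (rule qdf_has_deriv[OF Psi(1) behaviorD(1)[OF v RR(1)]])
    show "qdf (ddt_poly Psi) v t \<le> 0" for t using ddt[of v t] nonpos v R by auto
    show "(qdf Psi v \<longlongrightarrow> 0) at_top" by (rule qdf_decay[OF v RR Psi(1)])
  qed
  have strict: "v t j = 0" if v: "v \<in> behavior w R" and R: "R = R1 \<or> R = R2" and z: "\<And>t. qdf (ddt_poly Psi) v t = 0" for v t j R
  proof -
    have Qv: "mat_diff Q v t r = 0" if "r < q" for t r
    proof -
      have "(\<Sum>r<q. (mat_diff Q v t r)\<^sup>2) = 0" using ddt[of v t] z[of t] v R by auto
      thus ?thesis using that by (simp add: sum_nonneg_eq_0_iff)
    qed
    show ?thesis using R
    proof
      assume R: "R = R1"
      show ?thesis by (rule observable_pair[OF R1 d1_nz Qc _ obs1 Qv]) (use v R in auto)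
    next
      assume R: "R = R2"
      show ?thesis by (rule observable_pair[OF R2 d2_nz Qc _ kernel_R2_Q[OF pf obs1] Qv]) (use v R in auto)
    qed
  qed
  \<comment> \<open>Along mode 2 the \<open>V\<close> term vanishes together with R2 v; along mode 1
    it is the nonnegative surplus that a switch to mode 2 discards.\<close>
  have split: "qdf Psi v t = qdf T v t + (\<Sum>r<w. \<Sum>j<w. V $$ (r, j) * mat_diff R2 v t j * mat_diff R2 v t r)"
    if s: "smooth_traj w v" for v t
  proof -
    have cV: "const_mat V * R2 \<in> carrier_mat w w" using V R2 by simp
    have "qdf Psi v t = qdf T v t + (\<Sum>r<w. mat_diff (const_mat V * R2) v t r * mat_diff R2 v t r)"
      unfolding qdf_bil PsiT bil_add[OF T bivar_carrier[OF cV R2]] bil_bivar[OF cV R2 s] ..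
    thus ?thesis by (simp add: mat_diff_const_mult[OF s V R2] sum_distrib_right)
  qed
  let ?R = "std_modes R1 R2" and ?G = "std_gluing X2 X1' Pm" and ?P = "\<lambda>i::nat. if i = 1 then Psi else Psi2"
  have cR: "?R i \<in> carrier_mat w w" for i using R1 R2 by (simp add: std_modes_def)
  have sw: "\<exists>a b. (qdf (?P k) v \<longlongrightarrow> a) (at_left t) \<and> (qdf (?P (s t)) v \<longlongrightarrow> b) (at_right t) \<and> b \<le> a"
    if traj: "slds_traj w ?R ?G s v" and t: "t \<in> switch_times s" and k: "eventually (\<lambda>\<tau>. s \<tau> = k) (at_left t)" for s v t k
  proof -
    have sig: "switching_signal s" using traj by (simp add: slds_traj_def)
    from switch_modes[OF sig t k] show ?thesis
    proof
      assume m: "k = 1 \<and> s t = 2"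
      have G: "?G k (s t) = (X2, X2)" using m by (simp add: std_gluing_def)
      obtain ul ur where u: "ul \<in> behavior w (?R k)" "ur \<in> behavior w (?R (s t))"
        and ql: "\<forall>T\<in>carrier_mat w w. (qdf T v \<longlongrightarrow> qdf T ul t) (at_left t)"
        and qr: "\<forall>T\<in>carrier_mat w w. (qdf T v \<longlongrightarrow> qdf T ur t) (at_right t)"
        and gl: "\<forall>i<n2. mat_diff (snd (?G k (s t))) ur t i = mat_diff (fst (?G k (s t))) ul t i"
        by (rule switch_limits[OF traj t k cR, of n2]) (use G X2 in simp_all)
      have ul: "ul \<in> behavior w R1" and ur: "ur \<in> behavior w R2" using u m by (simp_all add: std_modes_def)
      note sl = behaviorD(1)[OF ul R1] and sr = behaviorD(1)[OF ur R2]
      have "qdf T ur t = qdf T ul t"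
        unfolding C2(2) by (rule qdf_state[OF C2(1) X2(1) sym2 sr sl]) (use gl G in simp)
      moreover have "qdf Psi2 ur t = qdf T ur t"
        using q2[OF ur] split[OF sr, of t] behaviorD(3)[OF ur R2] by simp
      ultimately have "qdf Psi2 ur t \<le> qdf Psi ul t" using split[OF sl, of t] psd[of "mat_diff R2 ul t"] by simp
      thus ?thesis using m ql Psi(1) qr Psi2 by (intro exI[of _ "qdf Psi ul t"] exI[of _ "qdf Psi2 ur t"]) simp
    next
      assume m: "k = 2 \<and> s t = 1"
      have G: "?G k (s t) = (X2 @\<^sub>r (const_mat Pm * X2), X1)" using m by (simp add: std_gluing_def X1_def)
      have PX: "const_mat Pm * X2 \<in> carrier_mat n1' w" using Pm X2 by simp
      have XP: "X2 @\<^sub>r (const_mat Pm * X2) \<in> carrier_mat (n2 + n1') w" by (rule carrier_append_rows[OF X2(1) PX])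
      obtain ul ur where u: "ul \<in> behavior w (?R k)" "ur \<in> behavior w (?R (s t))"
        and ql: "\<forall>T\<in>carrier_mat w w. (qdf T v \<longlongrightarrow> qdf T ul t) (at_left t)"
        and qr: "\<forall>T\<in>carrier_mat w w. (qdf T v \<longlongrightarrow> qdf T ur t) (at_right t)"
        and gl: "\<forall>i<n2 + n1'. mat_diff (snd (?G k (s t))) ur t i = mat_diff (fst (?G k (s t))) ul t i"
        by (rule switch_limits[OF traj t k cR, of "n2 + n1'"]) (use G XP X1 in simp_all)
      have ul: "ul \<in> behavior w R2" and ur: "ur \<in> behavior w R1" using u m by (simp_all add: std_modes_def)
      note sl = behaviorD(1)[OF ul R2] and sr = behaviorD(1)[OF ur R1]
      have "mat_diff (const_mat Pm * X2) ul t i = mat_diff X1' ul t i" if "i < n1'" for i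
        using mat_diff_rmod[OF ul R2 d2_nz X1'(1) that] modX by simp
      hence "\<forall>i<n2 + n1'. mat_diff (X2 @\<^sub>r (const_mat Pm * X2)) ul t i = mat_diff X1 ul t i"
        unfolding all_less_add_iff X1_def
        by (simp add: mat_diff_append_rows[OF X2(1) PX] mat_diff_append_rows[OF X2(1) X1'(1)])
      hence "qdf Psi ur t = qdf Psi ul t"
        unfolding C1(2) by (intro qdf_state[OF C1(1) X1 sym1 sr sl]) (use gl G in simp)
      hence "qdf Psi ur t \<le> qdf Psi2 ul t" using q2[OF ul] by simp
      thus ?thesis using m ql Psi(1) qr Psi2 by (intro exI[of _ "qdf Psi2 ul t"] exI[of _ "qdf Psi ur t"]) simp
    qed
  qed
  have "multiple_lyapunov w ?R ?G ?P"
    unfolding multiple_lyapunov_def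
  proof (intro conjI ballI allI impI)
    fix i :: nat and v assume i: "i \<in> {1, 2}" and v: "v \<in> behavior w (?R i)"
    show "0 \<le> qdf (?P i) v t" for t
      using i v nonneg[of v R1] nonneg[of v R2] q2[of v] by (auto simp: std_modes_def)
    show "qdf (ddt_poly (?P i)) v t \<le> 0" for t
      using i v ddt[of v t] ddt2[of v t] nonpos[of v t] by (auto simp: std_modes_def)
    show "v t j = 0" if "\<forall>t. qdf (ddt_poly (?P i)) v t = 0" for t j
      using i v that strict[of v R1] strict[of v R2] ddt2[of v] by (auto simp: std_modes_def)
  next
    fix s v t k assume "slds_traj w ?R ?G s v" "t \<in> switch_times s" "eventually (\<lambda>\<tau>. s \<tau> = k) (at_left t)"
    from sw[OF this] show "\<exists>a b. (qdf (?P k) v \<longlongrightarrow> a) (at_left t) \<and> (qdf (?P (s t)) v \<longlongrightarrow> b) (at_right t) \<and> b \<le> a" .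
  qed
  thus ?thesis using Psi(2) can unfolding Psi2_def by blast
qed

end

text \<open>The quotient by \<zeta> + \<eta> is multiplied out into an equation for
  \<open>ddt_poly Psi1\<close>; since \<zeta> + \<eta> is not a zero divisor, that equation
  determines \<open>Psi1\<close>.\<close>

theorem theorem4:
  fixes w :: nat and R1 R2 X2 X1' :: "real poly mat" and Pm :: "real mat"
  assumes R1: "R1 \<in> carrier_mat w w" and R2: "R2 \<in> carrier_mat w w"
    and hur1: "hurwitz R1" and hur2: "hurwitz R2"
    and sp: "right_sp R2 R1"
    and spr: "strictly_positive_real (R2 * adj_mat R1) (det R1)"
    and X2: "X2 \<in> carrier_mat (degree (det R2)) w" "row_basis X2 R2"
    and X1': "X1' \<in> carrier_mat (degree (det R1) - degree (det R2)) w" "row_basis (X2 @\<^sub>r X1') R1"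
    and Pm: "Pm \<in> carrier_mat (degree (det R1) - degree (det R2)) (degree (det R2))"
    and modX: "rmod X1' R2 = const_mat Pm * X2"
  shows "(\<exists>Q. good_factor w R1 (bivar R1 R2 + bivar R2 R1) Q) \<and>
    (\<forall>Q. good_factor w R1 (bivar R1 R2 + bivar R2 R1) Q \<longrightarrow>
       (\<exists>Psi1. ddt_poly Psi1 = (bivar R1 R2 + bivar R2 R1) - bivar Q Q \<and>
          canonical Psi1 R1 \<and>
          multiple_lyapunov w (std_modes R1 R2) (std_gluing X2 X1' Pm)
             (\<lambda>i. if i = 1 then Psi1 else bimod Psi1 R2)))"
proof -
  interpret sp_pair w R1 R2
    using R1 R2 hur1 hur2 sp spr by unfold_locales
  show ?thesis
    using good_factor_exists storage_function_multiple_lyapunov[OF X2 X1' Pm modX] by blast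
qed

end
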